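(* The maps $J_1,J_2,J_3$, where $J_n\colon\mathbb{Q}[\mathbb{C}(t)]_n\to\mathbb{S}_*^{n-1,1}A$, are surjective. Equivalently, they induce isomorphisms $$\frac{\mathbb{Q}[\mathbb{C}(t)]_1}{\mathcal{A}_1}\cong A,\qquad \frac{\mathbb{Q}[\mathbb{C}(t)]_2}{\mathcal{A}_2}\cong A\wedge A,\qquad \frac{\mathbb{Q}[\mathbb{C}(t)]_3}{\mathcal{A}_3}\cong\frac{Sym^2A\otimes A}{Sym^3A}.$$
   Context: **Polylogarithms.** $Li_n(z)=\sum_{k\ge1} z^k/k^n$ for $|z|<1$, continued analytically (as a multivalued function) to $\mathbb{CP}^1\setminus\{0,1,\infty\}$ by $Li_1(z)=-\log(1-z)$, $Li_n(z)=\int_0^z Li_{n-1}(t)\frac{dt}{t}$. Zagier's polylogarithm is $\mathcal{L}i_1(z)=\log|z|$ and, for $n\ge2$, $$\mathcal{L}i_n(z)=\Re_n\Big(\sum_{k=0}^{n-1}\beta_k \log^k|z|\cdot Li_{n-k}(z)\Big),\qquad \frac{2x}{e^{2x}-1}=\sum_{k\ge0}\beta_kx^k,$$ where $\Re_n$ is the real part for $n$ odd and the imaginary part for $n$ even. For $n\ge 2$ it is single-valued and extends continuously to $\mathbb{CP}^1$, and it is real analytic on $\mathbb{CP}^1\setminus\{0,1,\infty\}$. **The group $\mathcal{A}_n$.** For a set $S$, $\mathbb{Q}[S]$ is the $\mathbb{Q}$-vector space with basis $[s]$, $s\in S$. $\mathbb{Q}[\mathbb{C}(t)]_n$ is just $\mathbb{Q}[\mathbb{C}(t)]$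 (the subscript records the weight). $\mathcal{A}_n\subset\mathbb{Q}[\mathbb{C}(t)]_n$ is the subspace of all $\sum_i n_i[\varphi_i]$ ($n_i\in\mathbb{Q}$, $\varphi_i\in\mathbb{C}(t)$) such that $\sum_i n_i\,\mathcal{L}i_n(\varphi_i(t))$ is constant as a function of $t$ (where defined). Convention: constant $\varphi$ (including $\varphi=0,1$) give elements $[\varphi]\in\mathcal{A}_n$. **Divisors.** $A$ is the $\mathbb{Q}$-vector space of degree zero divisors on $\mathbb{CP}^1$, written inhomogeneously: we put $[\infty]=0$, so $A$ has basis $[p]$, $p\in\mathbb{C}$. For nonzero $\varphi\in\mathbb{C}(t)$, $(\varphi)\in A$ is its divisor. **$\mathbb{S}_*^{n-1,1}$ and $J_n$.** For a $\mathbb{Q}$-vector space $V$ and $n\ge2$, $\mathbb{S}_*^{n-1,1}V=(Sym^{n-1}V\otimes V)/Sym^nV$, where $Sym^nV$ is embedded by $x_1\cdots x_n\mapsto\sum_i x_1\cdots\widehat{x_i}\cdots x_n\otimes x_i$; for $n=1$, $\mathbb{S}_*^{0,1}V=V$. In particular $\mathbb{S}_*^{1,1}V=V\wedge V$. The linear map $J_n$ is given by $J_n([\varphi])=(\varphi)^{n-1}\otimes(1-\varphi)$ for $n\ge2$ (here $(1-\varphi)$ is the divisor of $1-\varphi$) and $J_1([\varphi])=(\varphi)$; by convention $J_n([0])=J_n([1])=0$. *)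

theory Defs
  imports
    "HOL-Complex_Analysis.Complex_Analysis"
    "HOL-Computational_Algebra.Computational_Algebra"
    "HOL-Computational_Algebra.Field_as_Ring"
    "HOL-Library.Poly_Mapping"
    "HOL-Library.Multiset"
    "HOL-Algebra.AbelCoset"
    "HOL-Algebra.Module"
begin

section \<open>Vector spaces over the rationals\<close>

text \<open>Rational vector spaces are modules, in the sense of \<^locale>\<open>module\<close>, over the field
  \<open>rat_ring\<close>. The record type also has the ring components \<^const>\<open>mult\<close> and \<^const>\<open>one\<close>, which play
  no role for modules and are left unspecified.\<close>

definition rat_ring :: "rat ring" where
  "rat_ring = \<lparr>carrier = UNIV, mult = (*), one = 1, zero = 0, add = (+)\<rparr>"

definition free_space :: "'s set \<Rightarrow> (rat, 's \<Rightarrow>\<^sub>0 rat) module" where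
  "free_space S = \<lparr>carrier = {f. Poly_Mapping.keys f \<subseteq> S}, mult = undefined, one = undefined,
     zero = 0, add = (+), smult = (\<lambda>q. Poly_Mapping.map ((*) q))\<rparr>"

abbreviation gen :: "'s \<Rightarrow> 's \<Rightarrow>\<^sub>0 rat" where
  "gen s \<equiv> Poly_Mapping.single s 1"

definition lin_span :: "(rat, 'v) module \<Rightarrow> 'v set \<Rightarrow> 'v set" where
  "lin_span M X = \<Inter>{N. submodule N rat_ring M \<and> X \<subseteq> N}"

text \<open>In a quotient, \<open>q \<odot> X\<close> is the coset of the elements \<open>q \<odot> x\<close>, \<open>x \<in> X\<close>; adding \<open>U\<close> is needed
  because for \<open>q = 0\<close> these elements alone do not fill a coset.\<close>

definition quot_space :: "(rat, 'v) module \<Rightarrow> 'v set \<Rightarrow> (rat, 'v set) module" where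
  "quot_space M U = \<lparr>carrier = a_rcosets\<^bsub>M\<^esub> U, mult = undefined, one = undefined,
     zero = U, add = set_add M, smult = (\<lambda>q X. U <+>\<^bsub>M\<^esub> ((\<lambda>x. q \<odot>\<^bsub>M\<^esub> x) ` X))\<rparr>"

definition lin_iso :: "(rat, 'v) module \<Rightarrow> (rat, 'w) module \<Rightarrow> ('v \<Rightarrow> 'w) set" where
  "lin_iso M N = {h \<in> iso (add_monoid M) (add_monoid N).
     \<forall>q. \<forall>x\<in>carrier M. h (q \<odot>\<^bsub>M\<^esub> x) = q \<odot>\<^bsub>N\<^esub> h x}"

definition induces_iso ::
    "(rat, 'v) module \<Rightarrow> 'v set \<Rightarrow> (rat, 'w) module \<Rightarrow> ('v \<Rightarrow> 'w) \<Rightarrow> bool" where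
  "induces_iso M U N f \<longleftrightarrow>
     (\<exists>h \<in> lin_iso (quot_space M U) N. \<forall>x\<in>carrier M. h (U +>\<^bsub>M\<^esub> x) = f x)"

definition lin_extend :: "(rat, 'v) module \<Rightarrow> ('s \<Rightarrow> 'v) \<Rightarrow> ('s \<Rightarrow>\<^sub>0 rat) \<Rightarrow> 'v" where
  "lin_extend M g x =
     (\<Oplus>\<^bsub>M\<^esub>s\<in>Poly_Mapping.keys x. Poly_Mapping.lookup x s \<odot>\<^bsub>M\<^esub> g s)"


section \<open>Tensor products, symmetric powers and the functor \<open>S\<^sub>*\<close>\<close>

definition tensor_rel :: "(rat, 'v) module \<Rightarrow> (rat, 'w) module \<Rightarrow> ('v \<times> 'w \<Rightarrow>\<^sub>0 rat) set" where
  "tensor_rel M N =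
     {gen (u \<oplus>\<^bsub>M\<^esub> v, y) - gen (u, y) - gen (v, y) | u v y.
        u \<in> carrier M \<and> v \<in> carrier M \<and> y \<in> carrier N}
   \<union> {gen (x, u \<oplus>\<^bsub>N\<^esub> v) - gen (x, u) - gen (x, v) | x u v.
        x \<in> carrier M \<and> u \<in> carrier N \<and> v \<in> carrier N}
   \<union> {gen (q \<odot>\<^bsub>M\<^esub> x, y) - Poly_Mapping.single (x, y) q | q x y.
        x \<in> carrier M \<and> y \<in> carrier N}
   \<union> {gen (x, q \<odot>\<^bsub>N\<^esub> y) - Poly_Mapping.single (x, y) q | q x y.
        x \<in> carrier M \<and> y \<in> carrier N}"

definition tensor_null :: "(rat, 'v) module \<Rightarrow> (rat, 'w) module \<Rightarrow> ('v \<times> 'w \<Rightarrow>\<^sub>0 rat) set" where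
  "tensor_null M N = lin_span (free_space (carrier M \<times> carrier N)) (tensor_rel M N)"

definition tensor ::
    "(rat, 'v) module \<Rightarrow> (rat, 'w) module \<Rightarrow> (rat, ('v \<times> 'w \<Rightarrow>\<^sub>0 rat) set) module" where
  "tensor M N = quot_space (free_space (carrier M \<times> carrier N)) (tensor_null M N)"

definition pure_tensor ::
    "(rat, 'v) module \<Rightarrow> (rat, 'w) module \<Rightarrow> 'v \<Rightarrow> 'w \<Rightarrow> ('v \<times> 'w \<Rightarrow>\<^sub>0 rat) set" where
  "pure_tensor M N x y =
     tensor_null M N +>\<^bsub>free_space (carrier M \<times> carrier N)\<^esub> gen (x, y)"

definition tuples :: "nat \<Rightarrow> (rat, 'v) module \<Rightarrow> 'v list set" where
  "tuples k V = {xs. length xs = k \<and> set xs \<subseteq> carrier V}"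

definition sym_rel :: "nat \<Rightarrow> (rat, 'v) module \<Rightarrow> ('v list \<Rightarrow>\<^sub>0 rat) set" where
  "sym_rel k V =
     {gen (xs @ [u \<oplus>\<^bsub>V\<^esub> v] @ ys) - gen (xs @ [u] @ ys) - gen (xs @ [v] @ ys) | xs u v ys.
        xs @ [u] @ ys \<in> tuples k V \<and> xs @ [v] @ ys \<in> tuples k V}
   \<union> {gen (xs @ [q \<odot>\<^bsub>V\<^esub> u] @ ys) - Poly_Mapping.single (xs @ [u] @ ys) q | xs q u ys.
        xs @ [u] @ ys \<in> tuples k V}
   \<union> {gen xs - gen ys | xs ys. xs \<in> tuples k V \<and> ys \<in> tuples k V \<and> mset xs = mset ys}"

definition sym_null :: "nat \<Rightarrow> (rat, 'v) module \<Rightarrow> ('v list \<Rightarrow>\<^sub>0 rat) set" where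
  "sym_null k V = lin_span (free_space (tuples k V)) (sym_rel k V)"

definition sym_power :: "nat \<Rightarrow> (rat, 'v) module \<Rightarrow> (rat, ('v list \<Rightarrow>\<^sub>0 rat) set) module" where
  "sym_power k V = quot_space (free_space (tuples k V)) (sym_null k V)"

definition sym_prod :: "(rat, 'v) module \<Rightarrow> 'v list \<Rightarrow> ('v list \<Rightarrow>\<^sub>0 rat) set" where
  "sym_prod V xs = sym_null (length xs) V +>\<^bsub>free_space (tuples (length xs) V)\<^esub> gen xs"

type_synonym 'v sym_tensor = "(('v list \<Rightarrow>\<^sub>0 rat) set \<times> 'v \<Rightarrow>\<^sub>0 rat) set"

text \<open>The image of \<open>Sym\<^sup>n V\<close> in \<open>Sym\<^sup>n\<^sup>-\<^sup>1 V \<otimes> V\<close> under the linear map sending \<open>x\<^sub>1 \<cdots> x\<^sub>n\<close> to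
  the sum over \<open>i\<close> of (the product of the \<open>x\<^sub>j\<close>, \<open>j \<noteq> i\<close>) \<open>\<otimes> x\<^sub>i\<close>.\<close>

definition sym_image :: "nat \<Rightarrow> (rat, 'v) module \<Rightarrow> 'v sym_tensor set" where
  "sym_image n V = lin_span (tensor (sym_power (n - 1) V) V)
     {\<Oplus>\<^bsub>tensor (sym_power (n - 1) V) V\<^esub>i\<in>{..<n}.
        pure_tensor (sym_power (n - 1) V) V (sym_prod V (take i xs @ drop (Suc i) xs)) (xs ! i)
      | xs. xs \<in> tuples n V}"

text \<open>\<open>S_star n V\<close> is the space \<open>S\<^sub>*\<^sup>n\<^sup>-\<^sup>1\<^sup>,\<^sup>1 V\<close> for \<open>n \<ge> 2\<close>. For \<open>n = 1\<close> that space is by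
  convention \<open>V\<close> itself, which is not an instance of this quotient.\<close>

definition S_star :: "nat \<Rightarrow> (rat, 'v) module \<Rightarrow> (rat, 'v sym_tensor set) module" where
  "S_star n V = quot_space (tensor (sym_power (n - 1) V) V) (sym_image n V)"


section \<open>Rational functions and their divisors\<close>

type_synonym ratfun = "complex poly fract"

definition numer :: "ratfun \<Rightarrow> complex poly" where
  "numer \<phi> = fst (quot_of_fract \<phi>)"

definition denom :: "ratfun \<Rightarrow> complex poly" where
  "denom \<phi> = snd (quot_of_fract \<phi>)"

definition const_ratfun :: "ratfun \<Rightarrow> bool" where
  "const_ratfun \<phi> \<longleftrightarrow> (\<exists>c. \<phi> = to_fract [:c:])"

text \<open>Numerator and denominator are coprime, so the poles in \<open>\<complex>\<close> are the roots of the denominator.\<close>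

definition finite_at :: "ratfun \<Rightarrow> complex \<Rightarrow> bool" where
  "finite_at \<phi> t \<longleftrightarrow> poly (denom \<phi>) t \<noteq> 0"

definition value_at :: "ratfun \<Rightarrow> complex \<Rightarrow> complex" where
  "value_at \<phi> t = poly (numer \<phi>) t / poly (denom \<phi>) t"

text \<open>Degree zero divisors on the Riemann sphere with \<open>[\<infinity>] = 0\<close>: the space with basis \<open>[p]\<close>,
  \<open>p \<in> \<complex>\<close>.\<close>

abbreviation Div :: "(rat, complex \<Rightarrow>\<^sub>0 rat) module" where
  "Div \<equiv> free_space UNIV"

definition poly_divisor :: "complex poly \<Rightarrow> complex \<Rightarrow>\<^sub>0 rat" where
  "poly_divisor f = (\<Sum>p | poly f p = 0. Poly_Mapping.single p (of_nat (Polynomial.order p f)))"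

definition divisor :: "ratfun \<Rightarrow> complex \<Rightarrow>\<^sub>0 rat" where
  "divisor \<phi> = poly_divisor (numer \<phi>) - poly_divisor (denom \<phi>)"


section \<open>Polylogarithms\<close>

text \<open>The branch on \<open>\<complex> - [1, \<infinity>)\<close> which vanishes at \<open>0\<close>. It is obtained by integration along straight
  segments from \<open>0\<close>; the value of the integrand at the endpoint \<open>0\<close> is immaterial. The case \<open>0\<close>
  is the usual \<open>Li\<^sub>0\<close> and is not used.\<close>

fun polylog :: "nat \<Rightarrow> complex \<Rightarrow> complex" where
  "polylog 0 z = z / (1 - z)"
| "polylog (Suc 0) z = - Ln (1 - z)"
| "polylog (Suc (Suc n)) z = contour_integral (linepath 0 z) (\<lambda>t. polylog (Suc n) t / t)"

definition zagier_beta :: "nat \<Rightarrow> real" where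
  "zagier_beta k = fps_nth (2 * fps_X / (fps_exp 2 - 1)) k"

definition Re_n :: "nat \<Rightarrow> complex \<Rightarrow> real" where
  "Re_n n w = (if odd n then Re w else Im w)"

definition branch_cut :: "complex set" where
  "branch_cut = complex_of_real ` {1..}"

definition zagier_formula :: "nat \<Rightarrow> complex \<Rightarrow> real" where
  "zagier_formula n z =
     Re_n n (\<Sum>k<n. of_real (zagier_beta k * ln (cmod z) ^ k) * polylog (n - k) z)"

text \<open>For \<open>n \<ge> 2\<close> the function is single-valued and continuous, so on the branch cut it is the limit
  of its values off the cut.\<close>

definition zagier :: "nat \<Rightarrow> complex \<Rightarrow> real" where
  "zagier n z =
     (if n = 1 then ln (cmod z)
      else if z \<notin> branch_cut then zagier_formula n z
      else Lim (at z within - branch_cut) (zagier_formula n))"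


section \<open>The groups \<open>\<A>\<^sub>n\<close> and the maps \<open>J\<^sub>n\<close>\<close>

abbreviation QCt :: "(rat, ratfun \<Rightarrow>\<^sub>0 rat) module" where
  "QCt \<equiv> free_space UNIV"

text \<open>The points at which the terms of \<open>x\<close> are defined by the formula: \<open>\<phi>(t)\<close> has to avoid \<open>0\<close>, \<open>\<infinity>\<close> and,
  for \<open>n \<ge> 2\<close>, also \<open>1\<close>. Constant \<open>\<phi>\<close> impose no condition and contribute a constant to the sum in
  \<open>A_grp\<close>, whence \<open>[\<phi>] \<in> A_grp n\<close> for all constant \<open>\<phi>\<close>, including \<open>0\<close> and \<open>1\<close>.\<close>

definition regular_points :: "nat \<Rightarrow> (ratfun \<Rightarrow>\<^sub>0 rat) \<Rightarrow> complex set" where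
  "regular_points n x = {t. \<forall>\<phi>\<in>Poly_Mapping.keys x. const_ratfun \<phi> \<or>
     finite_at \<phi> t \<and> value_at \<phi> t \<noteq> 0 \<and> (n \<ge> 2 \<longrightarrow> value_at \<phi> t \<noteq> 1)}"

definition A_grp :: "nat \<Rightarrow> (ratfun \<Rightarrow>\<^sub>0 rat) set" where
  "A_grp n = {x. \<exists>c. \<forall>t\<in>regular_points n x.
     (\<Sum>\<phi>\<in>Poly_Mapping.keys x.
        of_rat (Poly_Mapping.lookup x \<phi>) * zagier n (value_at \<phi> t)) = c}"

definition J1 :: "(ratfun \<Rightarrow>\<^sub>0 rat) \<Rightarrow> complex \<Rightarrow>\<^sub>0 rat" where
  "J1 = lin_extend Div (\<lambda>\<phi>. if \<phi> = 0 \<or> \<phi> = 1 then 0 else divisor \<phi>)"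

text \<open>\<open>J n\<close> is the map \<open>J\<^sub>n\<close> for \<open>n \<ge> 2\<close>; it sends \<open>[\<phi>]\<close> to the class of
  \<open>(\<phi>)\<^sup>n\<^sup>-\<^sup>1 \<otimes> (1 - \<phi>)\<close>.\<close>

definition J :: "nat \<Rightarrow> (ratfun \<Rightarrow>\<^sub>0 rat) \<Rightarrow> (complex \<Rightarrow>\<^sub>0 rat) sym_tensor set" where
  "J n = lin_extend (S_star n Div) (\<lambda>\<phi>.
     if \<phi> = 0 \<or> \<phi> = 1 then \<zero>\<^bsub>S_star n Div\<^esub>
     else sym_image n Div +>\<^bsub>tensor (sym_power (n - 1) Div) Div\<^esub>
       pure_tensor (sym_power (n - 1) Div) Div
         (sym_prod Div (replicate (n - 1) (divisor \<phi>))) (divisor (1 - \<phi>)))"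

end

theory Submission
  imports Defs "HOL-Real_Asymp.Real_Asymp"
begin

text \<open>
  Surjectivity amounts to exhibiting rational functions. The function \<open>(t - a) / (b - a)\<close> has \<open>(\<phi>) = [a]\<close> and
  \<open>(1 - \<phi>) = [b]\<close>, and so hits \<open>[a] \<otimes> [b]\<close> and \<open>[a]\<^sup>2 \<otimes> [b]\<close>. A cross-ratio hits
  \<open>([a] - [b])\<^sup>2 \<otimes> ([c] - [b])\<close>; this is \<open>- 2 [a][b] \<otimes> [c]\<close> modulo classes with a
  repeated point, which follow from \<open>[a]\<^sup>2 \<otimes> [b]\<close>. Together these classes span.

  The substance is that the kernel of \<open>J\<^sub>n\<close> is \<open>\<A>\<^sub>n\<close>. Let \<open>v\<^sub>a\<close>, \<open>w\<^sub>a\<close> denote the orders of \<open>\<phi>\<close> and \<open>1 - \<phi>\<close> at \<open>a\<close>,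
  and consider a combination of functions \<open>\<L>\<^sub>n(\<phi>(t))\<close> with coefficients \<open>m\<^sub>\<phi>\<close>, where \<open>\<L>\<^sub>n\<close> is Zagier's
  polylogarithm. Outside a finite set it is smooth, so it is constant there if and only if its gradient
  vanishes. Two facts decide when this happens. First, the functions \<open>ln |t - a|\<close>, divided by \<open>t - b\<close> and by the
  conjugate of \<open>t - c\<close>, are linearly independent (\<open>log_pole_independent\<close>). Second, the tame symbols of \<open>\<phi>\<close> and
  \<open>1 - \<phi>\<close> have absolute value \<open>1\<close> (\<open>tame_symbol\<close>); this controls the constants in the expansion of
  \<open>ln |\<phi>|\<close> and \<open>ln |1 - \<phi>|\<close> in the functions \<open>ln |t - a|\<close>.

  For \<open>n = 1\<close> the combination is, up to a constant, the sum of the \<open>(\<Sum> m\<^sub>\<phi> v\<^sub>a) ln |t - a|\<close>, and independence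
  suffices.

  For \<open>n = 2\<close> the gradient of \<open>\<L>\<^sub>2(\<phi>(t))\<close> is the sum over \<open>b\<close> of \<open>\<i> (v\<^sub>b ln |1 - \<phi>| - w\<^sub>b ln |\<phi>|) / (t - b)\<close>.
  In the gradient of the combination, the coefficient of \<open>ln |t - a| / (t - b)\<close> is therefore \<open>\<i>\<close> times that of
  \<open>[b] \<and> [a]\<close> in \<open>\<Sum> m\<^sub>\<phi> (\<phi>) \<and> (1 - \<phi>)\<close>. If the gradient vanishes, so do these coefficients. Conversely, if
  they vanish, then the tame symbols show that the remaining constants over \<open>t - b\<close> vanish too.

  For \<open>n = 3\<close> the residue of the gradient at \<open>b\<close> consists of \<open>\<i> \<Sum> m\<^sub>\<phi> v\<^sub>b \<L>\<^sub>2(\<phi>)\<close> and a quadratic expression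
  in logarithms. If the gradient vanishes, its derivative with respect to the conjugate of \<open>t\<close> is a relation
  between logarithms with two poles, whose coefficients express that \<open>\<Sum> m\<^sub>\<phi> v\<^sub>a v\<^sub>b w\<^sub>c\<close> is totally symmetric in
  \<open>a\<close>, \<open>b\<close>, \<open>c\<close>; this is the vanishing of \<open>J\<^sub>3\<close> (\<open>J3_eq_0_iff\<close>). Conversely, if it is totally symmetric, then
  \<open>\<Sum> m\<^sub>\<phi> v\<^sub>b \<L>\<^sub>2(\<phi>)\<close> is constant by the case \<open>n = 2\<close>, and even \<open>0\<close> because \<open>\<L>\<^sub>2\<close> vanishes at \<open>0\<close> and
  \<open>\<infinity>\<close>; the quadratic part vanishes by symmetry and the tame symbols.

  The formulas for the gradients come from differentiating polylogarithms on the slit plane. The relation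
  between the values at \<open>z\<close> and \<open>1/z\<close>, itself a consequence of the formulas, carries them across the cut.
\<close>

section \<open>The gradients of Zagier's dilogarithm and trilogarithm\<close>

lemma branch_cut_iff: "z \<in> branch_cut \<longleftrightarrow> Im z = 0 \<and> 1 \<le> Re z"
  by (auto simp: branch_cut_def image_iff complex_eq_iff)

lemma open_slit_plane: "open (- branch_cut)"
proof -
  have "branch_cut = {z. Im z = 0} \<inter> {z. 1 \<le> Re z}"
    by (auto simp: branch_cut_iff)
  moreover have "closed ({z. Im z = 0} \<inter> {z. 1 \<le> Re z})"
    by (intro closed_Int closed_Collect_eq closed_halfspace_Re_ge continuous_intros)
  ultimately show ?thesis
    by (metis closed_def)
qed

lemma slit_plane_star: "z \<notin> branch_cut \<Longrightarrow> closed_segment 0 z \<subseteq> - branch_cut"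
proof
  fix w assume z: "z \<notin> branch_cut" and "w \<in> closed_segment 0 z"
  then obtain u where u: "0 \<le> u" "u \<le> 1" "w = of_real u * z"
    by (auto simp: closed_segment_def scaleR_conv_of_real)
  show "w \<in> - branch_cut"
  proof
    assume "w \<in> branch_cut"
    then have *: "u * Im z = 0" "1 \<le> u * Re z" using u by (auto simp: branch_cut_iff)
    then have "u \<noteq> 0" by auto
    then have "Im z = 0" "u > 0" using * u by auto
    moreover have "Re z \<ge> 1"
    proof (rule ccontr)
      assume "\<not> Re z \<ge> 1"
      then have "u * Re z < u * 1" using \<open>u > 0\<close> by (intro mult_strict_left_mono) auto
      then show False using * u by auto
    qed
    ultimately show False using z by (auto simp: branch_cut_iff)
  qed
qed

text \<open>Since \<open>f\<close> vanishes at \<open>0\<close>, the integrand \<open>f t / t\<close> extends holomorphically over \<open>0\<close>. The slit plane is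
  star-shaped about \<open>0\<close>, so that integration along segments from \<open>0\<close> produces a primitive.\<close>

lemma polylog_integral_deriv:
  assumes f: "f holomorphic_on - branch_cut" and f0: "f 0 = 0" and z: "z \<notin> branch_cut"
  shows "((\<lambda>z. contour_integral (linepath 0 z) (\<lambda>t. f t / t)) has_field_derivative
           (if z = 0 then deriv f 0 else f z / z)) (at z)"
proof -
  define g where "g = (\<lambda>z. if z = 0 then deriv f 0 else f z / z)"
  have g: "g holomorphic_on - branch_cut"
    by (rule pole_theorem_open_0[OF f open_slit_plane, of 0]) (auto simp: g_def f0)
  have eq: "contour_integral (linepath 0 z) (\<lambda>t. f t / t) = contour_integral (linepath 0 z) g" for z
  proof (cases "z = 0")
    case False
    show ?thesis unfolding contour_integral_integral
      by (rule integral_spike[of "{0}"]) (auto simp: g_def linepath_def False)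
  qed simp
  have star: "y \<in> - branch_cut \<Longrightarrow> closed_segment 0 y \<subseteq> - branch_cut" for y
    using slit_plane_star by auto
  have z0: "(0::complex) \<in> - branch_cut" by (auto simp: branch_cut_iff)
  have slike: "starlike (- branch_cut)"
    unfolding starlike_def using star z0 by auto
  obtain G where G: "\<And>x. x \<in> - branch_cut \<Longrightarrow> (G has_field_derivative g x) (at x)"
    using holomorphic_starlike_primitive[OF holomorphic_on_imp_continuous_on[OF g] slike
        open_slit_plane finite.emptyI] g open_slit_plane holomorphic_on_imp_differentiable_at by blast
  have tri: "contour_integral (linepath 0 b) g + contour_integral (linepath b c) g
      + contour_integral (linepath c 0) g = 0" if "closed_segment b c \<subseteq> - branch_cut" for b c
  proof -
    have cs: "contour_integral (linepath a b) g = G b - G a"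
      if "closed_segment a b \<subseteq> - branch_cut" for a b
    proof -
      have "(g has_contour_integral (G (pathfinish (linepath a b)) - G (pathstart (linepath a b)))) (linepath a b)"
        by (rule contour_integral_primitive[where S="- branch_cut"])
           (use G that in \<open>auto intro: has_field_derivative_at_within\<close>)
      then show ?thesis by (simp add: contour_integral_unique)
    qed
    have "b \<in> - branch_cut" "c \<in> - branch_cut" using that by auto
    then show ?thesis
      using cs[of 0 b] cs[OF that] cs[of c 0] star[of b] star[of c]
      by (simp add: closed_segment_commute)
  qed
  have "((\<lambda>x. contour_integral (linepath 0 x) g) has_field_derivative g z) (at z)"
    by (rule triangle_contour_integrals_starlike_primitive[OF holomorphic_on_imp_continuous_on[OF g] z0
          open_slit_plane _ star tri]) (use z in auto)
  then show ?thesis by (simp add: eq g_def cong: if_cong)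
qed

lemma one_minus_notin_nonpos: "z \<notin> branch_cut \<Longrightarrow> 1 - z \<notin> \<real>\<^sub>\<le>\<^sub>0"
  by (auto simp: branch_cut_iff complex_nonpos_Reals_iff)

lemma polylog_1_deriv:
  "z \<notin> branch_cut \<Longrightarrow> (polylog (Suc 0) has_field_derivative 1 / (1 - z)) (at z)"
proof -
  assume "z \<notin> branch_cut"
  note * = one_minus_notin_nonpos[OF this]
  have e: "polylog (Suc 0) = (\<lambda>z. - Ln (1 - z))" by auto
  show ?thesis unfolding e
    by (rule derivative_eq_intros * refl | use * in \<open>force simp: field_simps\<close>)+
qed

lemma polylog_holomorphic_aux:
  "polylog (Suc n) holomorphic_on - branch_cut \<and> polylog (Suc n) 0 = 0"
proof (induction n)
  case 0
  then show ?case
    using polylog_1_deriv by (auto simp: holomorphic_on_open[OF open_slit_plane] simp del: polylog.simps(2))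
      simp
next
  case (Suc n)
  have e: "polylog (Suc (Suc n)) = (\<lambda>z. contour_integral (linepath 0 z) (\<lambda>t. polylog (Suc n) t / t))"
    by auto
  show ?case unfolding e
    using polylog_integral_deriv[OF conjunct1[OF Suc] conjunct2[OF Suc]]
    by (auto simp: holomorphic_on_open[OF open_slit_plane])
qed

lemma polylog_holomorphic: "polylog (Suc n) holomorphic_on - branch_cut"
  and polylog_at_0: "polylog (Suc n) 0 = 0"
  using polylog_holomorphic_aux by auto

lemma polylog_deriv:
  assumes "z \<notin> branch_cut" "z \<noteq> 0"
  shows "(polylog (Suc (Suc n)) has_field_derivative polylog (Suc n) z / z) (at z)"
proof -
  have e: "polylog (Suc (Suc n)) = (\<lambda>z. contour_integral (linepath 0 z) (\<lambda>t. polylog (Suc n) t / t))"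
    by auto
  show ?thesis unfolding e
    using polylog_integral_deriv[OF polylog_holomorphic polylog_at_0 assms(1)] assms by simp
qed

text \<open>Multiplying the generating series by \<open>exp (2 x) - 1\<close> gives a recursion for its coefficients.\<close>

lemma zagier_beta_values: "zagier_beta 0 = 1" "zagier_beta (Suc 0) = -1" "zagier_beta 2 = 1/3"
proof -
  define E :: "real fps" where "E = fps_exp 2 - 1"
  define F where "F = 2 * fps_X / E"
  have n: "fps_nth E 0 = 0" "fps_nth E 1 = 2" "fps_nth E 2 = 2" "fps_nth E 3 = 4/3"
    by (auto simp: E_def fact_numeral)
  have E0: "E \<noteq> 0" using n by auto
  have "subdegree E = 1" using n by (intro subdegreeI) auto
  moreover have "subdegree (2 * fps_X :: real fps) = 1" 
    by (intro subdegreeI) (auto simp: numeral_fps_const)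
  moreover have "2 * fps_X \<noteq> (0 :: real fps)" by auto
  ultimately have "E dvd 2 * fps_X" using E0 by (subst fps_dvd_iff) auto
  then have FE: "F * E = 2 * fps_X" unfolding F_def by simp
  have "fps_nth (F * E) 1 = 2" "fps_nth (F * E) 2 = 0" "fps_nth (F * E) 3 = 0"
    unfolding FE by (auto simp: numeral_fps_const fps_X_def)
  then have "fps_nth F 0 = 1" "fps_nth F 1 = -1" "fps_nth F 2 = 1/3"
    using n by (auto simp: fps_mult_nth eval_nat_numeral)
  then show "zagier_beta 0 = 1" "zagier_beta (Suc 0) = -1" "zagier_beta 2 = 1/3"
    by (auto simp: zagier_beta_def F_def E_def)
qed

lemma zagier_formula_2:
  "zagier_formula 2 z = Im (polylog (Suc (Suc 0)) z) + ln (cmod z) * Im (Ln (1 - z))"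
  by (simp add: zagier_formula_def Re_n_def lessThan_nat_numeral zagier_beta_values numeral_2_eq_2
      lessThan_Suc del: polylog.simps(3))

lemma zagier_formula_3:
  "zagier_formula 3 z = Re (polylog (Suc (Suc (Suc 0))) z) - ln (cmod z) * Re (polylog (Suc (Suc 0)) z)
     - (ln (cmod z))\<^sup>2 / 3 * Re (Ln (1 - z))"
proof -
  have o: "odd (Suc (Suc (Suc 0)))" by simp
  show ?thesis
    using zagier_beta_values o
    by (simp add: zagier_formula_def Re_n_def numeral_3_eq_3 numeral_2_eq_2
        lessThan_Suc del: polylog.simps(3) even_Suc)
qed

text \<open>The gradient \<open>2 \<partial>f/\<partial>z\<close> of a real function as one complex number. With this normalisation
  \<open>Re F\<close> has gradient \<open>F'\<close> for holomorphic \<open>F\<close>, and composition with a holomorphic function multiplies the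
  gradient by the derivative of that function.\<close>

definition has_cgrad :: "(complex \<Rightarrow> real) \<Rightarrow> complex \<Rightarrow> complex \<Rightarrow> bool" where
  "has_cgrad f g z \<longleftrightarrow> (f has_derivative (\<lambda>v. Re (g * v))) (at z)"

lemma has_cgrad_const: "has_cgrad (\<lambda>_. c) 0 z"
  by (simp add: has_cgrad_def)

lemma has_cgrad_add: "has_cgrad f g z \<Longrightarrow> has_cgrad f' g' z \<Longrightarrow> has_cgrad (\<lambda>z. f z + f' z) (g + g') z"
  unfolding has_cgrad_def by (auto intro!: derivative_eq_intros simp: algebra_simps)

lemma has_cgrad_diff: "has_cgrad f g z \<Longrightarrow> has_cgrad f' g' z \<Longrightarrow> has_cgrad (\<lambda>z. f z - f' z) (g - g') z"
  unfolding has_cgrad_def by (auto intro!: derivative_eq_intros simp: algebra_simps)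

lemma has_cgrad_cmult: "has_cgrad f g z \<Longrightarrow> has_cgrad (\<lambda>z. c * f z) (of_real c * g) z"
  unfolding has_cgrad_def by (auto intro!: derivative_eq_intros simp: algebra_simps)

lemma has_cgrad_mult:
  "has_cgrad f g z \<Longrightarrow> has_cgrad f' g' z \<Longrightarrow>
   has_cgrad (\<lambda>z. f z * f' z) (of_real (f z) * g' + of_real (f' z) * g) z"
  unfolding has_cgrad_def by (auto intro!: derivative_eq_intros simp: algebra_simps)

lemma has_cgrad_sum:
  "(\<And>i. i \<in> I \<Longrightarrow> has_cgrad (f i) (g i) z) \<Longrightarrow> has_cgrad (\<lambda>z. \<Sum>i\<in>I. f i z) (\<Sum>i\<in>I. g i) z"
  unfolding has_cgrad_def
  by (auto intro!: derivative_eq_intros simp: sum_distrib_right)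

lemma has_cgrad_Re: "(F has_field_derivative F') (at z) \<Longrightarrow> has_cgrad (\<lambda>z. Re (F z)) F' z"
  unfolding has_cgrad_def has_field_derivative_def
  by (auto intro!: derivative_eq_intros)

lemma has_cgrad_Im: "(F has_field_derivative F') (at z) \<Longrightarrow> has_cgrad (\<lambda>z. Im (F z)) (- \<i> * F') z"
  unfolding has_cgrad_def has_field_derivative_def
  by (auto intro!: derivative_eq_intros)

lemma has_cgrad_compose:
  "(F has_field_derivative F') (at z) \<Longrightarrow> has_cgrad f g (F z) \<Longrightarrow> has_cgrad (\<lambda>z. f (F z)) (g * F') z"
  unfolding has_cgrad_def has_field_derivative_def
  by (drule (1) has_derivative_compose) (simp add: mult.assoc)

lemma has_cgrad_ln_cmod: "z \<noteq> 0 \<Longrightarrow> has_cgrad (\<lambda>z. ln (cmod z)) (1 / z) z"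
  unfolding has_cgrad_def
proof -
  assume z: "z \<noteq> 0"
  have "((\<lambda>z. ln (cmod z)) has_derivative (\<lambda>v. (v \<bullet> sgn z) / cmod z)) (at z)"
    using z by (auto intro!: derivative_eq_intros has_derivative_norm simp: inverse_eq_divide)
  also have "(\<lambda>v. (v \<bullet> sgn z) / cmod z) = (\<lambda>v. Re (1 / z * v))"
  proof
    fix v
    have "Re (1 / z * v) = (v \<bullet> z) / (cmod z)\<^sup>2"
      by (simp add: inner_complex_def Re_divide cmod_power2 mult.commute)
    then show "(v \<bullet> sgn z) / cmod z = Re (1 / z * v)"
      by (simp add: sgn_div_norm power2_eq_square divide_inverse mult.commute)
  qed
  finally show "((\<lambda>z. ln (cmod z)) has_derivative (\<lambda>v. Re (1 / z * v))) (at z)" .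
qed

lemma has_cgrad_cong:
  assumes "has_cgrad f g z" "open S" "z \<in> S" "\<And>w. w \<in> S \<Longrightarrow> f w = f' w" "g = g'"
  shows "has_cgrad f' g' z"
  using assms has_derivative_transform_within_open unfolding has_cgrad_def by blast

text \<open>The gradients of \<^term>\<open>zagier 2\<close> and \<^term>\<open>zagier 3\<close> outside \<open>0\<close> and \<open>1\<close>. The second one depends on
  the value \<open>d\<close> of \<^term>\<open>zagier 2\<close> at \<open>z\<close>; with \<open>d\<close> as a separate argument both are elementary expressions,
  and their behaviour under \<open>z \<mapsto> 1/z\<close> becomes an algebraic identity.\<close>

definition cgrad2 :: "complex \<Rightarrow> complex" where
  "cgrad2 z = \<i> * (of_real (ln (cmod z)) / (1 - z) + of_real (ln (cmod (1 - z))) / z)"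

definition cgrad3 :: "complex \<Rightarrow> real \<Rightarrow> complex" where
  "cgrad3 z d = (\<i> * of_real d + of_real (ln (cmod z) * ln (cmod (1 - z)) / 3)) / z
      + of_real ((ln (cmod z))\<^sup>2 / 3) / (1 - z)"

lemma Ln_split: "z \<noteq> 0 \<Longrightarrow> Ln z = of_real (ln (cmod z)) + \<i> * of_real (Im (Ln z))"
  by (simp add: complex_eq_iff)

text \<open>The derivative of \<open>Li\<^sub>2\<close> contributes the argument of \<open>1 - z\<close>, and so does the product rule; the two
  contributions cancel. This is why the gradient is single-valued although \<open>Li\<^sub>2\<close> is not.\<close>

lemma has_cgrad_zagier_formula_2:
  assumes "z \<notin> branch_cut" "z \<noteq> 0"
  shows "has_cgrad (zagier_formula 2) (cgrad2 z) z"
proof -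
  have z1: "1 - z \<noteq> 0" using assms(1) by (auto simp: branch_cut_iff)
  have L: "((\<lambda>z. Ln (1 - z)) has_field_derivative - 1 / (1 - z)) (at z)"
    using polylog_1_deriv[OF assms(1)] by (auto dest: DERIV_minus)
  have "has_cgrad (\<lambda>z. Im (polylog (Suc (Suc 0)) z) + ln (cmod z) * Im (Ln (1 - z)))
     (- \<i> * (polylog (Suc 0) z / z) + (of_real (ln (cmod z)) * (- \<i> * (- 1 / (1 - z))) +
        of_real (Im (Ln (1 - z))) * (1 / z))) z"
    by (intro has_cgrad_add has_cgrad_mult has_cgrad_Im has_cgrad_ln_cmod L polylog_deriv assms)
  also have "(\<lambda>z. Im (polylog (Suc (Suc 0)) z) + ln (cmod z) * Im (Ln (1 - z))) = zagier_formula 2"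
    by (rule ext) (simp only: zagier_formula_2)
  also have "(- \<i> * (polylog (Suc 0) z / z) + (of_real (ln (cmod z)) * (- \<i> * (- 1 / (1 - z))) +
        of_real (Im (Ln (1 - z))) * (1 / z))) = cgrad2 z"
    using assms z1 unfolding polylog.simps
    by (subst (1) Ln_split[OF z1]) (simp add: cgrad2_def field_simps)
  finally show ?thesis .
qed

text \<open>The real part of \<open>Li\<^sub>2\<close> cancels, and its imaginary part combines with the argument of \<open>1 - z\<close> to the
  dilogarithm.\<close>

lemma has_cgrad_zagier_formula_3:
  assumes "z \<notin> branch_cut" "z \<noteq> 0"
  shows "has_cgrad (zagier_formula 3) (cgrad3 z (zagier_formula 2 z)) z"
proof -
  have z1: "1 - z \<noteq> 0" using assms(1) by (auto simp: branch_cut_iff)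
  have L: "((\<lambda>z. Ln (1 - z)) has_field_derivative - 1 / (1 - z)) (at z)"
    using polylog_1_deriv[OF assms(1)] by (auto dest: DERIV_minus)
  let ?l = "complex_of_real (ln (cmod z))"
  define P where "P = polylog (Suc (Suc 0)) z"
  have "has_cgrad (\<lambda>z. Re (polylog (Suc (Suc (Suc 0))) z) - ln (cmod z) * Re (polylog (Suc (Suc 0)) z)
     - (1/3) * ((ln (cmod z) * ln (cmod z)) * Re (Ln (1 - z))))
     (P / z - (?l * (polylog (Suc 0) z / z) + of_real (Re P) * (1 / z))
       - of_real (1/3) * (of_real (ln (cmod z) * ln (cmod z)) * (- 1 / (1 - z)) +
            of_real (Re (Ln (1 - z))) * (?l * (1 / z) + ?l * (1 / z)))) z"
    unfolding P_def
    by (intro has_cgrad_diff has_cgrad_mult has_cgrad_cmult has_cgrad_Re has_cgrad_ln_cmod L polylog_deriv assms)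
  also have "(\<lambda>z. Re (polylog (Suc (Suc (Suc 0))) z) - ln (cmod z) * Re (polylog (Suc (Suc 0)) z)
     - (1/3) * ((ln (cmod z) * ln (cmod z)) * Re (Ln (1 - z)))) = zagier_formula 3"
    by (rule ext) (simp add: zagier_formula_3 power2_eq_square del: polylog.simps)
  also have "(P / z - (?l * (polylog (Suc 0) z / z) + of_real (Re P) * (1 / z))
       - of_real (1/3) * (of_real (ln (cmod z) * ln (cmod z)) * (- 1 / (1 - z)) +
            of_real (Re (Ln (1 - z))) * (?l * (1 / z) + ?l * (1 / z)))) = cgrad3 z (zagier_formula 2 z)"
  proof -
    have P: "P = of_real (Re P) + \<i> * of_real (Im P)" by (rule complex_eq)
    have p1: "polylog (Suc 0) z = - of_real (ln (cmod (1 - z))) - \<i> * of_real (Im (Ln (1 - z)))"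
      unfolding polylog.simps by (subst Ln_split[OF z1]) simp
    have R: "Re (Ln (1 - z)) = ln (cmod (1 - z))" using z1 by simp
    show ?thesis
      unfolding cgrad3_def zagier_formula_2 p1 R P_def[symmetric]
      using assms(2) z1
      by (subst (1) P) (simp add: field_simps power2_eq_square)
  qed
  finally show ?thesis .
qed

lemma has_cgrad_0_imp_const:
  assumes "open S" "connected S" "\<And>z. z \<in> S \<Longrightarrow> has_cgrad h 0 z" "x \<in> S" "y \<in> S"
  shows "h x = h y"
  using assms by (intro has_derivative_zero_unique_connected[of S h]) (auto simp: has_cgrad_def)

lemma has_cgrad_isCont: "has_cgrad f g z \<Longrightarrow> isCont f z"
  unfolding has_cgrad_def by (rule has_derivative_continuous)

lemma ln_cmod_one_minus_inverse:
  assumes "z \<noteq> 0" "z \<noteq> 1"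
  shows "ln (cmod (1 - 1 / z)) = ln (cmod (1 - z)) - ln (cmod z)"
proof -
  have "1 - 1 / z = - ((1 - z) / z)" using assms by (simp add: field_simps)
  then have "cmod (1 - 1 / z) = cmod (1 - z) / cmod z" by (simp only: norm_minus_cancel norm_divide)
  then show ?thesis using assms by (simp add: ln_div)
qed

text \<open>Here \<open>L\<close> and \<open>M\<close> stand for \<open>ln |z|\<close> and \<open>ln |1 - z|\<close>, and \<open>d\<close> for the value of the dilogarithm. Under
  \<open>z \<mapsto> 1/z\<close> they become \<open>- L\<close>, \<open>M - L\<close> and \<open>- d\<close>, and the gradients are multiplied by the derivative
  \<open>- 1/z\<^sup>2\<close>.\<close>

lemma cgrad_inverse_algebra:
  fixes z L M d :: complex
  assumes "z \<noteq> 0" "z \<noteq> 1"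
  shows "\<i> * (- L / (1 - 1 / z) + (M - L) / (1 / z)) * (- (1 / z\<^sup>2)) = - (\<i> * (L / (1 - z) + M / z))"
    and "((\<i> * - d + - L * (M - L) / 3) / (1 / z) + (- L)\<^sup>2 / 3 / (1 - 1 / z)) * (- (1 / z\<^sup>2))
      = (\<i> * d + L * M / 3) / z + L\<^sup>2 / 3 / (1 - z)"
proof -
  \<comment> \<open>In terms of these reciprocals all expressions are polynomial; the identity \<open>q p = q - p\<close> is the
      partial fraction decomposition which relates them.\<close>
  define p q t :: complex where "p = 1 / z" and "q = 1 / (z - 1)" and "t = 1 / 3"
  have pq: "p * z = 1" "q * (z - 1) = 1" using assms by (simp_all add: p_def q_def)
  have "1 - 1 / z = (z - 1) / z" using assms by (simp add: diff_divide_distrib)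
  then have e1: "X / (1 - 1 / z) = X * (z * q)" for X by (simp add: q_def)
  have e2: "X / (1 / z) = X * z" for X by simp
  have "1 - z = - (z - 1)" by simp
  then have e3: "X / (1 - z) = X * (- q)" for X unfolding q_def by (metis divide_inverse inverse_eq_divide mult_minus_right nonzero_minus_divide_right minus_divide_right)
  have e4: "X / z = X * p" "X / 3 = X * t" for X by (simp_all add: p_def t_def)
  have e5: "1 / z\<^sup>2 = p * p" by (simp add: p_def power2_eq_square)
  have zp: "z * p = 1" using pq by (simp add: mult.commute)
  have "q - p = q * (z * p) - p * (q * (z - 1))" using pq zp by simp
  also have "\<dots> = q * p" by (simp add: algebra_simps)
  finally have qp: "q * p = q - p" by simp
  have "j * (- L / (1 - 1 / z) + (M - L) / (1 / z)) * (- (1 / z\<^sup>2)) = - (j * (L / (1 - z) + M / z))" for j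
  proof -
    have "j * (- L * (z * q) + (M - L) * z) * (- (p * p)) = j * (L * (z * p) * (q * p) - (M - L) * (z * p) * p)"
      by (simp add: algebra_simps)
    also have "\<dots> = - (j * (L * (- q) + M * p))" unfolding zp qp by (simp add: algebra_simps)
    finally show ?thesis unfolding e1 e2 e3 e5 unfolding e4 .
  qed
  then show "\<i> * (- L / (1 - 1 / z) + (M - L) / (1 / z)) * (- (1 / z\<^sup>2)) = - (\<i> * (L / (1 - z) + M / z))" .
  have "((j * - d + - L * (M - L) / 3) / (1 / z) + (- L)\<^sup>2 / 3 / (1 - 1 / z)) * (- (1 / z\<^sup>2))
      = (j * d + L * M / 3) / z + L\<^sup>2 / 3 / (1 - z)" for j
  proof -
    have "((j * - d + - L * (M - L) * t) * z + (- L)\<^sup>2 * t * (z * q)) * (- (p * p))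
      = (j * d + L * (M - L) * t) * (z * p) * p - L\<^sup>2 * t * (z * p) * (q * p)"
      by (simp add: algebra_simps)
    also have "\<dots> = (j * d + L * M * t) * p + L\<^sup>2 * t * (- q)"
      unfolding zp qp by (simp add: algebra_simps power2_eq_square)
    finally show ?thesis unfolding e1 e2 e3 e5 unfolding e4 .
  qed
  then show "((\<i> * - d + - L * (M - L) / 3) / (1 / z) + (- L)\<^sup>2 / 3 / (1 - 1 / z)) * (- (1 / z\<^sup>2))
      = (\<i> * d + L * M / 3) / z + L\<^sup>2 / 3 / (1 - z)" .
qed

lemma cgrad2_inverse:
  assumes "z \<noteq> 0" "z \<noteq> 1"
  shows "cgrad2 (1 / z) * (- (1 / z\<^sup>2)) = - cgrad2 z"
proof -
  have l: "ln (cmod (1 / z)) = - ln (cmod z)" using assms by (simp add: norm_divide ln_div)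
  show ?thesis unfolding cgrad2_def l ln_cmod_one_minus_inverse[OF assms] of_real_minus of_real_diff
    by (rule cgrad_inverse_algebra[OF assms])
qed

lemma cgrad3_inverse:
  assumes "z \<noteq> 0" "z \<noteq> 1"
  shows "cgrad3 (1 / z) (- d) * (- (1 / z\<^sup>2)) = cgrad3 z d"
proof -
  have l: "ln (cmod (1 / z)) = - ln (cmod z)" using assms by (simp add: norm_divide ln_div)
  show ?thesis unfolding cgrad3_def l ln_cmod_one_minus_inverse[OF assms]
      of_real_minus of_real_diff of_real_divide of_real_mult of_real_power of_real_numeral
    by (rule cgrad_inverse_algebra[OF assms])
qed

text \<open>The plane without \<open>[0, \<infinity>)\<close>: a connected open set which is stable under \<open>z \<mapsto> 1/z\<close> and avoids the branch
  cut, so that the formulas can be compared at \<open>z\<close> and at \<open>1/z\<close>.\<close>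

definition slit0 :: "complex set" where "slit0 = {z. \<not> (Im z = 0 \<and> 0 \<le> Re z)}"

lemma slit0_inverse: "z \<in> slit0 \<Longrightarrow> 1 / z \<in> slit0"
proof (rule ccontr)
  assume z: "z \<in> slit0" and "1 / z \<notin> slit0"
  then have "1 / z = of_real (Re (1 / z))" and r: "0 \<le> Re (1 / z)"
    by (auto simp: slit0_def complex_eq_iff)
  then have "z = of_real (1 / Re (1 / z))" by (metis divide_divide_eq_right div_by_1 mult_1 of_real_1 of_real_divide)
  moreover have "0 \<le> 1 / Re (1 / z)" using r by simp
  ultimately have "Im z = 0 \<and> 0 \<le> Re z" by (metis Im_complex_of_real Re_complex_of_real)
  then show False using z by (simp add: slit0_def)
qed

lemma slit0_D: "z \<in> slit0 \<Longrightarrow> z \<noteq> 0 \<and> z \<noteq> 1 \<and> z \<notin> branch_cut"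
  by (auto simp: slit0_def branch_cut_iff)

lemma minus_1_slit0: "-1 \<in> slit0" by (auto simp: slit0_def)

lemma open_slit0: "open slit0"
proof -
  have "- slit0 = {z. Im z = 0} \<inter> {z. 0 \<le> Re z}" by (auto simp: slit0_def)
  moreover have "closed ({z. Im z = 0} \<inter> {z. 0 \<le> Re z})"
    by (intro closed_Int closed_Collect_eq closed_halfspace_Re_ge continuous_intros)
  ultimately show ?thesis
    by (metis closed_def double_compl)
qed

lemma connected_slit0: "connected slit0"
proof (rule starlike_imp_connected)
  have "closed_segment (-1) z \<subseteq> slit0" if "z \<in> slit0" for z
  proof
    fix w assume "w \<in> closed_segment (-1) z"
    then obtain u where u: "0 \<le> u" "u \<le> 1" "w = (1 - u) *\<^sub>R (-1) + u *\<^sub>R z"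
      by (auto simp: closed_segment_def)
    show "w \<in> slit0"
    proof (rule ccontr)
      assume "w \<notin> slit0"
      then have *: "u * Im z = 0" "0 \<le> u * Re z - (1 - u)" using u by (auto simp: slit0_def)
      then have "u \<noteq> 0" using u by auto
      then have "Im z = 0" "u > 0" using * u by auto
      then have "Re z < 0" using that by (auto simp: slit0_def)
      then have "u * Re z < 0" using \<open>u > 0\<close> by (simp add: mult_pos_neg)
      then show False using * u by auto
    qed
  qed
  then show "starlike slit0" unfolding starlike_def using minus_1_slit0 by blast
qed

text \<open>On the segment from \<open>0\<close> to \<open>-1\<close> the integrand is real.\<close>

lemma polylog_2_minus_1: "Im (polylog (Suc (Suc 0)) (-1)) = 0"
proof -
  define f where "f = (\<lambda>x. polylog (Suc 0) (linepath 0 (-1) x) / linepath 0 (-1) x *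
      vector_derivative (linepath 0 (-1)) (at x))"
  have e: "polylog (Suc (Suc 0)) (-1) = integral {0..1} f"
    by (simp add: contour_integral_integral f_def del: polylog.simps(2))
  have im: "Im (f x) = 0" if "x \<in> {0..1}" for x
  proof -
    have "Ln (1 + of_real x) = of_real (ln (1 + x))"
      using that Ln_of_real[of "1 + x"] by simp
    then show ?thesis by (simp add: f_def linepath_def scaleR_conv_of_real)
  qed
  show ?thesis
  proof (cases "f integrable_on {0..1}")
    case True
    have "Im (integral {0..1} f) = integral {0..1} (Im \<circ> f)"
      by (rule integral_linear[OF True bounded_linear_Im, symmetric])
    also have "\<dots> = integral {0..1} (\<lambda>x::real. 0)"
      by (rule Henstock_Kurzweil_Integration.integral_cong) (simp add: im)
    finally show ?thesis unfolding e by simp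
  qed (simp add: e not_integrable_integral del: polylog.simps)
qed

lemma has_field_derivative_inverse_fun:
  "z \<noteq> 0 \<Longrightarrow> ((\<lambda>z. 1 / z) has_field_derivative - (1 / z\<^sup>2)) (at (z :: complex))"
  by (auto intro!: derivative_eq_intros simp: power2_eq_square)

text \<open>By \<open>cgrad2_inverse\<close> the sum of the values at \<open>z\<close> and \<open>1/z\<close> has gradient \<open>0\<close>, hence is constant. It is
  computed at the fixed point \<open>-1\<close> of inversion.\<close>

lemma zagier_formula_2_inverse:
  assumes "z \<in> slit0"
  shows "zagier_formula 2 z = - zagier_formula 2 (1 / z)"
proof -
  have "has_cgrad (\<lambda>z. zagier_formula 2 z + zagier_formula 2 (1 / z)) 0 w" if "w \<in> slit0" for w
  proof -
    note w = slit0_D[OF that] and w' = slit0_D[OF slit0_inverse[OF that]]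
    have "has_cgrad (\<lambda>z. zagier_formula 2 z + zagier_formula 2 (1 / z)) 
        (cgrad2 w + cgrad2 (1 / w) * (- (1 / w\<^sup>2))) w"
      by (intro has_cgrad_add has_cgrad_compose has_field_derivative_inverse_fun has_cgrad_zagier_formula_2)
        (use w w' in auto)
    moreover have "cgrad2 w + cgrad2 (1 / w) * (- (1 / w\<^sup>2)) = 0"
      using cgrad2_inverse[of w] w by simp
    ultimately show ?thesis by (simp only:)
  qed
  from has_cgrad_0_imp_const[OF open_slit0 connected_slit0 this assms minus_1_slit0]
  have "zagier_formula 2 z + zagier_formula 2 (1 / z) = 2 * zagier_formula 2 (-1)" by simp
  also have "zagier_formula 2 (-1) = 0"
    unfolding zagier_formula_2 polylog_2_minus_1 by simp
  finally show ?thesis by simp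
qed

text \<open>The difference of the two sides has gradient \<open>0\<close> and vanishes at the fixed point \<open>-1\<close>.\<close>

lemma zagier_formula_3_inverse:
  assumes "z \<in> slit0"
  shows "zagier_formula 3 z = zagier_formula 3 (1 / z)"
proof -
  have "has_cgrad (\<lambda>z. zagier_formula 3 z - zagier_formula 3 (1 / z)) 0 w" if "w \<in> slit0" for w
  proof -
    note w = slit0_D[OF that] and w' = slit0_D[OF slit0_inverse[OF that]]
    have "has_cgrad (\<lambda>z. zagier_formula 3 z - zagier_formula 3 (1 / z)) 
        (cgrad3 w (zagier_formula 2 w) - cgrad3 (1 / w) (zagier_formula 2 (1 / w)) * (- (1 / w\<^sup>2))) w"
      by (intro has_cgrad_diff has_cgrad_compose has_field_derivative_inverse_fun has_cgrad_zagier_formula_3)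
        (use w w' in auto)
    moreover have "cgrad3 w (zagier_formula 2 w) - cgrad3 (1 / w) (zagier_formula 2 (1 / w)) * (- (1 / w\<^sup>2)) = 0"
      using w cgrad3_inverse[of w "zagier_formula 2 w"] zagier_formula_2_inverse[OF that] by simp
    ultimately show ?thesis by (simp only:)
  qed
  from has_cgrad_0_imp_const[OF open_slit0 connected_slit0 this assms minus_1_slit0]
  show ?thesis by simp
qed

text \<open>On the cut \<^term>\<open>zagier n\<close> is a limit from outside the cut. Inversion moves this limit to the point \<open>1/z\<close>
  of \<open>(0, 1)\<close>, where the formula is continuous. Hence to the right of the line \<open>Re z = 1\<close> the function is
  given by one expression which does not see the cut.\<close>

lemma zagier_beyond_1:
  assumes n: "n \<noteq> 1" and inv: "\<And>z. z \<in> slit0 \<Longrightarrow> zagier_formula n z = s * zagier_formula n (1 / z)"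
    and cont: "\<And>z. z \<notin> branch_cut \<Longrightarrow> z \<noteq> 0 \<Longrightarrow> isCont (zagier_formula n) z"
    and z: "Re z > 1"
  shows "zagier n z = s * zagier_formula n (1 / z)"
proof (cases "z \<in> branch_cut")
  case False
  then have "z \<in> slit0" using z by (auto simp: branch_cut_iff slit0_def)
  then show ?thesis using inv False n by (simp add: zagier_def)
next
  case True
  have z0: "z \<noteq> 0" using z by auto
  have "z = of_real (Re z)" using True by (simp add: branch_cut_iff complex_eq_iff)
  then have "Re (1 / z) = 1 / Re z" by (metis Re_complex_of_real of_real_1 of_real_divide)
  then have "1 / z \<notin> branch_cut" using z by (simp add: branch_cut_iff)
  then have c: "isCont (zagier_formula n) (1 / z)" by (intro cont) (use z0 in auto)
  have "((\<lambda>w. 1 / w) \<longlongrightarrow> 1 / z) (at z within - branch_cut)"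
    by (intro tendsto_intros z0)
  then have t: "((\<lambda>w. s * zagier_formula n (1 / w)) \<longlongrightarrow> s * zagier_formula n (1 / z)) (at z within - branch_cut)"
    by (intro tendsto_mult_left isCont_tendsto_compose[OF c])
  have "open {w. Re w > 1}" by (rule open_halfspace_Re_gt)
  then have "eventually (\<lambda>w. w \<in> {w. Re w > 1}) (at z within - branch_cut)"
    using z eventually_nhds_in_open[of "{w. Re w > 1}" z]
    by (auto simp: eventually_at_filter elim: eventually_mono)
  moreover have "eventually (\<lambda>w. w \<in> - branch_cut) (at z within - branch_cut)"
    by (simp add: eventually_at_filter)
  ultimately have "eventually (\<lambda>w. s * zagier_formula n (1 / w) = zagier_formula n w) (at z within - branch_cut)"
  proof eventually_elim
    case (elim w)
    then have "w \<in> slit0" by (auto simp: branch_cut_iff slit0_def)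
    then show ?case using inv[of w] by simp
  qed
  then have lim: "(zagier_formula n \<longlongrightarrow> s * zagier_formula n (1 / z)) (at z within - branch_cut)"
    using t by (simp cong: filterlim_cong add: tendsto_cong)
  have "z islimpt - branch_cut"
    unfolding islimpt_approachable
  proof (intro allI impI)
    fix e :: real assume "e > 0"
    then show "\<exists>x'\<in>- branch_cut. x' \<noteq> z \<and> dist x' z < e"
      using True by (intro bexI[of _ "z + \<i> * of_real (e / 2)"]) (auto simp: branch_cut_iff dist_norm norm_mult)
  qed
  then have "\<not> trivial_limit (at z within - branch_cut)" by (simp add: trivial_limit_within)
  then show ?thesis using True n lim by (simp add: zagier_def tendsto_Lim)
qed

lemmas isCont_zagier_formula_2 = has_cgrad_isCont[OF has_cgrad_zagier_formula_2]
lemmas isCont_zagier_formula_3 = has_cgrad_isCont[OF has_cgrad_zagier_formula_3]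

lemma zagier_2_beyond_1: "Re z > 1 \<Longrightarrow> zagier 2 z = - zagier_formula 2 (1 / z)"
  using zagier_beyond_1[of 2 "-1" z] zagier_formula_2_inverse isCont_zagier_formula_2 by simp

lemma zagier_3_beyond_1: "Re z > 1 \<Longrightarrow> zagier 3 z = zagier_formula 3 (1 / z)"
  using zagier_beyond_1[of 3 1 z] zagier_formula_3_inverse isCont_zagier_formula_3 by simp

lemma zagier_off_cut: "n \<noteq> 1 \<Longrightarrow> z \<notin> branch_cut \<Longrightarrow> zagier n z = zagier_formula n z"
  by (simp add: zagier_def)

lemma inverse_on_cut:
  assumes "z \<in> branch_cut" "z \<noteq> 1"
  shows "Re z > 1" "1 / z \<notin> branch_cut" "z \<noteq> 0"
proof -
  show "Re z > 1" using assms by (auto simp: branch_cut_iff complex_eq_iff)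
  moreover have "z = of_real (Re z)" using assms by (simp add: branch_cut_iff complex_eq_iff)
  then have "Re (1 / z) = 1 / Re z" by (metis Re_complex_of_real of_real_1 of_real_divide)
  ultimately show "1 / z \<notin> branch_cut" "z \<noteq> 0" by (auto simp: branch_cut_iff)
qed

text \<open>Near a point of the cut other than \<open>1\<close> the function is computed from the formula at \<open>1/z\<close>, and
  \<open>cgrad2_inverse\<close> shows that the gradient has the same shape as off the cut.\<close>

lemma has_cgrad_zagier_2:
  assumes "z \<noteq> 0" "z \<noteq> 1"
  shows "has_cgrad (zagier 2) (cgrad2 z) z"
proof (cases "z \<in> branch_cut")
  case False
  show ?thesis
    by (rule has_cgrad_cong[OF has_cgrad_zagier_formula_2[OF False assms(1)] open_slit_plane])
       (use False in \<open>auto simp: zagier_off_cut\<close>)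
next
  case True
  note i = inverse_on_cut[OF True assms(2)]
  have "has_cgrad (\<lambda>z. (-1) * zagier_formula 2 (1 / z)) (of_real (-1) * (cgrad2 (1 / z) * - (1 / z\<^sup>2))) z"
    by (intro has_cgrad_cmult has_cgrad_compose has_field_derivative_inverse_fun has_cgrad_zagier_formula_2)
      (use i in auto)
  then show ?thesis
    by (rule has_cgrad_cong[OF _ open_halfspace_Re_gt[of 1]])
      (use i cgrad2_inverse[OF assms] in \<open>auto simp: zagier_2_beyond_1\<close>)
qed

lemma zagier_2_inverse:
  assumes "z \<noteq> 0" "z \<noteq> 1"
  shows "zagier 2 (1 / z) = - zagier 2 z"
proof -
  have cut: "zagier 2 (1 / z) = - zagier 2 z" if "z \<in> branch_cut" "z \<noteq> 1" for z
    using inverse_on_cut[OF that] by (simp add: zagier_2_beyond_1 zagier_off_cut)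
  have "z \<in> branch_cut \<or> 1 / z \<in> branch_cut \<or> z \<in> slit0"
  proof (cases "Im z = 0 \<and> 0 \<le> Re z")
    case True
    define r where "r = Re z"
    have z: "z = of_real r" using True by (simp add: complex_eq_iff r_def)
    have "1 / z = of_real (1 / r)" by (simp add: z)
    then show ?thesis using True assms
      by (cases "1 \<le> r") (auto simp: branch_cut_iff z field_simps)
  qed (auto simp: slit0_def)
  then consider "z \<in> branch_cut" | "1 / z \<in> branch_cut" | "z \<in> slit0" by blast
  then show ?thesis
  proof cases
    case 2
    then show ?thesis using cut[of "1 / z"] assms by auto
  next
    case 3
    then show ?thesis using slit0_D[OF 3] slit0_D[OF slit0_inverse[OF 3]] zagier_formula_2_inverse[OF 3]
      by (simp add: zagier_off_cut)
  qed (use cut assms in auto)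
qed

lemma has_cgrad_zagier_3:
  assumes "z \<noteq> 0" "z \<noteq> 1"
  shows "has_cgrad (zagier 3) (cgrad3 z (zagier 2 z)) z"
proof (cases "z \<in> branch_cut")
  case False
  show ?thesis
    by (rule has_cgrad_cong[OF has_cgrad_zagier_formula_3[OF False assms(1)] open_slit_plane])
       (use False in \<open>auto simp: zagier_off_cut\<close>)
next
  case True
  note i = inverse_on_cut[OF True assms(2)]
  have "has_cgrad (\<lambda>z. zagier_formula 3 (1 / z)) (cgrad3 (1 / z) (zagier_formula 2 (1 / z)) * (- (1 / z\<^sup>2))) z"
    by (intro has_cgrad_compose has_field_derivative_inverse_fun has_cgrad_zagier_formula_3)
      (use i in auto)
  then show ?thesis
    by (rule has_cgrad_cong[OF _ open_halfspace_Re_gt[of 1]])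
      (use i cgrad3_inverse[OF assms, of "zagier 2 z"] in \<open>auto simp: zagier_3_beyond_1 zagier_2_beyond_1\<close>)
qed

text \<open>The singular factor \<open>ln |z|\<close> is multiplied by the argument of \<open>1 - z\<close>, which is of size \<open>O(|z|)\<close>.\<close>

lemma zagier_2_tendsto_0: "(zagier 2 \<longlongrightarrow> 0) (at 0)"
proof -
  have "((\<lambda>x. x * ln x) \<longlongrightarrow> 0) (at_right (0::real))" by real_asymp
  moreover have "filterlim cmod (at_right 0) (at (0::complex))"
    unfolding filterlim_at by (auto simp: eventually_at_filter intro!: tendsto_eq_intros)
  ultimately have l: "((\<lambda>z::complex. cmod z * ln (cmod z)) \<longlongrightarrow> 0) (at 0)"
    by (rule filterlim_compose)
  have "isCont (polylog (Suc (Suc 0))) 0"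
    by (rule continuous_on_interior[OF holomorphic_on_imp_continuous_on[OF polylog_holomorphic]])
       (simp add: interior_open open_slit_plane branch_cut_iff)
  then have p: "((\<lambda>z. Im (polylog (Suc (Suc 0)) z)) \<longlongrightarrow> 0) (at 0)"
    unfolding isCont_def polylog_at_0 by (metis tendsto_Im zero_complex.sel(2))
  have ball: "eventually (\<lambda>z::complex. z \<in> ball 0 (1/2)) (at 0)"
    by (rule eventually_at_in_open') auto
  have b: "((\<lambda>z. ln (cmod z) * Im (Ln (1 - z))) \<longlongrightarrow> 0) (at 0)"
  proof (rule Lim_null_comparison)
    show "((\<lambda>z::complex. 2 * \<bar>cmod z * ln (cmod z)\<bar>) \<longlongrightarrow> 0) (at 0)"
      using tendsto_mult_left[OF tendsto_rabs_zero[OF l], of 2] by simp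
    show "eventually (\<lambda>z. norm (ln (cmod z) * Im (Ln (1 - z))) \<le> 2 * \<bar>cmod z * ln (cmod z)\<bar>) (at 0)"
      using ball
    proof eventually_elim
      case (elim z)
      have "\<bar>Im (Ln (1 - z))\<bar> \<le> norm (Ln (1 + - z))" using abs_Im_le_cmod by simp
      also have "\<dots> \<le> 2 * norm (- z)" by (rule norm_Ln_le) (use elim in auto)
      finally have "\<bar>ln (cmod z)\<bar> * \<bar>Im (Ln (1 - z))\<bar> \<le> \<bar>ln (cmod z)\<bar> * (2 * cmod z)"
        by (intro mult_left_mono) auto
      then show ?case by (simp add: abs_mult mult_ac)
    qed
  qed
  have "eventually (\<lambda>z. Im (polylog (Suc (Suc 0)) z) + ln (cmod z) * Im (Ln (1 - z)) = zagier 2 z) (at 0)"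
    using ball
  proof eventually_elim
    case (elim z)
    then have "z \<notin> branch_cut" using abs_Re_le_cmod[of z] by (auto simp: branch_cut_iff)
    then show ?case by (simp add: zagier_off_cut zagier_formula_2 del: polylog.simps)
  qed
  with tendsto_add[OF p b] show ?thesis by (auto dest: Lim_transform_eventually)
qed

section \<open>Rational functions: divisors, logarithms and tame symbols\<close>

definition ln_lead :: "complex poly \<Rightarrow> real" where "ln_lead p = ln (cmod (lead_coeff p))"

lemma lookup_poly_divisor:
  assumes "p \<noteq> 0"
  shows "Poly_Mapping.lookup (poly_divisor p) a = of_nat (Polynomial.order a p)"
proof -
  have "finite {a. poly p a = 0}" using assms by (rule poly_roots_finite)
  then have "Poly_Mapping.lookup (poly_divisor p) a = (\<Sum>b | poly p b = 0. Poly_Mapping.lookup (Poly_Mapping.single b (of_nat (Polynomial.order b p))) a)"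
    unfolding poly_divisor_def by (simp add: lookup_sum)
  also have "\<dots> = (\<Sum>b | poly p b = 0. if b = a then of_nat (Polynomial.order b p) else 0)"
    by (rule sum.cong) (auto simp: lookup_single when_def)
  also have "\<dots> = of_nat (Polynomial.order a p)"
    using \<open>finite _\<close> order_root[of p a] assms by (auto simp: sum.delta)
  finally show ?thesis .
qed

lemma poly_eq_prod_roots:
  fixes p :: "complex poly"
  assumes "p \<noteq> 0" "finite A" "\<And>a. poly p a = 0 \<Longrightarrow> a \<in> A"
  shows "poly p t = lead_coeff p * (\<Prod>a\<in>A. (t - a) ^ Polynomial.order a p)"
proof -
  have "poly p t = poly (Polynomial.smult (lead_coeff p) (\<Prod>z | poly p z = 0. [:-z, 1:] ^ Polynomial.order z p)) t"
    by (simp only: complex_poly_decompose)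
  also have "\<dots> = lead_coeff p * (\<Prod>z | poly p z = 0. (t - z) ^ Polynomial.order z p)"
    by (simp add: poly_prod)
  also have "(\<Prod>z | poly p z = 0. (t - z) ^ Polynomial.order z p) = (\<Prod>a\<in>A. (t - a) ^ Polynomial.order a p)"
    using assms order_root[of p] by (intro prod.mono_neutral_left) auto
  finally show ?thesis .
qed

lemma ln_cmod_poly:
  assumes "p \<noteq> 0" "finite A" "\<And>a. poly p a = 0 \<Longrightarrow> a \<in> A" "poly p t \<noteq> 0"
  shows "ln (cmod (poly p t)) = ln_lead p + (\<Sum>a\<in>A. real (Polynomial.order a p) * ln (cmod (t - a)))"
proof -
  have nz: "lead_coeff p \<noteq> 0" "(t - a) ^ Polynomial.order a p \<noteq> 0" if "a \<in> A" for a
    using assms order_root[of p a] by auto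
  have "ln (cmod (poly p t)) = ln (cmod (lead_coeff p) * (\<Prod>a\<in>A. cmod ((t - a) ^ Polynomial.order a p)))"
    by (subst poly_eq_prod_roots[OF assms(1-3)]) (simp_all add: norm_mult prod_norm)
  also have "\<dots> = ln (cmod (lead_coeff p)) + ln (\<Prod>a\<in>A. cmod ((t - a) ^ Polynomial.order a p))"
    using assms(1) nz(2) by (intro ln_mult_pos prod_pos) auto
  also have "ln (\<Prod>a\<in>A. cmod ((t - a) ^ Polynomial.order a p)) = (\<Sum>a\<in>A. ln (cmod ((t - a) ^ Polynomial.order a p)))"
    using nz(2) assms(2) by (intro ln_prod) auto
  also have "\<dots> = (\<Sum>a\<in>A. real (Polynomial.order a p) * ln (cmod (t - a)))"
  proof (rule sum.cong)
    fix a assume "a \<in> A"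
    show "ln (cmod ((t - a) ^ Polynomial.order a p)) = real (Polynomial.order a p) * ln (cmod (t - a))"
    proof (cases "t = a")
      case True
      then show ?thesis using assms(4) by (simp add: order_0I)
    qed (simp add: norm_power ln_realpow)
  qed simp
  finally show ?thesis by (simp add: ln_lead_def)
qed

lemma poly_log_deriv:
  fixes p :: "complex poly"
  assumes "p \<noteq> 0" "finite A" "\<And>a. poly p a = 0 \<Longrightarrow> a \<in> A" "t \<notin> A"
  shows "poly (pderiv p) t / poly p t = (\<Sum>a\<in>A. of_nat (Polynomial.order a p) / (t - a))"
proof -
  have pt: "poly p t \<noteq> 0" using assms by auto
  have ta: "t - a \<noteq> 0" if "a \<in> A" for a using that assms(4) by auto
  have e: "poly p = (\<lambda>t. lead_coeff p * (\<Prod>a\<in>A. (t - a) ^ Polynomial.order a p))"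
    using poly_eq_prod_roots[OF assms(1-3)] by auto
  have "((\<lambda>t. \<Prod>a\<in>A. (t - a) ^ Polynomial.order a p) has_field_derivative
      (\<Sum>a\<in>A. of_nat (Polynomial.order a p) / (t - a)) * (\<Prod>a\<in>A. (t - a) ^ Polynomial.order a p)) (at t)"
    using assms(2) ta
  proof (induction A rule: finite_induct)
    case (insert a A)
    have d: "((\<lambda>t. (t - a) ^ n) has_field_derivative of_nat n / (t - a) * (t - a) ^ n) (at t)" for n
    proof -
      have "((\<lambda>t. (t - a) ^ n) has_field_derivative of_nat n * (t - a) ^ (n - 1)) (at t)"
        by (auto intro!: derivative_eq_intros)
      also have "of_nat n * (t - a) ^ (n - 1) = of_nat n / (t - a) * (t - a) ^ n"
        using insert.prems[of a] by (cases n) auto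
      finally show ?thesis .
    qed
    show ?case
      using DERIV_mult[OF d insert.IH] insert
      by (simp add: algebra_simps)
  qed simp
  then have "(poly p has_field_derivative (\<Sum>a\<in>A. of_nat (Polynomial.order a p) / (t - a)) * poly p t) (at t)"
    by (subst (1 2) e) (auto intro!: derivative_eq_intros)
  then have "poly (pderiv p) t = (\<Sum>a\<in>A. of_nat (Polynomial.order a p) / (t - a)) * poly p t"
    using DERIV_unique poly_DERIV by blast
  then show ?thesis using pt by simp
qed

lemma coprime_numer_denom: "coprime (numer \<phi>) (denom \<phi>)"
  and unit_factor_denom: "unit_factor (denom \<phi>) = 1"
  using quot_of_fract_in_normalized_fracts[of \<phi>]
  by (auto simp: numer_def denom_def normalized_fracts_def split: prod.splits)

lemma denom_nonzero [simp]: "denom \<phi> \<noteq> 0"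
  using unit_factor_denom[of \<phi>] by auto

lemma ratfun_eq_Fract: "\<phi> = Fract (numer \<phi>) (denom \<phi>)"
  using quot_to_fract_quot_of_fract[of \<phi>]
  by (simp add: quot_to_fract_def numer_def denom_def split: prod.splits)

lemma numer_denom_Fract:
  assumes "coprime p q" "unit_factor q = 1"
  shows "numer (Fract p q) = p" "denom (Fract p q) = q"
proof -
  have "quot_of_fract (Fract p q) = (p, q)"
    using quot_of_fract_quot_to_fract'[of "(p, q)"] assms
    by (simp add: quot_to_fract_def normalized_fracts_def)
  then show "numer (Fract p q) = p" "denom (Fract p q) = q" by (simp_all add: numer_def denom_def)
qed

text \<open>Over the denominator of \<open>\<phi>\<close>, the function \<open>1 - \<phi>\<close> is again in lowest terms.\<close>

lemma numer_one_minus: "numer (1 - \<phi>) = denom \<phi> - numer \<phi>"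
  and denom_one_minus: "denom (1 - \<phi>) = denom \<phi>"
proof -
  have "1 - \<phi> = Fract 1 1 - Fract (numer \<phi>) (denom \<phi>)"
    using ratfun_eq_Fract[of \<phi>] by (simp add: One_fract_def)
  then have e: "1 - \<phi> = Fract (denom \<phi> - numer \<phi>) (denom \<phi>)" by simp
  have "coprime (denom \<phi> - numer \<phi>) (denom \<phi>)"
    using coprime_numer_denom[of \<phi>]
    by (metis (no_types, opaque_lifting) coprime_iff_gcd_eq_1 gcd_diff1 gcd.commute gcd_diff2)
  from numer_denom_Fract[OF this unit_factor_denom]
  show "numer (1 - \<phi>) = denom \<phi> - numer \<phi>" "denom (1 - \<phi>) = denom \<phi>" by (simp_all add: e)
qed

lemma numer_eq_0_iff: "numer \<phi> = 0 \<longleftrightarrow> \<phi> = 0"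
  using ratfun_eq_Fract[of \<phi>] denom_nonzero[of \<phi>]
  by (metis eq_fract(2) fract_collapse(1) mult_zero_left numer_def quot_of_fract_0 fst_conv)

lemma numer_denom_no_common_root: "poly (numer \<phi>) t = 0 \<Longrightarrow> poly (denom \<phi>) t \<noteq> 0"
  using coprime_poly_0[OF coprime_numer_denom[of \<phi>], of t] by auto

lemma const_ratfun_1: "const_ratfun 0" "const_ratfun 1"
  unfolding const_ratfun_def by (metis pCons_0_0 to_fract_0, metis one_pCons to_fract_1)

lemma value_at_const: "value_at (to_fract [:c:]) t = c"
  by (simp add: value_at_def numer_def denom_def)

lemma divisor_const: "c \<noteq> 0 \<Longrightarrow> divisor (to_fract [:c:]) = 0"
  by (simp add: divisor_def numer_def denom_def poly_divisor_def)

lemma finite_at_one_minus: "finite_at (1 - \<phi>) t = finite_at \<phi> t"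
  by (simp add: finite_at_def denom_one_minus)

lemma value_at_one_minus: "finite_at \<phi> t \<Longrightarrow> value_at (1 - \<phi>) t = 1 - value_at \<phi> t"
  by (simp add: value_at_def finite_at_def numer_one_minus denom_one_minus diff_divide_distrib)

definition ord_at :: "complex \<Rightarrow> ratfun \<Rightarrow> real" where
  "ord_at a \<phi> = of_rat (Poly_Mapping.lookup (divisor \<phi>) a)"

definition ln_lead_at :: "ratfun \<Rightarrow> real" where
  "ln_lead_at \<phi> = ln_lead (numer \<phi>) - ln_lead (denom \<phi>)"

lemma lookup_divisor:
  "\<phi> \<noteq> 0 \<Longrightarrow> Poly_Mapping.lookup (divisor \<phi>) a = of_nat (Polynomial.order a (numer \<phi>)) - of_nat (Polynomial.order a (denom \<phi>))"
  by (simp add: divisor_def lookup_minus lookup_poly_divisor numer_eq_0_iff)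

lemma ord_at: "\<phi> \<noteq> 0 \<Longrightarrow> ord_at a \<phi> = real (Polynomial.order a (numer \<phi>)) - real (Polynomial.order a (denom \<phi>))"
  by (simp add: ord_at_def lookup_divisor of_rat_diff)

lemma ln_cmod_value_at:
  assumes "\<phi> \<noteq> 0" "finite A" "\<And>a. a \<notin> A \<Longrightarrow> finite_at \<phi> a \<and> value_at \<phi> a \<noteq> 0" "t \<notin> A"
  shows "ln (cmod (value_at \<phi> t)) = ln_lead_at \<phi> + (\<Sum>a\<in>A. ord_at a \<phi> * ln (cmod (t - a)))"
proof -
  have n: "poly (numer \<phi>) a \<noteq> 0" "poly (denom \<phi>) a \<noteq> 0" if "a \<notin> A" for a
    using assms(3)[OF that] by (auto simp: finite_at_def value_at_def)
  have "ln (cmod (value_at \<phi> t)) = ln (cmod (poly (numer \<phi>) t)) - ln (cmod (poly (denom \<phi>) t))"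
    using n[OF assms(4)] by (simp add: value_at_def norm_divide ln_div)
  also have "\<dots> = ln_lead_at \<phi> + (\<Sum>a\<in>A. ord_at a \<phi> * ln (cmod (t - a)))"
    using n assms(1,4)
    by (subst (1 2) ln_cmod_poly[OF _ assms(2)])
       (auto simp: numer_eq_0_iff ln_lead_at_def ord_at algebra_simps sum_subtractf)
  finally show ?thesis .
qed

lemma value_at_has_deriv:
  assumes "\<phi> \<noteq> 0" "finite A" "\<And>a. a \<notin> A \<Longrightarrow> finite_at \<phi> a \<and> value_at \<phi> a \<noteq> 0" "t \<notin> A"
  shows "(value_at \<phi> has_field_derivative value_at \<phi> t * (\<Sum>a\<in>A. of_real (ord_at a \<phi>) / (t - a))) (at t)"
proof -
  have n: "poly (numer \<phi>) a \<noteq> 0" "poly (denom \<phi>) a \<noteq> 0" if "a \<notin> A" for a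
    using assms(3)[OF that] by (auto simp: finite_at_def value_at_def)
  let ?f = "poly (numer \<phi>) t" and ?g = "poly (denom \<phi>) t"
  let ?f' = "poly (pderiv (numer \<phi>)) t" and ?g' = "poly (pderiv (denom \<phi>)) t"
  have nz: "?f \<noteq> 0" "?g \<noteq> 0" using n assms(4) by auto
  have e: "value_at \<phi> = (\<lambda>t. poly (numer \<phi>) t / poly (denom \<phi>) t)" by (auto simp: value_at_def)
  have "(value_at \<phi> has_field_derivative (?f' * ?g - ?f * ?g') / (?g * ?g)) (at t)"
    unfolding e using nz by (intro DERIV_divide poly_DERIV)
  also have "(?f' * ?g - ?f * ?g') / (?g * ?g) = value_at \<phi> t * (?f' / ?f - ?g' / ?g)"
    using nz by (simp add: value_at_def field_simps)
  also have "?f' / ?f - ?g' / ?g = (\<Sum>a\<in>A. of_real (ord_at a \<phi>) / (t - a))"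
    using n assms(1,4)
    by (subst (1 2) poly_log_deriv[OF _ assms(2)])
       (auto simp: numer_eq_0_iff ord_at diff_divide_distrib sum_subtractf)
  finally show ?thesis .
qed

lemma ord_at_eq_0: "\<phi> \<noteq> 0 \<Longrightarrow> finite_at \<phi> a \<Longrightarrow> value_at \<phi> a \<noteq> 0 \<Longrightarrow> ord_at a \<phi> = 0"
  by (auto simp: ord_at finite_at_def value_at_def order_0I)

text \<open>For a finite set \<open>A\<close> that contains all zeros and poles of \<open>\<phi>\<close> this is \<open>ln |c|\<close>, where \<open>c\<close> is the leading
  coefficient in the expansion \<open>\<phi>(t) = c (t - b)\<^sup>k + \<cdots>\<close> at \<open>b\<close>.\<close>

definition ln_star :: "complex set \<Rightarrow> complex \<Rightarrow> ratfun \<Rightarrow> real" where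
  "ln_star A b \<phi> = ln_lead_at \<phi> + (\<Sum>a\<in>A - {b}. ord_at a \<phi> * ln (cmod (b - a)))"

text \<open>The tame symbol of \<open>\<phi>\<close> and \<open>1 - \<phi>\<close> at \<open>b\<close> has absolute value \<open>1\<close>. Where \<open>\<phi>\<close> has a zero, \<open>1 - \<phi>\<close> has the
  value \<open>1\<close>, and vice versa; where \<open>\<phi>\<close> has a pole, \<open>1 - \<phi>\<close> has a pole of the same order with the opposite
  leading coefficient; elsewhere both orders vanish.\<close>

lemma tame_symbol:
  assumes nz: "\<phi> \<noteq> 0" "\<phi> \<noteq> 1" and A: "finite A"
    "\<And>a. a \<notin> A \<Longrightarrow> finite_at \<phi> a \<and> value_at \<phi> a \<noteq> 0 \<and> value_at \<phi> a \<noteq> 1"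
  shows "ord_at b (1 - \<phi>) * ln_star A b \<phi> = ord_at b \<phi> * ln_star A b (1 - \<phi>)"
proof -
  define f g where "f = numer \<phi>" and "g = denom \<phi>"
  have one: "1 - \<phi> \<noteq> 0" using nz by auto
  have fg: "f \<noteq> 0" "g \<noteq> 0" "g - f \<noteq> 0"
    using nz one numer_eq_0_iff[of \<phi>] numer_eq_0_iff[of "1 - \<phi>"]
    by (auto simp: f_def g_def numer_one_minus)
  have roots: "poly f a \<noteq> 0 \<and> poly g a \<noteq> 0 \<and> poly (g - f) a \<noteq> 0" if "a \<notin> A" for a
    using A(2)[OF that] by (auto simp: f_def g_def finite_at_def value_at_def)
  define l where "l p = ln_lead p + (\<Sum>a\<in>A - {b}. real (Polynomial.order a p) * ln (cmod (b - a)))" for p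
  have l: "l p = ln (cmod (poly p b))" if "p \<in> {f, g, g - f}" "poly p b \<noteq> 0" for p
  proof -
    have "Polynomial.order b p = 0" using that(2) by (simp add: order_0I)
    then have "(\<Sum>a\<in>A - {b}. real (Polynomial.order a p) * ln (cmod (b - a))) = (\<Sum>a\<in>A. real (Polynomial.order a p) * ln (cmod (b - a)))"
      using A(1) by (intro sum.mono_neutral_left) auto
    then show ?thesis unfolding l_def
      using that fg roots by (subst ln_cmod_poly[OF _ A(1)]) (auto simp del: poly_diff)
  qed
  have s: "ln_star A b \<phi> = l f - l g" "ln_star A b (1 - \<phi>) = l (g - f) - l g"
    using nz one by (auto simp: ln_star_def ln_lead_at_def l_def ord_at f_def g_def numer_one_minus
        denom_one_minus algebra_simps sum_subtractf)
  have o: "ord_at b \<phi> = real (Polynomial.order b f) - real (Polynomial.order b g)"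
    "ord_at b (1 - \<phi>) = real (Polynomial.order b (g - f)) - real (Polynomial.order b g)"
    using nz one by (auto simp: ord_at f_def g_def numer_one_minus denom_one_minus)
  have ncr: "poly f b = 0 \<Longrightarrow> poly g b \<noteq> 0"
    using numer_denom_no_common_root by (auto simp: f_def g_def)
  consider "poly f b = 0" | "poly g b = 0" | "poly f b \<noteq> 0" "poly g b \<noteq> 0" by blast
  then show ?thesis
  proof cases
    case 1
    then have "poly (g - f) b = poly g b" "poly g b \<noteq> 0" using ncr by auto
    then show ?thesis using l[of g] l[of "g - f"] by (simp add: s o order_0I)
  next
    case 2
    then have "poly (g - f) b = - poly f b" "poly f b \<noteq> 0" using ncr by auto
    then show ?thesis using l[of f] l[of "g - f"] by (simp add: s o order_0I)
  next
    case 3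
    show ?thesis
    proof (cases "poly (g - f) b = 0")
      case True
      then have "poly f b = poly g b" by simp
      then show ?thesis using 3 l[of f] l[of g] by (simp add: s o order_0I)
    qed (use 3 in \<open>simp add: o order_0I\<close>)
  qed
qed

lemma ord_at_pos_imp_tendsto_0:
  assumes "\<phi> \<noteq> 0" "ord_at b \<phi> > 0"
  shows "(value_at \<phi> \<longlongrightarrow> 0) (at b)"
proof -
  have "Polynomial.order b (numer \<phi>) \<noteq> 0" using assms by (auto simp: ord_at)
  then have r: "poly (numer \<phi>) b = 0" by (auto simp: order_root)
  note r' = numer_denom_no_common_root[OF r]
  have "isCont (\<lambda>t. poly (numer \<phi>) t / poly (denom \<phi>) t) b"
    using r' by (intro continuous_intros)
  then show ?thesis using r by (simp add: isCont_def value_at_def[abs_def])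
qed

lemma ord_at_neg_imp_inverse_tendsto_0:
  assumes "\<phi> \<noteq> 0" "ord_at b \<phi> < 0"
  shows "((\<lambda>t. 1 / value_at \<phi> t) \<longlongrightarrow> 0) (at b)"
proof -
  have "Polynomial.order b (denom \<phi>) \<noteq> 0" using assms by (auto simp: ord_at)
  then have r: "poly (denom \<phi>) b = 0" by (auto simp: order_root)
  then have r': "poly (numer \<phi>) b \<noteq> 0" using numer_denom_no_common_root by blast
  have "isCont (\<lambda>t. poly (denom \<phi>) t / poly (numer \<phi>) t) b"
    using r' by (intro continuous_intros)
  then show ?thesis using r by (simp add: isCont_def value_at_def[abs_def])
qed

lemma finite_irregular:
  assumes "\<not> const_ratfun \<phi>"
  shows "finite {t. \<not> (finite_at \<phi> t \<and> value_at \<phi> t \<noteq> 0 \<and> value_at \<phi> t \<noteq> 1)}"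
proof -
  have "\<phi> \<noteq> 0" "\<phi> \<noteq> 1" using assms const_ratfun_1 by auto
  then have "numer \<phi> \<noteq> 0" "denom \<phi> - numer \<phi> \<noteq> 0"
    using numer_eq_0_iff[of \<phi>] numer_eq_0_iff[of "1 - \<phi>"] by (auto simp: numer_one_minus)
  then have "finite ({t. poly (denom \<phi>) t = 0} \<union> {t. poly (numer \<phi>) t = 0} \<union> {t. poly (denom \<phi> - numer \<phi>) t = 0})"
    using poly_roots_finite by (intro finite_UnI) (auto simp del: poly_diff)
  then show ?thesis
    by (rule rev_finite_subset) (auto simp: finite_at_def value_at_def divide_simps)
qed

section \<open>Independence of logarithms with simple poles\<close>

text \<open>For \<open>s\<close> tending to \<open>0\<close> from the right, \<open>ln s\<close> is unbounded and \<open>G\<close> is bounded, whence \<open>M\<close> vanishes at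
  \<open>0\<close>. Then \<open>s ln s\<close> tending to \<open>0\<close> shows that \<open>G\<close> vanishes there as well, and the relation can be divided
  by \<open>s\<close>, which lowers the degree of \<open>M\<close>.\<close>

lemma poly_mult_ln_analytic_imp_0:
  fixes M :: "complex poly"
  assumes "r > 0" "G holomorphic_on ball 0 r"
    and "\<And>s. 0 < s \<Longrightarrow> s < r \<Longrightarrow> poly M (of_real s) * of_real (ln s) + G (of_real s) = 0"
  shows "M = 0"
  using assms(2,3)
proof (induction "degree M" arbitrary: M G rule: less_induct)
  case less
  have filt: "eventually (\<lambda>s::real. 0 < s \<and> s < r) (at_right 0)"
    using assms(1) eventually_at_right_real[of 0 r] by (auto elim: eventually_mono)
  have ofr: "filterlim complex_of_real (at 0) (at_right 0)"
    unfolding filterlim_at by (auto simp: eventually_at_filter intro!: tendsto_eq_intros)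
  have "isCont G 0"
    using less.prems(1) assms(1) by (intro continuous_on_interior[OF holomorphic_on_imp_continuous_on])
      (auto simp: interior_open)
  then have G: "((\<lambda>s. G (of_real s)) \<longlongrightarrow> G 0) (at_right 0)"
    using ofr unfolding isCont_def by (rule filterlim_compose)
  have "isCont (poly M) 0" by simp
  then have M: "((\<lambda>s. poly M (of_real s)) \<longlongrightarrow> poly M 0) (at_right 0)"
    using ofr unfolding isCont_def by (rule filterlim_compose)
  have M0: "poly M 0 = 0"
  proof -
    have "((\<lambda>s::real. 1 / ln s) \<longlongrightarrow> 0) (at_right 0)" by real_asymp
    then have "((\<lambda>s::real. complex_of_real (1 / ln s)) \<longlongrightarrow> 0) (at_right 0)"
      by (metis of_real_0 tendsto_of_real)
    from tendsto_minus[OF tendsto_mult[OF G this]]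
    have "((\<lambda>s. - (G (of_real s) * of_real (1 / ln s))) \<longlongrightarrow> 0) (at_right 0)" by simp
    moreover have "eventually (\<lambda>s::real. 0 < s \<and> s < min r 1) (at_right 0)"
      using assms(1) eventually_at_right_real[of 0 "min r 1"] by (auto elim: eventually_mono)
    then have "eventually (\<lambda>s. - (G (of_real s) * of_real (1 / ln s)) = poly M (of_real s)) (at_right 0)"
    proof eventually_elim
      case (elim s)
      then have "ln s \<noteq> 0" and "G (of_real s) = - (poly M (of_real s) * of_real (ln s))"
        using less.prems(2)[of s] by (auto simp: add_eq_0_iff)
      then show ?case by simp
    qed
    ultimately have "((\<lambda>s. poly M (of_real s)) \<longlongrightarrow> 0) (at_right (0::real))"
      by (rule Lim_transform_eventually)
    then show ?thesis using M tendsto_unique trivial_limit_at_right_real by blast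
  qed
  then obtain N where N: "M = [:0, 1:] * N"
    using poly_eq_0_iff_dvd[of M 0] by (auto simp: dvd_def)
  show ?case
  proof (rule ccontr)
    assume "M \<noteq> 0"
    then have "N \<noteq> 0" using N by auto
    then have deg: "degree N < degree M" using N by (simp add: degree_pCons_eq)
    have "((\<lambda>s::real. s * ln s) \<longlongrightarrow> 0) (at_right 0)" by real_asymp
    then have "((\<lambda>s::real. complex_of_real (s * ln s)) \<longlongrightarrow> 0) (at_right 0)"
      by (metis of_real_0 tendsto_of_real)
    moreover have "((\<lambda>s. poly N (of_real s)) \<longlongrightarrow> poly N 0) (at_right 0)"
      using ofr by (rule filterlim_compose[rotated]) (simp add: isCont_def[symmetric])
    ultimately have "((\<lambda>s. - (poly N (of_real s) * of_real (s * ln s))) \<longlongrightarrow> - (poly N 0 * 0)) (at_right 0)"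
      by (intro tendsto_minus tendsto_mult)
    moreover have "eventually (\<lambda>s. - (poly N (of_real s) * of_real (s * ln s)) = G (of_real s)) (at_right 0)"
      using filt
    proof eventually_elim
      case (elim s)
      then show ?case using less.prems(2)[of s] by (simp add: N add_eq_0_iff mult_ac)
    qed
    ultimately have "((\<lambda>s. G (of_real s)) \<longlongrightarrow> - (poly N 0 * 0)) (at_right (0::real))"
      by (rule Lim_transform_eventually)
    then have G0: "G 0 = 0" using G tendsto_unique trivial_limit_at_right_real by fastforce
    define H where "H = (\<lambda>z. if z = 0 then deriv G 0 else G z / z)"
    have "H holomorphic_on ball 0 r"
      by (rule pole_theorem_open_0[OF less.prems(1), of 0]) (auto simp: H_def G0)
    moreover have "poly N (of_real s) * of_real (ln s) + H (of_real s) = 0" if "0 < s" "s < r" for s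
    proof -
      have "of_real s * (poly N (of_real s) * of_real (ln s) + H (of_real s)) = 0"
        using less.prems(2)[OF that] that by (simp add: N H_def algebra_simps)
      then show ?thesis using that by simp
    qed
    ultimately have "N = 0" using less.hyps[OF deg] by blast
    with \<open>N \<noteq> 0\<close> show False by simp
  qed
qed

lemma poly_eq_0_if_zero_on_reals:
  fixes p :: "complex poly"
  assumes "\<And>s::real. 0 < s \<Longrightarrow> s < 1 \<Longrightarrow> poly p (of_real s) = 0"
  shows "p = 0"
proof (rule ccontr)
  assume "p \<noteq> 0"
  then have "finite {z. poly p z = 0}" by (rule poly_roots_finite)
  moreover have "complex_of_real ` {0<..<1} \<subseteq> {z. poly p z = 0}" using assms by auto
  ultimately have "finite (complex_of_real ` {0<..<1})" using finite_subset by blast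
  then show False by (simp add: finite_image_iff inj_on_def infinite_Ioo)
qed

text \<open>For real \<open>s\<close> the square of \<open>|1 + s u/d|\<close> is the product of \<open>1 + s u/d\<close> and \<open>1 + s cnj (u/d)\<close>. The principal
  logarithms of these two factors make sense for complex \<open>s\<close> and are holomorphic for \<open>|s| < |d|\<close>.\<close>

lemma ln_cmod_line_analytic:
  assumes "d \<noteq> 0" "cmod u = 1"
  defines "L \<equiv> (\<lambda>s. of_real (ln (cmod d)) + (Ln (1 + s * (u / d)) + Ln (1 + s * cnj (u / d))) / 2)"
  shows "L holomorphic_on ball 0 (cmod d)"
    and "\<And>s. \<bar>s\<bar> < cmod d \<Longrightarrow> L (of_real s) = of_real (ln (cmod (d + of_real s * u)))"
proof -
  have pos: "1 + s * w \<notin> \<real>\<^sub>\<le>\<^sub>0" if "cmod s < cmod d" "cmod w = 1 / cmod d" for s w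
  proof -
    have "cmod (s * w) < 1" using that assms(1) by (simp add: norm_mult)
    then have "Re (s * w) > -1" using abs_Re_le_cmod[of "s * w"] by linarith
    then show ?thesis by (simp add: complex_nonpos_Reals_iff)
  qed
  have ud: "cmod (u / d) = 1 / cmod d" "cmod (cnj (u / d)) = 1 / cmod d"
    using assms(2) by (simp_all add: norm_divide)
  show "L holomorphic_on ball 0 (cmod d)"
    unfolding L_def using pos[OF _ ud(1)] pos[OF _ ud(2)] by (intro holomorphic_intros) auto
  fix s :: real assume s: "\<bar>s\<bar> < cmod d"
  let ?w = "1 + of_real s * (u / d)"
  have w: "?w \<notin> \<real>\<^sub>\<le>\<^sub>0" using pos[OF _ ud(1), of "of_real s"] s by simp
  then have w0: "?w \<noteq> 0" by auto
  have "1 + of_real s * cnj (u / d) = cnj ?w" by simp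
  then have "(Ln ?w + Ln (1 + of_real s * cnj (u / d))) / 2 = of_real (Re (Ln ?w))"
    by (simp only: cnj_Ln[OF w, symmetric]) (simp add: complex_eq_iff)
  also have "Re (Ln ?w) = ln (cmod ?w)" using w0 by simp
  finally have "L (of_real s) = of_real (ln (cmod d) + ln (cmod ?w))" by (simp add: L_def)
  also have "ln (cmod d) + ln (cmod ?w) = ln (cmod (d * ?w))"
    using assms(1) w0 by (simp add: norm_mult ln_mult_pos)
  also have "d * ?w = d + of_real s * u" using assms(1) by (simp add: algebra_simps)
  finally show "L (of_real s) = of_real (ln (cmod (d + of_real s * u)))" .
qed

text \<open>A polynomial in \<open>t\<close> and its conjugate which vanishes for all \<open>t\<close> still vanishes when these two are
  replaced by independent variables. With \<open>t = x + \<i> y\<close> the relation holds for real \<open>x\<close> and \<open>y\<close>; being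
  polynomial in each of them, it then holds for complex \<open>x\<close> and real \<open>y\<close>, and finally for complex \<open>x\<close>
  and \<open>y\<close>.\<close>

lemma vanishing_polarisation:
  fixes P :: "'i \<Rightarrow> complex poly" and T :: "'i \<Rightarrow> 'i \<Rightarrow> complex"
  assumes "finite A" and z: "\<And>t. (\<Sum>b\<in>A. \<Sum>c\<in>A. T b c * poly (P b) t * cnj (poly (P c) t)) = 0"
  shows "(\<Sum>b\<in>A. \<Sum>c\<in>A. T b c * poly (P b) s * cnj (poly (P c) t)) = 0"
proof -
  define Q where "Q c = map_poly cnj (P c)" for c
  have Q: "cnj (poly (P c) t) = poly (Q c) (cnj t)" for c t
    unfolding Q_def by (rule poly_cnj)
  let ?F = "\<lambda>x y. \<Sum>b\<in>A. \<Sum>c\<in>A. T b c * poly (P b) (x + \<i> * y) * poly (Q c) (x - \<i> * y)"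
  have F1: "?F (of_real x) (of_real y) = 0" for x y
    using z[of "of_real x + \<i> * of_real y"] unfolding Q by simp
  have F2: "?F x (of_real y) = 0" for x y
  proof -
    define p where "p = (\<Sum>b\<in>A. \<Sum>c\<in>A. Polynomial.smult (T b c) (pcompose (P b) [:\<i> * of_real y, 1:] * pcompose (Q c) [:- (\<i> * of_real y), 1:]))"
    have p: "poly p x = ?F x (of_real y)" for x
      by (simp add: p_def poly_sum poly_pcompose mult.assoc add.commute)
    have "p = 0" by (rule poly_eq_0_if_zero_on_reals) (simp only: p F1)
    then show ?thesis using p[of x] by simp
  qed
  have F3: "?F x y = 0" for x y
  proof -
    define p where "p = (\<Sum>b\<in>A. \<Sum>c\<in>A. Polynomial.smult (T b c) (pcompose (P b) [:x, \<i>:] * pcompose (Q c) [:x, - \<i>:]))"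
    have p: "poly p y = ?F x y" for y
      by (simp add: p_def poly_sum poly_pcompose mult.assoc mult.commute[of y])
    have "p = 0" by (rule poly_eq_0_if_zero_on_reals) (simp only: p F2)
    then show ?thesis using p[of y] by simp
  qed
  have "(s + cnj t) / 2 + \<i> * ((s - cnj t) / (2 * \<i>)) = s" "(s + cnj t) / 2 - \<i> * ((s - cnj t) / (2 * \<i>)) = cnj t"
    by (simp_all add: add_divide_distrib diff_divide_distrib)
  with F3[of "(s + cnj t) / 2" "(s - cnj t) / (2 * \<i>)"] show ?thesis by (simp only: Q)
qed

definition cofactor :: "complex set \<Rightarrow> complex \<Rightarrow> complex poly" where
  "cofactor A b = (\<Prod>a\<in>A - {b}. [:- a, 1:])"

lemma poly_cofactor: "poly (cofactor A b) t = (\<Prod>a\<in>A - {b}. t - a)"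
  by (simp add: cofactor_def poly_prod)

lemma cofactor_divide:
  assumes "finite A" "b \<in> A" "t \<notin> A"
  shows "1 / (t - b) = poly (cofactor A b) t / (\<Prod>a\<in>A. t - a)"
proof -
  have "(\<Prod>a\<in>A. t - a) = (t - b) * (\<Prod>a\<in>A - {b}. t - a)" using assms by (intro prod.remove) auto
  moreover have "(\<Prod>a\<in>A - {b}. t - a) \<noteq> 0" using assms by auto
  ultimately show ?thesis using assms by (simp add: poly_cofactor)
qed

lemma cofactor_at: "finite A \<Longrightarrow> b \<in> A \<Longrightarrow> c \<in> A \<Longrightarrow> poly (cofactor A b) c = 0 \<longleftrightarrow> b \<noteq> c"
  by (auto simp: poly_cofactor)

text \<open>The polarised relation at \<open>(b0, c0)\<close> isolates one coefficient, because \<open>cofactor A b\<close> vanishes at all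
  points of \<open>A\<close> except \<open>b\<close>.\<close>

lemma pole_pair_independent:
  assumes "finite A" and z: "\<And>t. (\<Sum>b\<in>A. \<Sum>c\<in>A. T b c * poly (cofactor A b) t * cnj (poly (cofactor A c) t)) = 0"
    and bc: "b0 \<in> A" "c0 \<in> A"
  shows "T b0 c0 = 0"
proof -
  have "0 = (\<Sum>b\<in>A. \<Sum>c\<in>A. T b c * poly (cofactor A b) b0 * cnj (poly (cofactor A c) c0))"
    using vanishing_polarisation[OF assms(1), of T "cofactor A", OF z] by simp
  also have "\<dots> = (\<Sum>b\<in>A. if b = b0 then (\<Sum>c\<in>A. T b c * poly (cofactor A b) b0 * cnj (poly (cofactor A c) c0)) else 0)"
    using cofactor_at[OF assms(1)] bc by (intro sum.cong refl) (auto intro!: sum.neutral)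
  also have "\<dots> = (\<Sum>c\<in>A. T b0 c * poly (cofactor A b0) b0 * cnj (poly (cofactor A c) c0))"
    using assms(1) bc by simp
  also have "\<dots> = (\<Sum>c\<in>A. if c = c0 then T b0 c * poly (cofactor A b0) b0 * cnj (poly (cofactor A c) c0) else 0)"
    using cofactor_at[OF assms(1)] bc by (intro sum.cong) auto
  also have "\<dots> = T b0 c0 * poly (cofactor A b0) b0 * cnj (poly (cofactor A c0) c0)"
    using assms(1) bc by simp
  finally show ?thesis using cofactor_at[OF assms(1)] bc by simp
qed

text \<open>After clearing denominators the hypothesis is a linear relation between \<open>1\<close> and the functions \<open>ln |t - a|\<close>
  whose coefficients, \<open>R k\<close> and \<open>R (T a)\<close>, are polynomials in \<open>t\<close> and its conjugate. On a line through \<open>a0\<close> all logarithms but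
  \<open>ln |t - a0|\<close> are analytic near \<open>a0\<close>, so the coefficient of that one vanishes on each such line, that is,
  everywhere. The polynomials \<open>R S\<close> in turn determine the numbers \<open>S b c\<close>.\<close>

lemma log_pole_independent:
  fixes T :: "complex \<Rightarrow> complex \<Rightarrow> complex \<Rightarrow> complex"
  assumes A: "finite A"
    and eq: "\<And>t. t \<notin> A \<Longrightarrow> (\<Sum>b\<in>A. \<Sum>c\<in>A. ((\<Sum>a\<in>A. T a b c * of_real (ln (cmod (t - a)))) + k b c) / ((t - b) * cnj (t - c))) = 0"
    and abc: "a0 \<in> A" "b0 \<in> A" "c0 \<in> A"
  shows "T a0 b0 c0 = 0"
proof -
  define R where "R S t = (\<Sum>b\<in>A. \<Sum>c\<in>A. S b c * poly (cofactor A b) t * cnj (poly (cofactor A c) t))"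
    for S :: "complex \<Rightarrow> complex \<Rightarrow> complex" and t
  have eqR: "(\<Sum>a\<in>A. of_real (ln (cmod (t - a))) * R (T a) t) + R k t = 0" if t: "t \<notin> A" for t
  proof -
    define p where "p = (\<Prod>a\<in>A. t - a)"
    have p: "p \<noteq> 0" using t A by (auto simp: p_def)
    have d: "X / ((t - b) * cnj (t - c)) = X * poly (cofactor A b) t * cnj (poly (cofactor A c) t) / (p * cnj p)"
      if "b \<in> A" "c \<in> A" for X b c
    proof -
      have "X / ((t - b) * cnj (t - c)) = X * (1 / (t - b)) * cnj (1 / (t - c))" by simp
      also have "\<dots> = X * (poly (cofactor A b) t / p) * cnj (poly (cofactor A c) t / p)"
        using cofactor_divide[OF A that(1) t] cofactor_divide[OF A that(2) t] unfolding p_def by (simp only:)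
      finally show ?thesis by simp
    qed
    have "0 = (\<Sum>b\<in>A. \<Sum>c\<in>A. ((\<Sum>a\<in>A. T a b c * of_real (ln (cmod (t - a)))) + k b c) * poly (cofactor A b) t * cnj (poly (cofactor A c) t) / (p * cnj p))"
      using eq[OF t] d by simp
    also have "\<dots> = (\<Sum>b\<in>A. \<Sum>c\<in>A. ((\<Sum>a\<in>A. T a b c * of_real (ln (cmod (t - a)))) + k b c) * poly (cofactor A b) t * cnj (poly (cofactor A c) t)) / (p * cnj p)"
      by (simp only: sum_divide_distrib)
    finally have "0 = (\<Sum>b\<in>A. \<Sum>c\<in>A. ((\<Sum>a\<in>A. T a b c * of_real (ln (cmod (t - a)))) + k b c) * poly (cofactor A b) t * cnj (poly (cofactor A c) t))"
      using p by simp
    also have "\<dots> = (\<Sum>b\<in>A. \<Sum>c\<in>A. \<Sum>a\<in>A. of_real (ln (cmod (t - a))) * (T a b c * poly (cofactor A b) t * cnj (poly (cofactor A c) t))) + R k t"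
      unfolding R_def sum.distrib[symmetric]
      by (intro sum.cong refl) (simp add: distrib_right sum_distrib_right mult.assoc mult.left_commute)
    also have "(\<Sum>b\<in>A. \<Sum>c\<in>A. \<Sum>a\<in>A. of_real (ln (cmod (t - a))) * (T a b c * poly (cofactor A b) t * cnj (poly (cofactor A c) t)))
      = (\<Sum>a\<in>A. of_real (ln (cmod (t - a))) * R (T a) t)"
      unfolding R_def sum_distrib_left by (subst sum.swap, rule sum.cong[OF refl], rule sum.swap) 
    finally show ?thesis by simp
  qed
  have "R (T a0) t = 0" for t
  proof -
    \<comment> \<open>The line from \<open>a0\<close> in the direction \<open>u\<close> passes through \<open>t\<close>; for \<open>t = a0\<close> any direction will do.\<close>
    define u where "u = (if t = a0 then 1 else (t - a0) / of_real (cmod (t - a0)))"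
    define s0 where "s0 = cmod (t - a0)"
    have u: "cmod u = 1" and t: "t = a0 + of_real s0 * u" by (auto simp: u_def s0_def norm_divide)
    \<comment> \<open>The restriction of \<open>R S\<close> to this line is a polynomial in the real parameter \<open>s\<close>.\<close>
    define RP where "RP S = (\<Sum>b\<in>A. \<Sum>c\<in>A. Polynomial.smult (S b c) (pcompose (cofactor A b) [:a0, u:] *
        pcompose (map_poly cnj (cofactor A c)) [:cnj a0, cnj u:]))" for S :: "complex \<Rightarrow> complex \<Rightarrow> complex"
    have cj: "cnj (poly (cofactor A c) (a0 + of_real s * u)) =
        poly (map_poly cnj (cofactor A c)) (cnj a0 + of_real s * cnj u)" for c s
      by (subst poly_cnj) simp
    have RP: "poly (RP S) (of_real s) = R S (a0 + of_real s * u)" for S s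
      unfolding RP_def R_def cj poly_sum poly_smult poly_mult poly_pcompose
      by (intro sum.cong refl) simp
    \<comment> \<open>A radius around \<open>a0\<close> within which there is no other point of \<open>A\<close>.\<close>
    define d where "d = Min (insert 1 ((\<lambda>a. cmod (a0 - a)) ` (A - {a0})))"
    have d: "d > 0" "\<And>a. a \<in> A - {a0} \<Longrightarrow> d \<le> cmod (a0 - a)" using A by (auto simp: d_def)
    define L where "L a = (\<lambda>s. of_real (ln (cmod (a0 - a))) + (Ln (1 + s * (u / (a0 - a))) + Ln (1 + s * cnj (u / (a0 - a)))) / 2)" for a
    have L1: "L a holomorphic_on ball 0 d" if "a \<in> A - {a0}" for a
    proof -
      have "L a holomorphic_on ball 0 (cmod (a0 - a))"
        unfolding L_def by (rule ln_cmod_line_analytic(1)) (use that u in auto)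
      then show ?thesis using d(2)[OF that] by (rule holomorphic_on_subset[OF _ subset_ball])
    qed
    have L2: "L a (of_real s) = of_real (ln (cmod (a0 + of_real s * u - a)))" if "a \<in> A - {a0}" "0 < s" "s < d" for a s
    proof -
      have "L a (of_real s) = of_real (ln (cmod (a0 - a + of_real s * u)))"
        unfolding L_def by (rule ln_cmod_line_analytic(2)) (use that u d(2)[OF that(1)] in auto)
      also have "a0 - a + of_real s * u = a0 + of_real s * u - a" by simp
      finally show ?thesis .
    qed
    define G where "G = (\<lambda>s. (\<Sum>a\<in>A - {a0}. L a s * poly (RP (T a)) s) + poly (RP k) s)"
    have "RP (T a0) = 0"
    proof (rule poly_mult_ln_analytic_imp_0[OF d(1)])
      show "G holomorphic_on ball 0 d" unfolding G_def using L1 by (intro holomorphic_intros) auto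
      fix s :: real assume s: "0 < s" "s < d"
      let ?t = "a0 + of_real s * u"
      have c0: "cmod (?t - a0) = s" using s u by (simp add: norm_mult)
      have "?t \<notin> A"
      proof
        assume "?t \<in> A"
        then have "?t \<in> A - {a0}" using s u by auto
        from d(2)[OF this] show False using s u by (simp add: norm_mult)
      qed
      from eqR[OF this]
      have "of_real (ln (cmod (?t - a0))) * R (T a0) ?t + (\<Sum>a\<in>A - {a0}. of_real (ln (cmod (?t - a))) * R (T a) ?t) + R k ?t = 0"
        using A abc(1) by (simp add: sum.remove)
      then show "poly (RP (T a0)) (of_real s) * of_real (ln s) + G (of_real s) = 0"
        unfolding c0 G_def RP using L2 s by (simp add: mult.commute add.assoc)
    qed
    then show ?thesis using RP[of "T a0" s0] t by simp
  qed
  then show ?thesis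
    using pole_pair_independent[OF A, of "T a0"] abc unfolding R_def by blast
qed

section \<open>Differentiating polylogarithms of a family of rational functions\<close>

lemma has_cgrad_unique:
  assumes "has_cgrad f g z" "has_cgrad f g' z"
  shows "g = g'"
proof -
  have "(\<lambda>v. Re (g * v)) = (\<lambda>v. Re (g' * v))"
    using assms unfolding has_cgrad_def by (rule has_derivative_unique)
  then have "Re (g * 1) = Re (g' * 1)" "Re (g * \<i>) = Re (g' * \<i>)" by meson+
  then show ?thesis by (simp add: complex_eq_iff)
qed

text \<open>The number \<open>q\<close> is the derivative of \<open>F\<close> with respect to the conjugate of \<open>t\<close>. The holomorphic derivative
  \<open>p\<close> is left open since only \<open>q\<close> is of interest: holomorphic factors behave like constants for it.\<close>

definition has_dbar :: "(complex \<Rightarrow> complex) \<Rightarrow> complex \<Rightarrow> complex \<Rightarrow> bool" where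
  "has_dbar F q t \<longleftrightarrow> (\<exists>p. (F has_derivative (\<lambda>v. p * v + q * cnj v)) (at t))"

lemma has_dbar_of_real: "has_cgrad f g t \<Longrightarrow> has_dbar (\<lambda>t. of_real (f t)) (cnj g / 2) t"
proof -
  assume "has_cgrad f g t"
  then have "((\<lambda>t. complex_of_real (f t)) has_derivative (\<lambda>v. of_real (Re (g * v)))) (at t)"
    unfolding has_cgrad_def by (rule has_derivative_of_real)
  moreover have "(\<lambda>v. complex_of_real (Re (g * v))) = (\<lambda>v. g / 2 * v + cnj g / 2 * cnj v)"
    by (rule ext) (simp add: complex_eq_iff field_simps)
  ultimately show ?thesis unfolding has_dbar_def by metis
qed

lemma has_dbar_add:
  assumes "has_dbar F q t" "has_dbar G r t" shows "has_dbar (\<lambda>t. F t + G t) (q + r) t"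
proof -
  obtain p p' where "(F has_derivative (\<lambda>v. p * v + q * cnj v)) (at t)" "(G has_derivative (\<lambda>v. p' * v + r * cnj v)) (at t)"
    using assms by (auto simp: has_dbar_def)
  from has_derivative_add[OF this]
  have "((\<lambda>t. F t + G t) has_derivative (\<lambda>v. (p + p') * v + (q + r) * cnj v)) (at t)"
    by (simp add: algebra_simps)
  then show ?thesis unfolding has_dbar_def by blast
qed

lemma has_dbar_sum:
  "finite I \<Longrightarrow> (\<And>i. i \<in> I \<Longrightarrow> has_dbar (F i) (q i) t) \<Longrightarrow> has_dbar (\<lambda>t. \<Sum>i\<in>I. F i t) (\<Sum>i\<in>I. q i) t"
proof (induction I rule: finite_induct)
  case empty
  have "((\<lambda>t. 0) has_derivative (\<lambda>v. 0 * v + 0 * cnj v)) (at t)" by simp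
  then show ?case unfolding has_dbar_def sum.empty by blast
qed (simp add: has_dbar_add)

lemma has_dbar_mult_holomorphic:
  assumes "has_dbar F q t" "(h has_field_derivative h') (at t)"
  shows "has_dbar (\<lambda>t. h t * F t) (h t * q) t"
proof -
  obtain p where "(F has_derivative (\<lambda>v. p * v + q * cnj v)) (at t)" using assms by (auto simp: has_dbar_def)
  from has_derivative_mult[OF assms(2)[unfolded has_field_derivative_def] this]
  have "((\<lambda>t. h t * F t) has_derivative (\<lambda>v. (h t * p + h' * F t) * v + (h t * q) * cnj v)) (at t)"
    by (simp add: algebra_simps)
  then show ?thesis unfolding has_dbar_def by blast
qed

lemma has_dbar_cmult: "has_dbar F q t \<Longrightarrow> has_dbar (\<lambda>t. c * F t) (c * q) t"
  using has_dbar_mult_holomorphic[of F q t "\<lambda>_. c" 0] by simp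

lemma has_dbar_locally_0:
  assumes "has_dbar F q t" "open S" "t \<in> S" "\<And>s. s \<in> S \<Longrightarrow> F s = 0"
  shows "q = 0"
proof -
  obtain p where p: "(F has_derivative (\<lambda>v. p * v + q * cnj v)) (at t)" using assms by (auto simp: has_dbar_def)
  have "((\<lambda>_. 0) has_derivative (\<lambda>v. p * v + q * cnj v)) (at t)"
    by (rule has_derivative_transform_within_open[OF p assms(2,3)]) (use assms(4) in auto)
  then have "(\<lambda>v. p * v + q * cnj v) = (\<lambda>_. 0)"
    using has_derivative_unique has_derivative_const by blast
  then have "p * 1 + q * cnj 1 = 0" "p * \<i> + q * cnj \<i> = 0" by meson+
  then have "p + q = 0" "\<i> * (p - q) = 0" by (simp_all add: algebra_simps)
  then show "q = 0" by (simp add: eq_neg_iff_add_eq_0[symmetric])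
qed

text \<open>The terms of a formal sum of rational functions, without the constant ones. In the locale, \<open>A\<close> is the
  finite set of points at which some \<open>\<phi>\<close> takes one of the values \<open>0\<close>, \<open>1\<close>, \<open>\<infinity>\<close>; \<open>v\<close> and \<open>w\<close> are the orders of
  \<open>\<phi>\<close> and \<open>1 - \<phi>\<close>; \<open>L\<close> and \<open>M\<close> are the logarithms of their absolute values; \<open>dL\<close> and \<open>dM\<close> are the gradients of
  \<open>L\<close> and \<open>M\<close>.\<close>

locale ratfun_family =
  fixes I :: "ratfun set"
  assumes finite_I: "finite I" and nonconst: "\<And>\<phi>. \<phi> \<in> I \<Longrightarrow> \<not> const_ratfun \<phi>"
begin

definition A :: "complex set" where
  "A = (\<Union>\<phi>\<in>I. {t. \<not> (finite_at \<phi> t \<and> value_at \<phi> t \<noteq> 0 \<and> value_at \<phi> t \<noteq> 1)})"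

lemma finite_A: "finite A"
  unfolding A_def using finite_I finite_irregular[OF nonconst] by blast

lemma regular: "\<phi> \<in> I \<Longrightarrow> t \<notin> A \<Longrightarrow> finite_at \<phi> t \<and> value_at \<phi> t \<noteq> 0 \<and> value_at \<phi> t \<noteq> 1"
  by (auto simp: A_def)

lemma open_A: "open (- A)" and connected_A: "connected (- A)"
proof -
  show "open (- A)" using finite_A by (simp add: open_Compl finite_imp_closed)
  have "connected (UNIV - A)" by (rule connected_open_delete_finite) (use finite_A in auto)
  then show "connected (- A)" by (simp add: Compl_eq_Diff_UNIV)
qed

abbreviation v :: "ratfun \<Rightarrow> complex \<Rightarrow> real" where "v \<phi> a \<equiv> ord_at a \<phi>"
abbreviation w :: "ratfun \<Rightarrow> complex \<Rightarrow> real" where "w \<phi> a \<equiv> ord_at a (1 - \<phi>)"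

definition L :: "ratfun \<Rightarrow> complex \<Rightarrow> real" where "L \<phi> t = ln (cmod (value_at \<phi> t))"
definition M :: "ratfun \<Rightarrow> complex \<Rightarrow> real" where "M \<phi> t = ln (cmod (1 - value_at \<phi> t))"
definition dL :: "ratfun \<Rightarrow> complex \<Rightarrow> complex" where "dL \<phi> t = (\<Sum>a\<in>A. of_real (v \<phi> a) / (t - a))"
definition dM :: "ratfun \<Rightarrow> complex \<Rightarrow> complex" where "dM \<phi> t = (\<Sum>a\<in>A. of_real (w \<phi> a) / (t - a))"

lemma nz: "\<phi> \<in> I \<Longrightarrow> \<phi> \<noteq> 0 \<and> \<phi> \<noteq> 1 \<and> 1 - \<phi> \<noteq> 0"
  using nonconst const_ratfun_1 by auto

lemma L_eq: "\<phi> \<in> I \<Longrightarrow> t \<notin> A \<Longrightarrow> L \<phi> t = ln_lead_at \<phi> + (\<Sum>a\<in>A. v \<phi> a * ln (cmod (t - a)))"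
  unfolding L_def using nz regular finite_A by (intro ln_cmod_value_at) auto

lemma regular_one_minus: "\<phi> \<in> I \<Longrightarrow> t \<notin> A \<Longrightarrow> finite_at (1 - \<phi>) t \<and> value_at (1 - \<phi>) t \<noteq> 0 \<and> value_at (1 - \<phi>) t = 1 - value_at \<phi> t"
  using regular[of \<phi> t] by (simp add: finite_at_one_minus value_at_one_minus)

lemma M_eq: "\<phi> \<in> I \<Longrightarrow> t \<notin> A \<Longrightarrow> M \<phi> t = ln_lead_at (1 - \<phi>) + (\<Sum>a\<in>A. w \<phi> a * ln (cmod (t - a)))"
proof -
  assume \<phi>: "\<phi> \<in> I" and t: "t \<notin> A"
  have "ln (cmod (value_at (1 - \<phi>) t)) = ln_lead_at (1 - \<phi>) + (\<Sum>a\<in>A. w \<phi> a * ln (cmod (t - a)))"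
    by (rule ln_cmod_value_at) (use nz[OF \<phi>] regular_one_minus[OF \<phi>] finite_A t in blast)+
  then show ?thesis using regular_one_minus[OF \<phi> t] by (simp add: M_def)
qed

lemma val_deriv: "\<phi> \<in> I \<Longrightarrow> t \<notin> A \<Longrightarrow> (value_at \<phi> has_field_derivative value_at \<phi> t * dL \<phi> t) (at t)"
  unfolding dL_def using nz regular finite_A by (intro value_at_has_deriv) auto

lemma one_minus_val_deriv:
  assumes "\<phi> \<in> I" "t \<notin> A"
  shows "((\<lambda>t. 1 - value_at \<phi> t) has_field_derivative (1 - value_at \<phi> t) * dM \<phi> t) (at t)"
proof -
  have "(value_at (1 - \<phi>) has_field_derivative value_at (1 - \<phi>) t * dM \<phi> t) (at t)"
    unfolding dM_def by (rule value_at_has_deriv) (use nz[OF assms(1)] regular_one_minus[OF assms(1)] finite_A assms(2) in blast)+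
  then show ?thesis
    using has_field_derivative_transform_within_open[of "value_at (1 - \<phi>)" _ t "- A" "\<lambda>t. 1 - value_at \<phi> t"]
      open_A regular_one_minus assms by auto
qed

text \<open>Both sides are the derivative of \<open>\<phi>\<close>.\<close>

lemma dL_dM: "\<phi> \<in> I \<Longrightarrow> t \<notin> A \<Longrightarrow> value_at \<phi> t * dL \<phi> t = - ((1 - value_at \<phi> t) * dM \<phi> t)"
  using DERIV_unique[OF DERIV_diff[OF DERIV_const[of 1] val_deriv] one_minus_val_deriv]
  by (metis add.inverse_inverse diff_0)

lemma val_quotients:
  assumes "\<phi> \<in> I" "t \<notin> A"
  shows "value_at \<phi> t * dL \<phi> t / value_at \<phi> t = dL \<phi> t" "value_at \<phi> t * dL \<phi> t / (1 - value_at \<phi> t) = - dM \<phi> t"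
proof -
  show "value_at \<phi> t * dL \<phi> t / value_at \<phi> t = dL \<phi> t" using regular[OF assms] by simp
  have "1 - value_at \<phi> t \<noteq> 0" using regular[OF assms] by auto
  then show "value_at \<phi> t * dL \<phi> t / (1 - value_at \<phi> t) = - dM \<phi> t" unfolding dL_dM[OF assms] by simp
qed

lemma L_cgrad: "\<phi> \<in> I \<Longrightarrow> t \<notin> A \<Longrightarrow> has_cgrad (L \<phi>) (dL \<phi> t) t"
  using has_cgrad_compose[OF val_deriv has_cgrad_ln_cmod] regular[of \<phi> t] unfolding L_def[abs_def] by fastforce

lemma M_cgrad: "\<phi> \<in> I \<Longrightarrow> t \<notin> A \<Longrightarrow> has_cgrad (M \<phi>) (dM \<phi> t) t"
  using has_cgrad_compose[OF one_minus_val_deriv has_cgrad_ln_cmod] regular[of \<phi> t] unfolding M_def[abs_def] by fastforce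

text \<open>Substituting \<open>\<phi>(t)\<close> for \<open>z\<close> turns \<open>dz/z\<close> into \<open>dL\<close> and \<open>dz/(1 - z)\<close> into \<open>- dM\<close>.\<close>

lemma zagier_2_val_cgrad:
  assumes "\<phi> \<in> I" "t \<notin> A"
  shows "has_cgrad (\<lambda>t. zagier 2 (value_at \<phi> t)) (\<i> * (of_real (M \<phi> t) * dL \<phi> t - of_real (L \<phi> t) * dM \<phi> t)) t"
proof -
  let ?z = "value_at \<phi> t"
  have z: "?z \<noteq> 0" "1 - ?z \<noteq> 0" using regular[OF assms] by auto
  have "has_cgrad (\<lambda>t. zagier 2 (value_at \<phi> t)) (cgrad2 ?z * (?z * dL \<phi> t)) t"
    by (rule has_cgrad_compose[OF val_deriv[OF assms] has_cgrad_zagier_2]) (use z in auto)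
  also have "cgrad2 ?z * (?z * dL \<phi> t) = \<i> * (of_real (M \<phi> t) * (?z * dL \<phi> t) / ?z + of_real (L \<phi> t) * (?z * dL \<phi> t) / (1 - ?z))"
    by (simp add: cgrad2_def L_def M_def algebra_simps)
  also have "\<dots> = \<i> * (of_real (M \<phi> t) * (?z * dL \<phi> t / ?z) + of_real (L \<phi> t) * (?z * dL \<phi> t / (1 - ?z)))"
    by (simp only: times_divide_eq_right)
  also have "\<dots> = \<i> * (of_real (M \<phi> t) * dL \<phi> t - of_real (L \<phi> t) * dM \<phi> t)"
    unfolding val_quotients[OF assms] by simp
  finally show ?thesis .
qed

lemma zagier_3_val_cgrad:
  assumes "\<phi> \<in> I" "t \<notin> A"
  shows "has_cgrad (\<lambda>t. zagier 3 (value_at \<phi> t))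
    ((\<i> * of_real (zagier 2 (value_at \<phi> t)) + of_real (L \<phi> t * M \<phi> t / 3)) * dL \<phi> t - of_real ((L \<phi> t)\<^sup>2 / 3) * dM \<phi> t) t"
proof -
  let ?z = "value_at \<phi> t" and ?d = "zagier 2 (value_at \<phi> t)"
  have z: "?z \<noteq> 0" "1 - ?z \<noteq> 0" using regular[OF assms] by auto
  have "has_cgrad (\<lambda>t. zagier 3 (value_at \<phi> t)) (cgrad3 ?z ?d * (?z * dL \<phi> t)) t"
    by (rule has_cgrad_compose[OF val_deriv[OF assms] has_cgrad_zagier_3]) (use z in auto)
  also have "cgrad3 ?z ?d * (?z * dL \<phi> t) = (\<i> * of_real ?d + of_real (L \<phi> t * M \<phi> t / 3)) * (?z * dL \<phi> t) / ?z
      + of_real ((L \<phi> t)\<^sup>2 / 3) * (?z * dL \<phi> t) / (1 - ?z)"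
    by (simp add: cgrad3_def L_def M_def distrib_right)
  also have "\<dots> = (\<i> * of_real ?d + of_real (L \<phi> t * M \<phi> t / 3)) * (?z * dL \<phi> t / ?z)
      + of_real ((L \<phi> t)\<^sup>2 / 3) * (?z * dL \<phi> t / (1 - ?z))"
    by (simp only: times_divide_eq_right)
  also have "\<dots> = (\<i> * of_real ?d + of_real (L \<phi> t * M \<phi> t / 3)) * dL \<phi> t - of_real ((L \<phi> t)\<^sup>2 / 3) * dM \<phi> t"
    unfolding val_quotients[OF assms] by simp
  finally show ?thesis .
qed

text \<open>The tame symbol relation, solved for the leading coefficients at infinity, which enter the expansions
  of \<open>L\<close> and \<open>M\<close> as constants.\<close>

lemma tame: "\<phi> \<in> I \<Longrightarrow> v \<phi> b * ln_lead_at (1 - \<phi>) - w \<phi> b * ln_lead_at \<phi> =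
    - (\<Sum>a\<in>A - {b}. (v \<phi> b * w \<phi> a - w \<phi> b * v \<phi> a) * ln (cmod (b - a)))"
  using tame_symbol[of \<phi> A b] nz finite_A regular unfolding ln_star_def
  by (auto simp: algebra_simps sum_subtractf sum_distrib_left)

lemma const_imp_cgrad_0:
  assumes const: "\<And>t. t \<notin> A \<Longrightarrow> f t = c" and "has_cgrad f g t" "t \<notin> A"
  shows "g = 0"
proof -
  have "has_cgrad f 0 t"
    by (rule has_cgrad_cong[OF has_cgrad_const[of c] open_A]) (use assms in auto)
  with assms(2) show ?thesis by (rule has_cgrad_unique)
qed

lemma cgrad_0_imp_const:
  assumes "\<And>t. t \<notin> A \<Longrightarrow> has_cgrad f 0 t"
  shows "\<exists>c. \<forall>t. t \<notin> A \<longrightarrow> f t = c"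
proof (cases "- A = {}")
  case False
  then obtain s where s: "s \<in> - A" by auto
  have "f t = f s" if "t \<notin> A" for t
    by (rule has_cgrad_0_imp_const[OF open_A connected_A, where h = f]) (use assms that s in simp_all)
  then show ?thesis by blast
qed auto

definition f2 :: "(ratfun \<Rightarrow> real) \<Rightarrow> complex \<Rightarrow> real" where
  "f2 m t = (\<Sum>\<phi>\<in>I. m \<phi> * zagier 2 (value_at \<phi> t))"

definition f3 :: "(ratfun \<Rightarrow> real) \<Rightarrow> complex \<Rightarrow> real" where
  "f3 m t = (\<Sum>\<phi>\<in>I. m \<phi> * zagier 3 (value_at \<phi> t))"

lemma f2_cgrad:
  assumes "t \<notin> A"
  shows "has_cgrad (f2 m) (\<i> * (\<Sum>b\<in>A. of_real (\<Sum>\<phi>\<in>I. m \<phi> * (v \<phi> b * M \<phi> t - w \<phi> b * L \<phi> t)) / (t - b))) t"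
proof -
  have "has_cgrad (f2 m) (\<Sum>\<phi>\<in>I. of_real (m \<phi>) * (\<i> * (of_real (M \<phi> t) * dL \<phi> t - of_real (L \<phi> t) * dM \<phi> t))) t"
    unfolding f2_def by (intro has_cgrad_sum has_cgrad_cmult zagier_2_val_cgrad assms)
  also have "(\<Sum>\<phi>\<in>I. of_real (m \<phi>) * (\<i> * (of_real (M \<phi> t) * dL \<phi> t - of_real (L \<phi> t) * dM \<phi> t)))
     = (\<Sum>\<phi>\<in>I. \<Sum>b\<in>A. \<i> * (of_real (m \<phi> * (v \<phi> b * M \<phi> t - w \<phi> b * L \<phi> t)) / (t - b)))"
    unfolding dL_def dM_def sum_distrib_left sum_subtractf[symmetric]
    by (intro sum.cong refl) (simp add: diff_divide_distrib algebra_simps)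
  also have "\<dots> = (\<Sum>b\<in>A. \<Sum>\<phi>\<in>I. \<i> * (of_real (m \<phi> * (v \<phi> b * M \<phi> t - w \<phi> b * L \<phi> t)) / (t - b)))"
    by (rule sum.swap)
  also have "\<dots> = \<i> * (\<Sum>b\<in>A. of_real (\<Sum>\<phi>\<in>I. m \<phi> * (v \<phi> b * M \<phi> t - w \<phi> b * L \<phi> t)) / (t - b))"
    by (simp only: sum_distrib_left sum_divide_distrib of_real_sum)
  finally show ?thesis .
qed

text \<open>The weights \<open>p\<close> and \<open>q\<close> are the orders of \<open>\<phi>\<close> and \<open>1 - \<phi>\<close> at a point in the case of the dilogarithm, and
  quadratic expressions in such orders in the case of the trilogarithm.\<close>

lemma pairing_expand:
  assumes "t \<notin> A"
  shows "(\<Sum>\<phi>\<in>I. m \<phi> * (p \<phi> * M \<phi> t - q \<phi> * L \<phi> t)) =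
     (\<Sum>a\<in>A. (\<Sum>\<phi>\<in>I. m \<phi> * (p \<phi> * w \<phi> a - q \<phi> * v \<phi> a)) * ln (cmod (t - a)))
     + (\<Sum>\<phi>\<in>I. m \<phi> * (p \<phi> * ln_lead_at (1 - \<phi>) - q \<phi> * ln_lead_at \<phi>))"
proof -
  have "(\<Sum>\<phi>\<in>I. m \<phi> * (p \<phi> * M \<phi> t - q \<phi> * L \<phi> t)) =
     (\<Sum>\<phi>\<in>I. (\<Sum>a\<in>A. m \<phi> * (p \<phi> * w \<phi> a - q \<phi> * v \<phi> a) * ln (cmod (t - a)))
       + m \<phi> * (p \<phi> * ln_lead_at (1 - \<phi>) - q \<phi> * ln_lead_at \<phi>))"
  proof (rule sum.cong[OF refl])
    fix \<phi> assume \<phi>: "\<phi> \<in> I"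
    have "(\<Sum>a\<in>A. m \<phi> * (p \<phi> * w \<phi> a - q \<phi> * v \<phi> a) * ln (cmod (t - a))) =
       m \<phi> * (p \<phi> * (\<Sum>a\<in>A. w \<phi> a * ln (cmod (t - a))) - q \<phi> * (\<Sum>a\<in>A. v \<phi> a * ln (cmod (t - a))))"
      unfolding sum_distrib_left sum_subtractf[symmetric] by (intro sum.cong refl) (simp add: algebra_simps)
    then show "m \<phi> * (p \<phi> * M \<phi> t - q \<phi> * L \<phi> t) = (\<Sum>a\<in>A. m \<phi> * (p \<phi> * w \<phi> a - q \<phi> * v \<phi> a) * ln (cmod (t - a)))
       + m \<phi> * (p \<phi> * ln_lead_at (1 - \<phi>) - q \<phi> * ln_lead_at \<phi>)"
      unfolding L_eq[OF \<phi> assms] M_eq[OF \<phi> assms] by (simp add: algebra_simps)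
  qed
  also have "\<dots> = (\<Sum>\<phi>\<in>I. \<Sum>a\<in>A. m \<phi> * (p \<phi> * w \<phi> a - q \<phi> * v \<phi> a) * ln (cmod (t - a)))
     + (\<Sum>\<phi>\<in>I. m \<phi> * (p \<phi> * ln_lead_at (1 - \<phi>) - q \<phi> * ln_lead_at \<phi>))" by (rule sum.distrib)
  also have "(\<Sum>\<phi>\<in>I. \<Sum>a\<in>A. m \<phi> * (p \<phi> * w \<phi> a - q \<phi> * v \<phi> a) * ln (cmod (t - a))) =
      (\<Sum>a\<in>A. (\<Sum>\<phi>\<in>I. m \<phi> * (p \<phi> * w \<phi> a - q \<phi> * v \<phi> a)) * ln (cmod (t - a)))"
    unfolding sum_distrib_right by (rule sum.swap)
  finally show ?thesis .
qed

text \<open>The coefficient of \<open>[b] \<and> [a]\<close> in the sum of the \<open>m \<phi> \<cdot> (\<phi>) \<and> (1 - \<phi>)\<close>.\<close>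

definition wedge :: "(ratfun \<Rightarrow> real) \<Rightarrow> complex \<Rightarrow> complex \<Rightarrow> real" where
  "wedge m b a = (\<Sum>\<phi>\<in>I. m \<phi> * (v \<phi> b * w \<phi> a - w \<phi> b * v \<phi> a))"

text \<open>In the gradient of \<open>f2 m\<close> the function \<open>ln |t - a| / (t - b)\<close> has the coefficient \<open>\<i> wedge m b a\<close>, and the
  functions of this form are linearly independent.\<close>

lemma f2_const_imp_wedge_0:
  assumes const: "\<And>t. t \<notin> A \<Longrightarrow> f2 m t = c" and ab: "a \<in> A" "b \<in> A"
  shows "wedge m b a = 0"
proof -
  define C where "C b = (\<Sum>\<phi>\<in>I. m \<phi> * (v \<phi> b * ln_lead_at (1 - \<phi>) - w \<phi> b * ln_lead_at \<phi>))" for b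
  \<comment> \<open>The gradient has no antiholomorphic poles. Dividing it by the conjugate of \<open>t - b\<close> for the one point
      \<open>b\<close> gives a relation of the required form, with coefficients \<open>0\<close> for all \<open>c\<close> other than \<open>b\<close>.\<close>
  have "(if b = b then complex_of_real (wedge m b a) else 0) = 0"
  proof (rule log_pole_independent[OF finite_A _ ab(1,2,2),
      where T = "\<lambda>a b' c. if c = b then of_real (wedge m b' a) else 0" and k = "\<lambda>b' c. if c = b then of_real (C b') else 0"])
    fix t assume t: "t \<notin> A"
    define hs where "hs b = (\<Sum>\<phi>\<in>I. m \<phi> * (v \<phi> b * M \<phi> t - w \<phi> b * L \<phi> t))" for b
    have "\<i> * (\<Sum>b\<in>A. of_real (hs b) / (t - b)) = 0"
      unfolding hs_def by (rule const_imp_cgrad_0[OF const f2_cgrad[OF t] t])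
    then have 0: "(\<Sum>b\<in>A. of_real (hs b) / (t - b)) = 0" by simp
    have h: "complex_of_real (hs b') = (\<Sum>a\<in>A. of_real (wedge m b' a) * of_real (ln (cmod (t - a)))) + of_real (C b')" for b'
      unfolding hs_def pairing_expand[OF t] wedge_def C_def by simp
    have "(\<Sum>b'\<in>A. \<Sum>c\<in>A. ((\<Sum>a\<in>A. (if c = b then of_real (wedge m b' a) else 0) * of_real (ln (cmod (t - a)))) +
        (if c = b then of_real (C b') else 0)) / ((t - b') * cnj (t - c)))
      = (\<Sum>b'\<in>A. \<Sum>c\<in>A. if c = b then of_real (hs b') / (t - b') / cnj (t - b) else 0)"
      by (intro sum.cong refl) (simp add: h)
    also have "\<dots> = (\<Sum>b'\<in>A. of_real (hs b') / (t - b') / cnj (t - b))"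
      using finite_A ab(2) by simp
    also have "\<dots> = (\<Sum>b'\<in>A. of_real (hs b') / (t - b')) / cnj (t - b)" by (rule sum_divide_distrib[symmetric])
    finally show "(\<Sum>b'\<in>A. \<Sum>c\<in>A. ((\<Sum>a\<in>A. (if c = b then of_real (wedge m b' a) else 0) * of_real (ln (cmod (t - a)))) +
        (if c = b then of_real (C b') else 0)) / ((t - b') * cnj (t - c))) = 0"
      unfolding 0 by simp
  qed
  then show ?thesis by simp
qed

text \<open>If all coefficients \<open>wedge m b a\<close> vanish, the gradient has constants as numerators over the \<open>t - b\<close>. By
  the tame symbol relation these constants are combinations of the same coefficients.\<close>

lemma wedge_0_imp_f2_const:
  assumes "\<And>a b. a \<in> A \<Longrightarrow> b \<in> A \<Longrightarrow> wedge m b a = 0"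
  shows "\<exists>c. \<forall>t. t \<notin> A \<longrightarrow> f2 m t = c"
proof (rule cgrad_0_imp_const)
  fix t assume t: "t \<notin> A"
  have "(\<Sum>\<phi>\<in>I. m \<phi> * (v \<phi> b * M \<phi> t - w \<phi> b * L \<phi> t)) = 0" if b: "b \<in> A" for b
  proof -
    have "(\<Sum>\<phi>\<in>I. m \<phi> * (v \<phi> b * ln_lead_at (1 - \<phi>) - w \<phi> b * ln_lead_at \<phi>)) =
       - (\<Sum>\<phi>\<in>I. \<Sum>a\<in>A - {b}. m \<phi> * (v \<phi> b * w \<phi> a - w \<phi> b * v \<phi> a) * ln (cmod (b - a)))"
      unfolding sum_negf[symmetric] by (intro sum.cong refl) (simp add: tame sum_distrib_left sum_negf mult.assoc)
    also have "(\<Sum>\<phi>\<in>I. \<Sum>a\<in>A - {b}. m \<phi> * (v \<phi> b * w \<phi> a - w \<phi> b * v \<phi> a) * ln (cmod (b - a)))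
        = (\<Sum>a\<in>A - {b}. wedge m b a * ln (cmod (b - a)))"
      unfolding wedge_def sum_distrib_right by (rule sum.swap)
    also have "\<dots> = 0" using assms b by simp
    finally show ?thesis
      unfolding pairing_expand[OF t] using assms[OF _ b] by (simp add: wedge_def)
  qed
  then show "has_cgrad (f2 m) 0 t" using f2_cgrad[OF t, of m] by simp
qed

lemma eventually_notin_A: "eventually (\<lambda>t. t \<notin> A) (at b)"
proof -
  have "open (- (A - {b}))" by (intro open_Compl finite_imp_closed finite_Diff finite_A)
  then have "eventually (\<lambda>t. t \<in> - (A - {b})) (nhds b)" by (intro eventually_nhds_in_open) auto
  then show ?thesis by (auto simp: eventually_at_filter elim: eventually_mono)
qed

text \<open>A pole of \<open>\<phi>\<close> is reduced to a zero by the inversion relation.\<close>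

lemma zagier_2_val_tendsto_0:
  assumes "\<phi> \<in> I" "v \<phi> b \<noteq> 0"
  shows "((\<lambda>t. zagier 2 (value_at \<phi> t)) \<longlongrightarrow> 0) (at b)"
proof -
  have r: "eventually (\<lambda>t. value_at \<phi> t \<noteq> 0 \<and> value_at \<phi> t \<noteq> 1) (at b)"
    using eventually_notin_A by eventually_elim (use regular assms in auto)
  consider "v \<phi> b > 0" | "v \<phi> b < 0" using assms(2) by linarith
  then show ?thesis
  proof cases
    case 1
    have "filterlim (value_at \<phi>) (at 0) (at b)"
      using ord_at_pos_imp_tendsto_0[OF _ 1] nz[OF assms(1)] r
      by (auto simp: filterlim_at elim: eventually_mono)
    then show ?thesis by (rule filterlim_compose[OF zagier_2_tendsto_0])
  next
    case 2
    have "filterlim (\<lambda>t. 1 / value_at \<phi> t) (at 0) (at b)"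
      using ord_at_neg_imp_inverse_tendsto_0[OF _ 2] nz[OF assms(1)] r
      by (auto simp: filterlim_at elim: eventually_mono)
    then have "((\<lambda>t. - zagier 2 (1 / value_at \<phi> t)) \<longlongrightarrow> - 0) (at b)"
      by (intro tendsto_minus filterlim_compose[OF zagier_2_tendsto_0])
    moreover have "eventually (\<lambda>t. - zagier 2 (1 / value_at \<phi> t) = zagier 2 (value_at \<phi> t)) (at b)"
      using r by eventually_elim (simp add: zagier_2_inverse)
    ultimately show ?thesis by (auto dest: Lim_transform_eventually)
  qed
qed

text \<open>The coefficient of \<open>[a] \<otimes> [b] \<otimes> [c]\<close> in the sum of the \<open>m \<phi> \<cdot> (\<phi>) \<otimes> (\<phi>) \<otimes> (1 - \<phi>)\<close>.\<close>

definition trip :: "(ratfun \<Rightarrow> real) \<Rightarrow> complex \<Rightarrow> complex \<Rightarrow> complex \<Rightarrow> real" where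
  "trip m a b c = (\<Sum>\<phi>\<in>I. m \<phi> * (v \<phi> a * (v \<phi> b * w \<phi> c)))"

lemma wedge_trip: "wedge (\<lambda>\<phi>. m \<phi> * v \<phi> c) b a = trip m c b a - trip m c a b"
  unfolding wedge_def trip_def sum_subtractf[symmetric] by (intro sum.cong refl) (simp add: algebra_simps)

text \<open>The residue at \<open>b\<close> consists of the dilogarithms of the same functions, with weights multiplied by the
  orders at \<open>b\<close>, and of a quadratic expression in logarithms.\<close>

lemma f3_cgrad:
  assumes "t \<notin> A"
  shows "has_cgrad (f3 m) (\<Sum>b\<in>A. (\<i> * of_real (f2 (\<lambda>\<phi>. m \<phi> * v \<phi> b) t) +
      of_real (\<Sum>\<phi>\<in>I. m \<phi> * L \<phi> t * (v \<phi> b * M \<phi> t - w \<phi> b * L \<phi> t) / 3)) / (t - b)) t"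
proof -
  have "has_cgrad (f3 m) (\<Sum>\<phi>\<in>I. of_real (m \<phi>) *
     ((\<i> * of_real (zagier 2 (value_at \<phi> t)) + of_real (L \<phi> t * M \<phi> t / 3)) * dL \<phi> t - of_real ((L \<phi> t)\<^sup>2 / 3) * dM \<phi> t)) t"
    unfolding f3_def by (intro has_cgrad_sum has_cgrad_cmult zagier_3_val_cgrad assms)
  also have "(\<Sum>\<phi>\<in>I. of_real (m \<phi>) *
     ((\<i> * of_real (zagier 2 (value_at \<phi> t)) + of_real (L \<phi> t * M \<phi> t / 3)) * dL \<phi> t - of_real ((L \<phi> t)\<^sup>2 / 3) * dM \<phi> t))
    = (\<Sum>\<phi>\<in>I. \<Sum>b\<in>A. (\<i> * of_real (m \<phi> * v \<phi> b * zagier 2 (value_at \<phi> t)) +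
      of_real (m \<phi> * L \<phi> t * (v \<phi> b * M \<phi> t - w \<phi> b * L \<phi> t) / 3)) / (t - b))"
    unfolding dL_def dM_def sum_distrib_left sum_subtractf[symmetric]
    by (intro sum.cong refl) (simp add: add_divide_distrib diff_divide_distrib algebra_simps power2_eq_square)
  also have "\<dots> = (\<Sum>b\<in>A. \<Sum>\<phi>\<in>I. (\<i> * of_real (m \<phi> * v \<phi> b * zagier 2 (value_at \<phi> t)) +
      of_real (m \<phi> * L \<phi> t * (v \<phi> b * M \<phi> t - w \<phi> b * L \<phi> t) / 3)) / (t - b))"
    by (rule sum.swap)
  also have "\<dots> = (\<Sum>b\<in>A. (\<i> * of_real (f2 (\<lambda>\<phi>. m \<phi> * v \<phi> b) t) +
      of_real (\<Sum>\<phi>\<in>I. m \<phi> * L \<phi> t * (v \<phi> b * M \<phi> t - w \<phi> b * L \<phi> t) / 3)) / (t - b))"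
  proof (rule sum.cong[OF refl])
    fix b
    show "(\<Sum>\<phi>\<in>I. (\<i> * of_real (m \<phi> * v \<phi> b * zagier 2 (value_at \<phi> t)) +
        of_real (m \<phi> * L \<phi> t * (v \<phi> b * M \<phi> t - w \<phi> b * L \<phi> t) / 3)) / (t - b)) =
      (\<i> * of_real (f2 (\<lambda>\<phi>. m \<phi> * v \<phi> b) t) +
        of_real (\<Sum>\<phi>\<in>I. m \<phi> * L \<phi> t * (v \<phi> b * M \<phi> t - w \<phi> b * L \<phi> t) / 3)) / (t - b)"
      by (subst sum_divide_distrib[symmetric]) (simp only: f2_def sum.distrib sum_distrib_left of_real_sum)
  qed
  finally show ?thesis .
qed

text \<open>Both parts of the residue at \<open>b\<close> vanish. By \<open>wedge_trip\<close> the symmetry makes the sum of dilogarithms with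
  weights \<open>m \<phi> v \<phi> b\<close> constant. Only functions with a zero or a pole at \<open>b\<close> occur in it, so it tends to \<open>0\<close> at
  \<open>b\<close>, and the constant is \<open>0\<close>. The quadratic part is expanded in the functions \<open>ln |t - a|\<close>; what the
  symmetry does not cancel directly is a sum over leading coefficients, which the tame symbol relation
  makes symmetric.\<close>

lemma trip_symmetric_imp_f3_const:
  assumes sym: "\<And>a b c. a \<in> A \<Longrightarrow> b \<in> A \<Longrightarrow> c \<in> A \<Longrightarrow> trip m a b c = trip m a c b"
  shows "\<exists>c. \<forall>t. t \<notin> A \<longrightarrow> f3 m t = c"
proof (rule cgrad_0_imp_const)
  fix t assume t: "t \<notin> A"
  have P: "f2 (\<lambda>\<phi>. m \<phi> * v \<phi> b) t = 0" if b: "b \<in> A" for b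
  proof -
    obtain c where c: "\<And>s. s \<notin> A \<Longrightarrow> f2 (\<lambda>\<phi>. m \<phi> * v \<phi> b) s = c"
      using wedge_0_imp_f2_const[of "\<lambda>\<phi>. m \<phi> * v \<phi> b"] sym b by (auto simp: wedge_trip)
    have "((\<lambda>s. m \<phi> * v \<phi> b * zagier 2 (value_at \<phi> s)) \<longlongrightarrow> 0) (at b)" if "\<phi> \<in> I" for \<phi>
      using zagier_2_val_tendsto_0[OF that, of b] by (cases "v \<phi> b = 0") (auto intro: tendsto_mult_right_zero)
    then have "(f2 (\<lambda>\<phi>. m \<phi> * v \<phi> b) \<longlongrightarrow> (\<Sum>\<phi>\<in>I. 0)) (at b)"
      unfolding f2_def[abs_def] by (intro tendsto_sum)
    then have "(f2 (\<lambda>\<phi>. m \<phi> * v \<phi> b) \<longlongrightarrow> 0) (at b)" by simp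
    moreover have "eventually (\<lambda>s. f2 (\<lambda>\<phi>. m \<phi> * v \<phi> b) s = c) (at b)"
      using eventually_notin_A by eventually_elim (rule c)
    ultimately have "((\<lambda>s. c) \<longlongrightarrow> 0) (at b)" by (rule Lim_transform_eventually)
    then have "c = 0" by (rule LIM_const_eq)
    then show ?thesis using c[OF t] by simp
  qed
  \<comment> \<open>The sum over leading coefficients; the tame symbol at \<open>c\<close> rewrites it into a form symmetric in \<open>b\<close> and \<open>c\<close>.\<close>
  define S where "S b c = (\<Sum>\<phi>\<in>I. m \<phi> * ln_lead_at \<phi> * (v \<phi> b * w \<phi> c))" for b c
  have S: "S b c = (\<Sum>\<phi>\<in>I. m \<phi> * (v \<phi> b * v \<phi> c) * ln_lead_at (1 - \<phi>))" if bc: "b \<in> A" "c \<in> A" for b c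
  proof -
    have "S b c = (\<Sum>\<phi>\<in>I. m \<phi> * (v \<phi> b * v \<phi> c) * ln_lead_at (1 - \<phi>)
        + (\<Sum>a\<in>A - {c}. (m \<phi> * (v \<phi> b * (v \<phi> c * w \<phi> a)) - m \<phi> * (v \<phi> b * (v \<phi> a * w \<phi> c))) * ln (cmod (c - a))))"
      unfolding S_def
    proof (rule sum.cong[OF refl])
      fix \<phi> assume \<phi>: "\<phi> \<in> I"
      have "(\<Sum>a\<in>A - {c}. (m \<phi> * (v \<phi> b * (v \<phi> c * w \<phi> a)) - m \<phi> * (v \<phi> b * (v \<phi> a * w \<phi> c))) * ln (cmod (c - a)))
        = m \<phi> * v \<phi> b * (\<Sum>a\<in>A - {c}. (v \<phi> c * w \<phi> a - w \<phi> c * v \<phi> a) * ln (cmod (c - a)))"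
        unfolding sum_distrib_left by (intro sum.cong refl) (simp add: algebra_simps)
      also have "\<dots> = m \<phi> * v \<phi> b * (w \<phi> c * ln_lead_at \<phi> - v \<phi> c * ln_lead_at (1 - \<phi>))"
        using tame[OF \<phi>, of c] by simp
      finally show "m \<phi> * ln_lead_at \<phi> * (v \<phi> b * w \<phi> c) = m \<phi> * (v \<phi> b * v \<phi> c) * ln_lead_at (1 - \<phi>)
        + (\<Sum>a\<in>A - {c}. (m \<phi> * (v \<phi> b * (v \<phi> c * w \<phi> a)) - m \<phi> * (v \<phi> b * (v \<phi> a * w \<phi> c))) * ln (cmod (c - a)))"
        by (simp add: algebra_simps)
    qed
    also have "\<dots> = (\<Sum>\<phi>\<in>I. m \<phi> * (v \<phi> b * v \<phi> c) * ln_lead_at (1 - \<phi>))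
        + (\<Sum>a\<in>A - {c}. (trip m b c a - trip m b a c) * ln (cmod (c - a)))"
      unfolding sum.distrib trip_def sum_subtractf[symmetric] sum_distrib_right by (subst sum.swap) simp
    also have "(\<Sum>a\<in>A - {c}. (trip m b c a - trip m b a c) * ln (cmod (c - a))) = 0"
      using sym bc by (intro sum.neutral) auto
    finally show ?thesis by simp
  qed
  have Ssym: "S b c = S c b" if "b \<in> A" "c \<in> A" for b c
    unfolding S[OF that] S[OF that(2,1)] by (simp add: mult.commute)
  have Q: "(\<Sum>\<phi>\<in>I. m \<phi> * L \<phi> t * (v \<phi> b * M \<phi> t - w \<phi> b * L \<phi> t)) = 0" if b: "b \<in> A" for b
  proof -
    \<comment> \<open>The constants of the expansion are absorbed into differences of logarithms, again by the tame symbol.\<close>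
    have LM: "v \<phi> b * M \<phi> t - w \<phi> b * L \<phi> t =
        (\<Sum>a\<in>A - {b}. (v \<phi> b * w \<phi> a - w \<phi> b * v \<phi> a) * (ln (cmod (t - a)) - ln (cmod (b - a))))" if \<phi>: "\<phi> \<in> I" for \<phi>
    proof -
      have "v \<phi> b * M \<phi> t - w \<phi> b * L \<phi> t = (\<Sum>a\<in>A. (v \<phi> b * w \<phi> a - w \<phi> b * v \<phi> a) * ln (cmod (t - a)))
          + (v \<phi> b * ln_lead_at (1 - \<phi>) - w \<phi> b * ln_lead_at \<phi>)"
        unfolding L_eq[OF \<phi> t] M_eq[OF \<phi> t] by (simp add: algebra_simps sum_subtractf sum_distrib_left)
      also have "(\<Sum>a\<in>A. (v \<phi> b * w \<phi> a - w \<phi> b * v \<phi> a) * ln (cmod (t - a))) =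
          (\<Sum>a\<in>A - {b}. (v \<phi> b * w \<phi> a - w \<phi> b * v \<phi> a) * ln (cmod (t - a)))"
        using finite_A b by (simp add: sum.remove[of A b])
      finally show ?thesis unfolding tame[OF \<phi>] by (simp add: algebra_simps sum_subtractf sum.distrib)
    qed
    have zero: "(\<Sum>\<phi>\<in>I. m \<phi> * L \<phi> t * (v \<phi> b * w \<phi> a - w \<phi> b * v \<phi> a)) = 0" if a: "a \<in> A" for a
    proof -
      have "(\<Sum>\<phi>\<in>I. m \<phi> * L \<phi> t * (v \<phi> b * w \<phi> a - w \<phi> b * v \<phi> a)) =
        (\<Sum>\<phi>\<in>I. (m \<phi> * ln_lead_at \<phi> * (v \<phi> b * w \<phi> a) - m \<phi> * ln_lead_at \<phi> * (v \<phi> a * w \<phi> b))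
          + (\<Sum>c\<in>A. (m \<phi> * (v \<phi> c * (v \<phi> b * w \<phi> a)) - m \<phi> * (v \<phi> c * (v \<phi> a * w \<phi> b))) * ln (cmod (t - c))))"
      proof (rule sum.cong[OF refl])
        fix \<phi> assume \<phi>: "\<phi> \<in> I"
        have "(\<Sum>c\<in>A. (m \<phi> * (v \<phi> c * (v \<phi> b * w \<phi> a)) - m \<phi> * (v \<phi> c * (v \<phi> a * w \<phi> b))) * ln (cmod (t - c)))
          = m \<phi> * (v \<phi> b * w \<phi> a - w \<phi> b * v \<phi> a) * (\<Sum>c\<in>A. v \<phi> c * ln (cmod (t - c)))"
          unfolding sum_distrib_left by (intro sum.cong refl) (simp add: algebra_simps)
        then show "m \<phi> * L \<phi> t * (v \<phi> b * w \<phi> a - w \<phi> b * v \<phi> a) =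
          (m \<phi> * ln_lead_at \<phi> * (v \<phi> b * w \<phi> a) - m \<phi> * ln_lead_at \<phi> * (v \<phi> a * w \<phi> b))
          + (\<Sum>c\<in>A. (m \<phi> * (v \<phi> c * (v \<phi> b * w \<phi> a)) - m \<phi> * (v \<phi> c * (v \<phi> a * w \<phi> b))) * ln (cmod (t - c)))"
          unfolding L_eq[OF \<phi> t] by (simp add: algebra_simps)
      qed
      also have "\<dots> = (S b a - S a b) + (\<Sum>c\<in>A. (trip m c b a - trip m c a b) * ln (cmod (t - c)))"
        unfolding sum.distrib trip_def S_def sum_subtractf[symmetric] sum_distrib_right by (subst sum.swap) simp
      also have "\<dots> = 0" using Ssym[OF a b] sym[OF _ a b] by simp
      finally show ?thesis .
    qed
    have "(\<Sum>\<phi>\<in>I. m \<phi> * L \<phi> t * (v \<phi> b * M \<phi> t - w \<phi> b * L \<phi> t)) =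
      (\<Sum>\<phi>\<in>I. \<Sum>a\<in>A - {b}. m \<phi> * L \<phi> t * (v \<phi> b * w \<phi> a - w \<phi> b * v \<phi> a) * (ln (cmod (t - a)) - ln (cmod (b - a))))"
      by (intro sum.cong refl) (simp add: LM sum_distrib_left mult.assoc)
    also have "\<dots> = (\<Sum>a\<in>A - {b}. (\<Sum>\<phi>\<in>I. m \<phi> * L \<phi> t * (v \<phi> b * w \<phi> a - w \<phi> b * v \<phi> a)) * (ln (cmod (t - a)) - ln (cmod (b - a))))"
      unfolding sum_distrib_right by (rule sum.swap)
    also have "\<dots> = 0" using zero by simp
    finally show ?thesis .
  qed
  have "(\<Sum>b\<in>A. (\<i> * of_real (f2 (\<lambda>\<phi>. m \<phi> * v \<phi> b) t) +
      of_real (\<Sum>\<phi>\<in>I. m \<phi> * L \<phi> t * (v \<phi> b * M \<phi> t - w \<phi> b * L \<phi> t) / 3)) / (t - b)) = 0"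
    using P Q by (intro sum.neutral) (simp add: sum_divide_distrib[symmetric])
  then show "has_cgrad (f3 m) 0 t" using f3_cgrad[OF t, of m] by (simp only:)
qed

text \<open>The gradient still contains dilogarithms. Its derivative with respect to the conjugate of \<open>t\<close> does not: it
  is a combination of the functions \<open>ln |t - a|\<close> divided by \<open>t - b\<close> and by the conjugate of \<open>t - c\<close>. So all
  coefficients \<open>T a b c\<close> of this combination vanish. Since \<open>trip\<close> is symmetric in its first two arguments, it
  has at most three different values on the permutations of \<open>a\<close>, \<open>b\<close>, \<open>c\<close>, and \<open>T a b c = 0\<close> says that each of
  them is the mean of the other two; so they are equal.\<close>

lemma f3_const_imp_trip_symmetric:
  assumes const: "\<And>t. t \<notin> A \<Longrightarrow> f3 m t = k0" and abc: "a \<in> A" "b \<in> A" "c \<in> A"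
  shows "trip m a b c = trip m a c b"
proof -
  define T where "T a b c = (\<Sum>\<phi>\<in>I. m \<phi> * ((2 * v \<phi> b * v \<phi> c) * w \<phi> a - (v \<phi> b * w \<phi> c + w \<phi> b * v \<phi> c) * v \<phi> a))" for a b c
  define k where "k b c = (\<Sum>\<phi>\<in>I. m \<phi> * ((2 * v \<phi> b * v \<phi> c) * ln_lead_at (1 - \<phi>) - (v \<phi> b * w \<phi> c + w \<phi> b * v \<phi> c) * ln_lead_at \<phi>))" for b c
  have "T a b c = 0" if abc: "a \<in> A" "b \<in> A" "c \<in> A" for a b c
  proof -
    have "complex_of_real (T a b c) = 0"
    proof (rule log_pole_independent[OF finite_A _ abc, where T = "\<lambda>a b c. of_real (T a b c)" and k = "\<lambda>b c. of_real (k b c)"])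
      fix t assume t: "t \<notin> A"
      \<comment> \<open>The gradient is the sum of the \<open>G b t / (t - b)\<close>, and \<open>\<phi>\<close> contributes \<open>m \<phi> / 3\<close> times \<open>h b \<phi>\<close>
          to the conjugate derivative of \<open>G b\<close>.\<close>
      define G where "G b t = \<i> * of_real (f2 (\<lambda>\<phi>. m \<phi> * v \<phi> b) t) +
        of_real (\<Sum>\<phi>\<in>I. (m \<phi> / 3) * (L \<phi> t * (v \<phi> b * M \<phi> t - w \<phi> b * L \<phi> t)))" for b t
      define h where "h b \<phi> = (2 * v \<phi> b * of_real (M \<phi> t) * cnj (dL \<phi> t) - v \<phi> b * of_real (L \<phi> t) * cnj (dM \<phi> t)
          - w \<phi> b * of_real (L \<phi> t) * cnj (dL \<phi> t))" for b \<phi>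
      have Gd: "has_dbar (G b) (\<Sum>\<phi>\<in>I. of_real (m \<phi> / 3) * h b \<phi>) t" for b
      proof -
        have "has_dbar (G b) (\<i> * (cnj (\<Sum>\<phi>\<in>I. of_real (m \<phi> * v \<phi> b) * (\<i> * (of_real (M \<phi> t) * dL \<phi> t - of_real (L \<phi> t) * dM \<phi> t))) / 2)
          + cnj (\<Sum>\<phi>\<in>I. of_real (m \<phi> / 3) * (of_real (L \<phi> t) * (of_real (v \<phi> b) * dM \<phi> t - of_real (w \<phi> b) * dL \<phi> t)
              + of_real (v \<phi> b * M \<phi> t - w \<phi> b * L \<phi> t) * dL \<phi> t)) / 2) t"
          unfolding G_def f2_def
          by (intro has_dbar_add has_dbar_cmult has_dbar_of_real has_cgrad_sum has_cgrad_cmult has_cgrad_mult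
              has_cgrad_diff zagier_2_val_cgrad L_cgrad M_cgrad t)
        also have "\<i> * (cnj (\<Sum>\<phi>\<in>I. of_real (m \<phi> * v \<phi> b) * (\<i> * (of_real (M \<phi> t) * dL \<phi> t - of_real (L \<phi> t) * dM \<phi> t))) / 2)
          + cnj (\<Sum>\<phi>\<in>I. of_real (m \<phi> / 3) * (of_real (L \<phi> t) * (of_real (v \<phi> b) * dM \<phi> t - of_real (w \<phi> b) * dL \<phi> t)
              + of_real (v \<phi> b * M \<phi> t - w \<phi> b * L \<phi> t) * dL \<phi> t)) / 2
          = (\<Sum>\<phi>\<in>I. of_real (m \<phi> / 3) * h b \<phi>)"
          unfolding cnj_sum sum_divide_distrib sum_distrib_left sum.distrib[symmetric]
          by (intro sum.cong refl) (simp add: h_def field_simps)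
        finally show ?thesis .
      qed
      have inv: "((\<lambda>t. 1 / (t - b)) has_field_derivative - (1 / (t - b)\<^sup>2)) (at t)" if "b \<in> A" for b
        using that t by (auto intro!: derivative_eq_intros simp: power2_eq_square)
      have dbar: "has_dbar (\<lambda>t. \<Sum>b\<in>A. 1 / (t - b) * G b t) (\<Sum>b\<in>A. 1 / (t - b) * (\<Sum>\<phi>\<in>I. of_real (m \<phi> / 3) * h b \<phi>)) t"
        by (intro has_dbar_sum finite_A has_dbar_mult_holomorphic[OF Gd inv])
      have vanish: "(\<Sum>b\<in>A. 1 / (s - b) * G b s) = 0" if s: "s \<in> - A" for s
      proof -
        have s': "s \<notin> A" using s by simp
        have "(\<Sum>b\<in>A. (\<i> * of_real (f2 (\<lambda>\<phi>. m \<phi> * v \<phi> b) s) +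
          of_real (\<Sum>\<phi>\<in>I. m \<phi> * L \<phi> s * (v \<phi> b * M \<phi> s - w \<phi> b * L \<phi> s) / 3)) / (s - b)) = 0"
          by (rule const_imp_cgrad_0[OF const f3_cgrad[OF s'] s'])
        then show ?thesis by (simp add: G_def mult.assoc)
      qed
      have 0: "(\<Sum>b\<in>A. 1 / (t - b) * (\<Sum>\<phi>\<in>I. of_real (m \<phi> / 3) * h b \<phi>)) = 0"
        by (rule has_dbar_locally_0[OF dbar open_A _ vanish]) (use t in auto)
      define Y where "Y b = (\<Sum>c\<in>A. ((\<Sum>a\<in>A. of_real (T a b c) * of_real (ln (cmod (t - a)))) + of_real (k b c)) / cnj (t - c))" for b
      have hexp: "(\<Sum>\<phi>\<in>I. of_real (m \<phi> / 3) * h b \<phi>) = Y b / 3" for b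
      proof -
        have "(\<Sum>\<phi>\<in>I. of_real (m \<phi> / 3) * h b \<phi>) = (\<Sum>\<phi>\<in>I. \<Sum>c\<in>A.
            of_real (m \<phi> * ((2 * v \<phi> b * v \<phi> c) * M \<phi> t - (v \<phi> b * w \<phi> c + w \<phi> b * v \<phi> c) * L \<phi> t)) / cnj (t - c) / 3)"
          unfolding h_def dL_def dM_def cnj_sum sum_distrib_left sum_subtractf[symmetric]
          by (intro sum.cong refl) (simp add: diff_divide_distrib add_divide_distrib algebra_simps)
        also have "\<dots> = (\<Sum>c\<in>A. \<Sum>\<phi>\<in>I.
            of_real (m \<phi> * ((2 * v \<phi> b * v \<phi> c) * M \<phi> t - (v \<phi> b * w \<phi> c + w \<phi> b * v \<phi> c) * L \<phi> t)) / cnj (t - c) / 3)"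
          by (rule sum.swap)
        also have "\<dots> = (\<Sum>c\<in>A.
            of_real (\<Sum>\<phi>\<in>I. m \<phi> * ((2 * v \<phi> b * v \<phi> c) * M \<phi> t - (v \<phi> b * w \<phi> c + w \<phi> b * v \<phi> c) * L \<phi> t)) / cnj (t - c)) / 3"
          by (simp only: sum_divide_distrib of_real_sum)
        finally show ?thesis unfolding pairing_expand[OF t] T_def k_def Y_def by simp
      qed
      have "(\<Sum>b\<in>A. \<Sum>c\<in>A. ((\<Sum>a\<in>A. of_real (T a b c) * of_real (ln (cmod (t - a)))) + of_real (k b c)) / ((t - b) * cnj (t - c)))
        = (\<Sum>b\<in>A. Y b / (t - b))"
        unfolding Y_def sum_divide_distrib by (intro sum.cong refl) (simp add: mult.commute)
      also have "\<dots> = 3 * (\<Sum>b\<in>A. 1 / (t - b) * (\<Sum>\<phi>\<in>I. of_real (m \<phi> / 3) * h b \<phi>))"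
      proof -
        have "y / x = 3 * (1 / x * (y / 3))" for x y :: complex by simp
        then show ?thesis unfolding hexp sum_distrib_left by (intro sum.cong refl)
      qed
      finally show "(\<Sum>b\<in>A. \<Sum>c\<in>A. ((\<Sum>a\<in>A. of_real (T a b c) * of_real (ln (cmod (t - a)))) + of_real (k b c)) / ((t - b) * cnj (t - c))) = 0"
        unfolding 0 by simp
    qed
    then show ?thesis by simp
  qed
  moreover have "T a b c = 2 * trip m b c a - trip m b a c - trip m c a b" for a b c
    unfolding T_def trip_def sum_distrib_left sum_subtractf[symmetric]
    by (intro sum.cong refl) (simp add: algebra_simps)
  moreover have "trip m a b c = trip m b a c" for a b c
    unfolding trip_def by (simp add: mult.left_commute)
  ultimately show ?thesis
    using abc by (smt (verit))
qed

end

section \<open>Linear algebra over the rationals\<close>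

lemma rat_ring_simps [simp]:
  "carrier rat_ring = UNIV" "mult rat_ring = (*)" "one rat_ring = 1" "zero rat_ring = 0" "add rat_ring = (+)"
  by (simp_all add: rat_ring_def)

lemma cring_rat_ring: "cring rat_ring"
proof (rule cringI)
  show "abelian_group rat_ring"
    by (rule abelian_groupI) (auto intro: exI[of _ "- x" for x] simp: algebra_simps)
  show "comm_monoid rat_ring"
    by (rule comm_monoidI) auto
qed (auto simp: algebra_simps)

lemma keys_subset_iff: "Poly_Mapping.keys f \<subseteq> S \<longleftrightarrow> (\<forall>s. s \<notin> S \<longrightarrow> Poly_Mapping.lookup f s = 0)"
  by (auto simp: in_keys_iff)

lemma lookup_scale [simp]: "Poly_Mapping.lookup (Poly_Mapping.map ((*) q) f) s = (q :: rat) * Poly_Mapping.lookup f s"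
  by transfer (auto simp: when_def)

lemma free_space_simps [simp]:
  "carrier (free_space S) = {f. Poly_Mapping.keys f \<subseteq> S}" "zero (free_space S) = 0" "add (free_space S) = (+)"
  "smult (free_space S) q = Poly_Mapping.map ((*) q)"
  by (simp_all add: free_space_def)

lemma module_free_space: "module rat_ring (free_space S)"
proof (rule moduleI[OF cring_rat_ring])
  show "abelian_group (free_space S)"
  proof (rule abelian_groupI)
    fix x assume "x \<in> carrier (free_space S)"
    then show "\<exists>y\<in>carrier (free_space S). y \<oplus>\<^bsub>free_space S\<^esub> x = \<zero>\<^bsub>free_space S\<^esub>"
      by (intro bexI[of _ "- x"]) (auto simp: keys_subset_iff)
  qed (auto simp: keys_subset_iff lookup_add algebra_simps)
qed (auto simp: keys_subset_iff lookup_add algebra_simps intro!: poly_mapping_eqI)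

text \<open>The rationals as a vector space over themselves, the target of linear functionals.\<close>

definition rat_space :: "(rat, rat) module" where
  "rat_space = \<lparr>carrier = UNIV, mult = undefined, one = undefined, zero = 0, add = (+), smult = (*)\<rparr>"

lemma rat_space_simps [simp]:
  "carrier rat_space = UNIV" "zero rat_space = 0" "add rat_space = (+)" "smult rat_space = (*)"
  by (simp_all add: rat_space_def)

lemma module_rat_space: "module rat_ring rat_space"
proof (rule moduleI[OF cring_rat_ring])
  show "abelian_group rat_space"
    by (rule abelian_groupI) (auto intro: exI[of _ "- x" for x] simp: algebra_simps)
qed (auto simp: algebra_simps)

lemma submoduleI_rat:
  assumes "module rat_ring M" "H \<subseteq> carrier M" "\<zero>\<^bsub>M\<^esub> \<in> H"
    and "\<And>x y. x \<in> H \<Longrightarrow> y \<in> H \<Longrightarrow> x \<oplus>\<^bsub>M\<^esub> y \<in> H" "\<And>q x. x \<in> H \<Longrightarrow> q \<odot>\<^bsub>M\<^esub> x \<in> H"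
  shows "submodule H rat_ring M"
proof -
  interpret M: module rat_ring M by fact
  show ?thesis
  proof (rule M.submoduleI)
    fix a assume a: "a \<in> H"
    have "(\<ominus>\<^bsub>rat_ring\<^esub> \<one>\<^bsub>rat_ring\<^esub>) \<odot>\<^bsub>M\<^esub> a = \<ominus>\<^bsub>M\<^esub> (\<one>\<^bsub>rat_ring\<^esub> \<odot>\<^bsub>M\<^esub> a)"
      using a assms(2) by (intro M.smult_l_minus) auto
    also have "\<one>\<^bsub>rat_ring\<^esub> \<odot>\<^bsub>M\<^esub> a = a" using a assms(2) by (intro M.smult_one) auto
    finally show "\<ominus>\<^bsub>M\<^esub> a \<in> H" using assms(5)[OF a] by metis
  qed (use assms in auto)
qed

lemma submoduleD:
  assumes "module rat_ring M" "submodule H rat_ring M"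
  shows "H \<subseteq> carrier M" "\<zero>\<^bsub>M\<^esub> \<in> H"
    and "\<And>x y. x \<in> H \<Longrightarrow> y \<in> H \<Longrightarrow> x \<oplus>\<^bsub>M\<^esub> y \<in> H" "\<And>q x. x \<in> H \<Longrightarrow> q \<odot>\<^bsub>M\<^esub> x \<in> H"
proof -
  interpret submodule H rat_ring M by fact
  show "H \<subseteq> carrier M" "\<zero>\<^bsub>M\<^esub> \<in> H" using subset one_closed by auto
  show "\<And>x y. x \<in> H \<Longrightarrow> y \<in> H \<Longrightarrow> x \<oplus>\<^bsub>M\<^esub> y \<in> H" using m_closed by auto
  show "\<And>q x. x \<in> H \<Longrightarrow> q \<odot>\<^bsub>M\<^esub> x \<in> H" by (rule smult_closed) auto
qed

lemma submodule_lin_span: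
  assumes M: "module rat_ring M" and X: "X \<subseteq> carrier M"
  shows "submodule (lin_span M X) rat_ring M"
proof -
  have "submodule (carrier M) rat_ring M" using M by (rule module.carrier_is_submodule)
  then have "lin_span M X \<subseteq> carrier M" using X unfolding lin_span_def by blast
  then show ?thesis
    by (intro submoduleI_rat[OF M]) (auto simp: lin_span_def dest: submoduleD[OF M])
qed

lemma lin_span_superset: "X \<subseteq> lin_span M X"
  by (auto simp: lin_span_def)

lemma lin_span_least: "submodule N rat_ring M \<Longrightarrow> X \<subseteq> N \<Longrightarrow> lin_span M X \<subseteq> N"
  by (auto simp: lin_span_def)

definition lin_map :: "(rat, 'v) module \<Rightarrow> (rat, 'w) module \<Rightarrow> ('v \<Rightarrow> 'w) \<Rightarrow> bool" where
  "lin_map M N f \<longleftrightarrow> (\<forall>x\<in>carrier M. f x \<in> carrier N) \<and>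
     (\<forall>x\<in>carrier M. \<forall>y\<in>carrier M. f (x \<oplus>\<^bsub>M\<^esub> y) = f x \<oplus>\<^bsub>N\<^esub> f y) \<and>
     (\<forall>q. \<forall>x\<in>carrier M. f (q \<odot>\<^bsub>M\<^esub> x) = q \<odot>\<^bsub>N\<^esub> f x)"

lemma lin_mapI:
  assumes "\<And>x. x \<in> carrier M \<Longrightarrow> f x \<in> carrier N"
    and "\<And>x y. x \<in> carrier M \<Longrightarrow> y \<in> carrier M \<Longrightarrow> f (x \<oplus>\<^bsub>M\<^esub> y) = f x \<oplus>\<^bsub>N\<^esub> f y"
    and "\<And>q x. x \<in> carrier M \<Longrightarrow> f (q \<odot>\<^bsub>M\<^esub> x) = q \<odot>\<^bsub>N\<^esub> f x"
  shows "lin_map M N f"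
  using assms by (simp add: lin_map_def)

lemma lin_mapD:
  assumes "lin_map M N f" "x \<in> carrier M"
  shows "f x \<in> carrier N" "y \<in> carrier M \<Longrightarrow> f (x \<oplus>\<^bsub>M\<^esub> y) = f x \<oplus>\<^bsub>N\<^esub> f y" "f (q \<odot>\<^bsub>M\<^esub> x) = q \<odot>\<^bsub>N\<^esub> f x"
  using assms by (simp_all add: lin_map_def)

lemma smult_0: "module rat_ring M \<Longrightarrow> x \<in> carrier M \<Longrightarrow> 0 \<odot>\<^bsub>M\<^esub> x = \<zero>\<^bsub>M\<^esub>"
  using module.smult_l_null[of rat_ring M x] by simp

lemma module_zero_closed: "module rat_ring M \<Longrightarrow> \<zero>\<^bsub>M\<^esub> \<in> carrier M"
  by (simp add: module_def abelian_group_def abelian_monoid.zero_closed)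

lemma lin_map_zero:
  assumes "module rat_ring M" "module rat_ring N" "lin_map M N f"
  shows "f \<zero>\<^bsub>M\<^esub> = \<zero>\<^bsub>N\<^esub>"
proof -
  have z: "\<zero>\<^bsub>M\<^esub> \<in> carrier M" using assms(1) by (rule module_zero_closed)
  have "f (0 \<odot>\<^bsub>M\<^esub> \<zero>\<^bsub>M\<^esub>) = 0 \<odot>\<^bsub>N\<^esub> f \<zero>\<^bsub>M\<^esub>" using lin_mapD(3)[OF assms(3) z] .
  then show ?thesis using smult_0[OF assms(1) z] smult_0[OF assms(2) lin_mapD(1)[OF assms(3) z]] by simp
qed

lemma lin_map_compose: "lin_map M N f \<Longrightarrow> lin_map N K g \<Longrightarrow> lin_map M K (\<lambda>x. g (f x))"
  by (simp add: lin_map_def)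

lemma submodule_preimage:
  assumes "module rat_ring M" "module rat_ring N" "lin_map M N f" "submodule H rat_ring N"
  shows "submodule {x \<in> carrier M. f x \<in> H} rat_ring M"
proof -
  interpret M: module rat_ring M by fact
  note H = submoduleD[OF assms(2,4)]
  show ?thesis
    using lin_mapD[OF assms(3)] lin_map_zero[OF assms(1-3)] H
    by (intro submoduleI_rat[OF assms(1)]) auto
qed

lemma submodule_zero: "module rat_ring M \<Longrightarrow> submodule {\<zero>\<^bsub>M\<^esub>} rat_ring M"
proof -
  assume M: "module rat_ring M"
  interpret M: module rat_ring M by fact
  show ?thesis using M.smult_r_null by (intro submoduleI_rat[OF M]) auto
qed

lemma submodule_image:
  assumes "module rat_ring M" "module rat_ring N" "lin_map M N f"
  shows "submodule (f ` carrier M) rat_ring N"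
proof -
  interpret M: module rat_ring M by fact
  have z: "\<zero>\<^bsub>N\<^esub> \<in> f ` carrier M" using lin_map_zero[OF assms] by (metis M.zero_closed image_eqI)
  show ?thesis
  proof (rule submoduleI_rat[OF assms(2) _ z])
    show "f ` carrier M \<subseteq> carrier N" using lin_mapD(1)[OF assms(3)] by auto
    show "x \<oplus>\<^bsub>N\<^esub> y \<in> f ` carrier M" if "x \<in> f ` carrier M" "y \<in> f ` carrier M" for x y
      using that lin_mapD(2)[OF assms(3)] by (smt (verit) M.a_closed image_iff)
    show "q \<odot>\<^bsub>N\<^esub> x \<in> f ` carrier M" if x: "x \<in> f ` carrier M" for x q
    proof -
      obtain y where "y \<in> carrier M" "x = f y" using x by auto
      then have "q \<odot>\<^bsub>N\<^esub> x = f (q \<odot>\<^bsub>M\<^esub> y)" "q \<odot>\<^bsub>M\<^esub> y \<in> carrier M" using lin_mapD(3)[OF assms(3)] by auto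
      then show ?thesis by auto
    qed
  qed
qed

lemma lin_map_finsum:
  assumes "module rat_ring M" "module rat_ring N" "lin_map M N f" "finite I" "\<And>i. i \<in> I \<Longrightarrow> g i \<in> carrier M"
  shows "f (\<Oplus>\<^bsub>M\<^esub>i\<in>I. g i) = (\<Oplus>\<^bsub>N\<^esub>i\<in>I. f (g i))"
proof -
  interpret M: module rat_ring M by fact
  interpret N: module rat_ring N by fact
  show ?thesis using assms(4,5)
  proof (induction I rule: finite_induct)
    case empty
    then show ?case using lin_map_zero[OF assms(1-3)] by simp
  next
    case (insert i I)
    have gI: "g \<in> I \<rightarrow> carrier M" "g i \<in> carrier M" using insert.prems by auto
    have fg: "(\<lambda>i. f (g i)) \<in> I \<rightarrow> carrier N" "f (g i) \<in> carrier N"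
      using gI lin_mapD(1)[OF assms(3)] by auto
    have "f (\<Oplus>\<^bsub>M\<^esub>i\<in>insert i I. g i) = f (g i) \<oplus>\<^bsub>N\<^esub> f (\<Oplus>\<^bsub>M\<^esub>i\<in>I. g i)"
      using insert.hyps gI by (simp add: M.finsum_insert lin_mapD(2)[OF assms(3)] M.finsum_closed)
    also have "\<dots> = (\<Oplus>\<^bsub>N\<^esub>i\<in>insert i I. f (g i))"
      using insert fg by (simp add: N.finsum_insert)
    finally show ?case .
  qed
qed

lemma finsum_rat_space: "finsum rat_space f I = sum f I"
proof (cases "finite I")
  case True
  interpret M: module rat_ring rat_space by (rule module_rat_space)
  show ?thesis using True by induction (simp_all add: M.finsum_insert)
next
  case False
  then show ?thesis by (simp add: finsum_def finprod_def)
qed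

subsection \<open>Quotients\<close>

lemma abelian_subgroup_submodule:
  assumes "module rat_ring M" "submodule U rat_ring M"
  shows "abelian_subgroup U M"
  using assms by (intro abelian_subgroupI3 additive_subgroupI) (auto simp: submodule_def module_def)

lemma quot_space_simps:
  "carrier (quot_space M U) = a_rcosets\<^bsub>M\<^esub> U" "zero (quot_space M U) = U" "add (quot_space M U) = set_add M"
  "smult (quot_space M U) q X = U <+>\<^bsub>M\<^esub> ((\<lambda>x. q \<odot>\<^bsub>M\<^esub> x) ` X)"
  by (simp_all add: quot_space_def)

lemma carrier_quot_space: "carrier (quot_space M U) = (\<lambda>x. U +>\<^bsub>M\<^esub> x) ` carrier M"
  by (auto simp: quot_space_simps A_RCOSETS_def')

lemma coset_smult:
  assumes M: "module rat_ring M" and U: "submodule U rat_ring M" and x: "x \<in> carrier M"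
  shows "q \<odot>\<^bsub>quot_space M U\<^esub> (U +>\<^bsub>M\<^esub> x) = U +>\<^bsub>M\<^esub> (q \<odot>\<^bsub>M\<^esub> x)"
proof -
  interpret M: module rat_ring M by fact
  note U' = submoduleD[OF M U]
  have UC: "u \<in> carrier M" if "u \<in> U" for u using that U'(1) by auto
  have e: "u \<oplus>\<^bsub>M\<^esub> q \<odot>\<^bsub>M\<^esub> (u' \<oplus>\<^bsub>M\<^esub> x) = (u \<oplus>\<^bsub>M\<^esub> q \<odot>\<^bsub>M\<^esub> u') \<oplus>\<^bsub>M\<^esub> q \<odot>\<^bsub>M\<^esub> x" if "u \<in> U" "u' \<in> U" for u u'
    using UC[OF that(1)] UC[OF that(2)] x M.smult_r_distr[of q u' x] by (simp add: M.a_assoc)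
  show ?thesis
  proof (intro equalityI subsetI)
    fix z assume "z \<in> q \<odot>\<^bsub>quot_space M U\<^esub> (U +>\<^bsub>M\<^esub> x)"
    then obtain u u' where "u \<in> U" "u' \<in> U" "z = u \<oplus>\<^bsub>M\<^esub> q \<odot>\<^bsub>M\<^esub> (u' \<oplus>\<^bsub>M\<^esub> x)"
      by (auto simp: quot_space_simps set_add_def' a_r_coset_def')
    then show "z \<in> U +>\<^bsub>M\<^esub> (q \<odot>\<^bsub>M\<^esub> x)" using e U'(3,4) by (auto simp: a_r_coset_def')
  next
    fix z assume "z \<in> U +>\<^bsub>M\<^esub> (q \<odot>\<^bsub>M\<^esub> x)"
    then obtain u where u: "u \<in> U" "z = u \<oplus>\<^bsub>M\<^esub> q \<odot>\<^bsub>M\<^esub> x" by (auto simp: a_r_coset_def')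
    then have "z = u \<oplus>\<^bsub>M\<^esub> q \<odot>\<^bsub>M\<^esub> (\<zero>\<^bsub>M\<^esub> \<oplus>\<^bsub>M\<^esub> x)" using x by simp
    then show "z \<in> q \<odot>\<^bsub>quot_space M U\<^esub> (U +>\<^bsub>M\<^esub> x)"
      using u(1) U'(2) by (force simp: quot_space_simps set_add_def' a_r_coset_def')
  qed
qed

lemma coset_add:
  assumes "module rat_ring M" "submodule U rat_ring M" "x \<in> carrier M" "y \<in> carrier M"
  shows "(U +>\<^bsub>M\<^esub> x) \<oplus>\<^bsub>quot_space M U\<^esub> (U +>\<^bsub>M\<^esub> y) = U +>\<^bsub>M\<^esub> (x \<oplus>\<^bsub>M\<^esub> y)"
  using abelian_subgroup.a_rcos_sum[OF abelian_subgroup_submodule[OF assms(1,2)] assms(3,4)]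
  by (simp add: quot_space_simps)

lemma coset_zero:
  assumes "module rat_ring M" "submodule U rat_ring M"
  shows "U +>\<^bsub>M\<^esub> \<zero>\<^bsub>M\<^esub> = \<zero>\<^bsub>quot_space M U\<^esub>"
proof -
  interpret M: module rat_ring M by fact
  show ?thesis using submoduleD(1)[OF assms] by (simp add: quot_space_simps)
qed

lemma coset_eqI:
  assumes M: "module rat_ring M" and U: "submodule U rat_ring M" and "u \<in> U" "y \<in> carrier M" "x = u \<oplus>\<^bsub>M\<^esub> y"
  shows "U +>\<^bsub>M\<^esub> x = U +>\<^bsub>M\<^esub> y"
proof -
  interpret M: module rat_ring M by fact
  have "x \<in> U +>\<^bsub>M\<^esub> y" using assms by (auto simp: a_r_coset_def')
  moreover have "subgroup U (add_monoid M)" using U by (simp add: submodule_def)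
  ultimately show ?thesis using M.a_repr_independence[of x U y] assms(4) by simp
qed

lemma coset_eqD:
  assumes M: "module rat_ring M" and U: "submodule U rat_ring M" and "x \<in> carrier M" "U +>\<^bsub>M\<^esub> x = U +>\<^bsub>M\<^esub> y"
  shows "\<exists>u\<in>U. x = u \<oplus>\<^bsub>M\<^esub> y"
proof -
  interpret M: module rat_ring M by fact
  have "\<zero>\<^bsub>M\<^esub> \<oplus>\<^bsub>M\<^esub> x \<in> U +>\<^bsub>M\<^esub> x" using submoduleD(2)[OF M U] by (auto simp: a_r_coset_def')
  then show ?thesis using assms(3,4) by (auto simp: a_r_coset_def')
qed

lemma module_quot_space:
  assumes M: "module rat_ring M" and U: "submodule U rat_ring M"
  shows "module rat_ring (quot_space M U)"
proof -
  interpret M: module rat_ring M by fact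
  note simps = coset_add[OF M U] coset_smult[OF M U] coset_zero[OF M U, symmetric] carrier_quot_space
  show ?thesis
  proof (rule moduleI[OF cring_rat_ring])
  show "abelian_group (quot_space M U)"
  proof (rule abelian_groupI)
    fix X assume "X \<in> carrier (quot_space M U)"
    then obtain x where x: "x \<in> carrier M" "X = U +>\<^bsub>M\<^esub> x" by (auto simp: carrier_quot_space)
    then show "\<exists>Y\<in>carrier (quot_space M U). Y \<oplus>\<^bsub>quot_space M U\<^esub> X = \<zero>\<^bsub>quot_space M U\<^esub>"
      by (intro bexI[of _ "U +>\<^bsub>M\<^esub> (\<ominus>\<^bsub>M\<^esub> x)"]) (auto simp: simps M.l_neg)
  qed (auto simp: simps M.a_ac)
qed (auto simp: coset_add[OF M U] coset_smult[OF M U] carrier_quot_space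
      M.smult_l_distr[simplified] M.smult_r_distr[simplified] M.smult_assoc1[simplified] M.smult_closed[simplified] M.smult_one[simplified])
qed

lemma lin_map_coset:
  assumes "module rat_ring M" "submodule U rat_ring M"
  shows "lin_map M (quot_space M U) (\<lambda>x. U +>\<^bsub>M\<^esub> x)"
  by (rule lin_mapI) (auto simp: carrier_quot_space coset_add[OF assms] coset_smult[OF assms])

lemma quot_space_lift:
  assumes M: "module rat_ring M" and U: "submodule U rat_ring M" and N: "module rat_ring N"
    and f: "lin_map M N f" and fU: "\<And>u. u \<in> U \<Longrightarrow> f u = \<zero>\<^bsub>N\<^esub>"
  shows "\<exists>g. lin_map (quot_space M U) N g \<and> (\<forall>x\<in>carrier M. g (U +>\<^bsub>M\<^esub> x) = f x)"
proof -
  interpret M: module rat_ring M by fact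
  interpret N: module rat_ring N by fact
  define g where "g X = f (SOME x. x \<in> carrier M \<and> X = U +>\<^bsub>M\<^esub> x)" for X
  have g: "g (U +>\<^bsub>M\<^esub> x) = f x" if x: "x \<in> carrier M" for x
  proof -
    define y where "y = (SOME y. y \<in> carrier M \<and> U +>\<^bsub>M\<^esub> x = U +>\<^bsub>M\<^esub> y)"
    have y: "y \<in> carrier M \<and> U +>\<^bsub>M\<^esub> x = U +>\<^bsub>M\<^esub> y" unfolding y_def
      by (rule someI[of _ x]) (use x in auto)
    then obtain u where u: "u \<in> U" "x = u \<oplus>\<^bsub>M\<^esub> y" using coset_eqD[OF M U x] by blast
    then have "f x = f u \<oplus>\<^bsub>N\<^esub> f y" using lin_mapD(2)[OF f] y submoduleD(1)[OF M U] by blast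
    also have "\<dots> = f y" using fU[OF u(1)] lin_mapD(1)[OF f] y by simp
    finally show ?thesis by (simp add: g_def y_def)
  qed
  have "lin_map (quot_space M U) N g"
    by (rule lin_mapI) (auto simp: carrier_quot_space coset_add[OF M U] coset_smult[OF M U] g lin_mapD[OF f])
  then show ?thesis using g by blast
qed

text \<open>The first isomorphism theorem.\<close>

lemma induces_isoI:
  assumes M: "module rat_ring M" and N: "module rat_ring N" and f: "lin_map M N f"
    and surj: "f ` carrier M = carrier N" and U: "U = {x \<in> carrier M. f x = \<zero>\<^bsub>N\<^esub>}"
  shows "induces_iso M U N f"
proof -
  interpret M: module rat_ring M by fact
  interpret N: module rat_ring N by fact
  have sU: "submodule U rat_ring M"
    using submodule_preimage[OF M N f submodule_zero[OF N]] by (simp add: U)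
  obtain g where g: "lin_map (quot_space M U) N g" "\<And>x. x \<in> carrier M \<Longrightarrow> g (U +>\<^bsub>M\<^esub> x) = f x"
    using quot_space_lift[OF M sU N f] U by auto
  have inj: "inj_on g (carrier (quot_space M U))"
  proof (rule inj_onI)
    fix X Y assume "X \<in> carrier (quot_space M U)" "Y \<in> carrier (quot_space M U)" and e: "g X = g Y"
    then obtain x y where x: "x \<in> carrier M" "X = U +>\<^bsub>M\<^esub> x" and y: "y \<in> carrier M" "Y = U +>\<^bsub>M\<^esub> y"
      by (auto simp: carrier_quot_space)
    then have fe: "f x = f y" using e g(2) by simp
    define u where "u = x \<oplus>\<^bsub>M\<^esub> (\<ominus>\<^bsub>M\<^esub> y)"
    have u: "u \<in> carrier M" "x = u \<oplus>\<^bsub>M\<^esub> y" using x y by (auto simp: u_def M.a_assoc M.l_neg)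
    have fu: "f u \<in> carrier N" "f x = f u \<oplus>\<^bsub>N\<^esub> f y" "f y \<in> carrier N" using lin_mapD[OF f] u y by auto
    then have "f u = \<zero>\<^bsub>N\<^esub>" using fe by (metis N.add.r_cancel_one')
    then have "u \<in> U" using u by (simp add: U)
    then show "X = Y" using coset_eqI[OF M sU _ y(1) u(2)] x y by simp
  qed
  have img: "g ` carrier (quot_space M U) = carrier N"
  proof -
    have "g ` carrier (quot_space M U) = (\<lambda>x. g (U +>\<^bsub>M\<^esub> x)) ` carrier M"
      by (simp add: carrier_quot_space image_image)
    also have "\<dots> = f ` carrier M" using g(2) by (intro image_cong) auto
    finally show ?thesis using surj by simp
  qed
  have "g \<in> lin_iso (quot_space M U) N"
    unfolding lin_iso_def iso_def hom_def bij_betw_def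
    using inj img lin_mapD[OF g(1)] by auto
  then show ?thesis unfolding induces_iso_def using g(2) by blast
qed

subsection \<open>Free spaces\<close>

lemma gen_in_free: "gen s \<in> carrier (free_space S) \<longleftrightarrow> s \<in> S"
  by auto

lemma single_eq_scale: "Poly_Mapping.single s q = Poly_Mapping.map ((*) q) (gen s)"
  by (rule poly_mapping_eqI) (auto simp: lookup_single when_def)

lemma free_space_spanned:
  assumes N: "submodule N rat_ring (free_space S)" and g: "\<And>s. s \<in> S \<Longrightarrow> gen s \<in> N" and x: "x \<in> carrier (free_space S)"
  shows "x \<in> N"
proof -
  note N' = submoduleD[OF module_free_space N]
  have "(\<Sum>s\<in>I. Poly_Mapping.single s (Poly_Mapping.lookup x s)) \<in> N" if "finite I" "I \<subseteq> S" for I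
    using that
  proof (induction I rule: finite_induct)
    case (insert s I)
    have "Poly_Mapping.single s (Poly_Mapping.lookup x s) \<in> N"
      using N'(4)[OF g[of s], of "Poly_Mapping.lookup x s"] insert.prems by (subst single_eq_scale) simp
    then show ?case using insert N'(3) by (simp add: add.commute)
  qed (use N'(2) in simp)
  then have "(\<Sum>s\<in>Poly_Mapping.keys x. Poly_Mapping.single s (Poly_Mapping.lookup x s)) \<in> N" using x by simp
  also have "(\<Sum>s\<in>Poly_Mapping.keys x. Poly_Mapping.single s (Poly_Mapping.lookup x s)) = x"
    by (rule poly_mapping_eqI) (auto simp: lookup_sum lookup_single when_def in_keys_iff sum.delta)
  finally show ?thesis .
qed

lemma lin_extend_superset:
  assumes N: "module rat_ring N" and g: "\<And>s. s \<in> S \<Longrightarrow> g s \<in> carrier N"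
    and I: "finite I" "Poly_Mapping.keys x \<subseteq> I" "I \<subseteq> S"
  shows "lin_extend N g x = (\<Oplus>\<^bsub>N\<^esub>s\<in>I. Poly_Mapping.lookup x s \<odot>\<^bsub>N\<^esub> g s)"
proof -
  interpret N: module rat_ring N by fact
  have c: "q \<odot>\<^bsub>N\<^esub> g s \<in> carrier N" if "s \<in> I" for q s using that g I by (intro N.smult_closed) auto
  show ?thesis unfolding lin_extend_def
  proof (rule N.add.finprod_mono_neutral_cong_left[OF I(1,2)])
    fix s assume "s \<in> I - Poly_Mapping.keys x"
    then show "Poly_Mapping.lookup x s \<odot>\<^bsub>N\<^esub> g s = \<zero>\<^bsub>N\<^esub>"
      using smult_0[OF N] g I by (auto simp: in_keys_iff)
  qed (use c in auto)
qed

lemma lin_extend_gen: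
  assumes "module rat_ring N" "g s \<in> carrier N"
  shows "lin_extend N g (gen s) = g s"
proof -
  interpret N: module rat_ring N by fact
  have "1 \<odot>\<^bsub>N\<^esub> g s = g s" using N.smult_one[OF assms(2)] by simp
  then show ?thesis using assms(2) by (simp add: lin_extend_def)
qed

lemma lin_map_lin_extend:
  fixes S :: "'s set"
  assumes N: "module rat_ring N" and g: "\<And>s. s \<in> S \<Longrightarrow> g s \<in> carrier N"
  shows "lin_map (free_space S) N (lin_extend N g)"
proof (rule lin_mapI)
  interpret N: module rat_ring N by fact
  have c: "q \<odot>\<^bsub>N\<^esub> g s \<in> carrier N" if "s \<in> S" for q s using that g by (intro N.smult_closed) auto
  fix x :: "'s \<Rightarrow>\<^sub>0 rat" assume x: "x \<in> carrier (free_space S)"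
  show "lin_extend N g x \<in> carrier N"
    unfolding lin_extend_def using x c by (intro N.finsum_closed) auto
  fix y :: "'s \<Rightarrow>\<^sub>0 rat" assume y: "y \<in> carrier (free_space S)"
  let ?I = "Poly_Mapping.keys x \<union> Poly_Mapping.keys y"
  have I: "finite ?I" "?I \<subseteq> S" using x y by auto
  have "lin_extend N g (x + y) = (\<Oplus>\<^bsub>N\<^esub>s\<in>?I. Poly_Mapping.lookup x s \<odot>\<^bsub>N\<^esub> g s \<oplus>\<^bsub>N\<^esub> Poly_Mapping.lookup y s \<odot>\<^bsub>N\<^esub> g s)"
    using N.smult_l_distr g I
    by (subst lin_extend_superset[OF N g I(1) keys_add I(2)]) (auto simp: lookup_add intro!: N.finsum_cong' c)
  also have "\<dots> = lin_extend N g x \<oplus>\<^bsub>N\<^esub> lin_extend N g y"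
    using I c by (subst N.finsum_addf) (auto simp: lin_extend_superset[OF N g I(1) _ I(2)])
  finally show "lin_extend N g (x \<oplus>\<^bsub>free_space S\<^esub> y) = lin_extend N g x \<oplus>\<^bsub>N\<^esub> lin_extend N g y" by simp
next
  interpret N: module rat_ring N by fact
  fix q and x :: "'s \<Rightarrow>\<^sub>0 rat" assume x: "x \<in> carrier (free_space S)"
  have c: "q \<odot>\<^bsub>N\<^esub> g s \<in> carrier N" if "s \<in> S" for q s using that g by (intro N.smult_closed) auto
  have I: "finite (Poly_Mapping.keys x)" "Poly_Mapping.keys x \<subseteq> S" using x by auto
  have k: "Poly_Mapping.keys (Poly_Mapping.map ((*) q) x) \<subseteq> Poly_Mapping.keys x" by (auto simp: in_keys_iff)
  have "lin_extend N g (Poly_Mapping.map ((*) q) x) = (\<Oplus>\<^bsub>N\<^esub>s\<in>Poly_Mapping.keys x. q \<odot>\<^bsub>N\<^esub> (Poly_Mapping.lookup x s \<odot>\<^bsub>N\<^esub> g s))"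
    using N.smult_assoc1 g I
    by (subst lin_extend_superset[OF N g I(1) k I(2)]) (auto intro!: N.finsum_cong' c)
  also have "\<dots> = q \<odot>\<^bsub>N\<^esub> lin_extend N g x"
    unfolding lin_extend_def using I c by (intro N.finsum_smult_ldistr[symmetric]) auto
  finally show "lin_extend N g (q \<odot>\<^bsub>free_space S\<^esub> x) = q \<odot>\<^bsub>N\<^esub> lin_extend N g x" by simp
qed

lemma lin_map_eq_on_gens:
  assumes N: "module rat_ring N" and f: "lin_map (free_space S) N f" and g: "lin_map (free_space S) N g"
    and eq: "\<And>s. s \<in> S \<Longrightarrow> f (gen s) = g (gen s)" and x: "x \<in> carrier (free_space S)"
  shows "f x = g x"
proof -
  note M = module_free_space[of S]
  have "submodule {x \<in> carrier (free_space S). f x = g x} rat_ring (free_space S)"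
  proof (rule submoduleI_rat[OF M])
    show "\<zero>\<^bsub>free_space S\<^esub> \<in> {x \<in> carrier (free_space S). f x = g x}"
      using lin_map_zero[OF M N f] lin_map_zero[OF M N g] by simp
    fix x y assume x: "x \<in> {x \<in> carrier (free_space S). f x = g x}" and "y \<in> {x \<in> carrier (free_space S). f x = g x}"
    then have "x \<in> carrier (free_space S)" "y \<in> carrier (free_space S)" "f x = g x" "f y = g y" by blast+
    then show "x \<oplus>\<^bsub>free_space S\<^esub> y \<in> {x \<in> carrier (free_space S). f x = g x}"
      using lin_mapD(2)[OF f] lin_mapD(2)[OF g] abelian_monoid.a_closed[of "free_space S" x y] M
      by (metis (mono_tags, lifting) abelian_group_def mem_Collect_eq module_def)
  next
    fix q x assume "x \<in> {x \<in> carrier (free_space S). f x = g x}"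
    then have "x \<in> carrier (free_space S)" "f x = g x" by blast+
    then show "q \<odot>\<^bsub>free_space S\<^esub> x \<in> {x \<in> carrier (free_space S). f x = g x}"
      using lin_mapD(3)[OF f] lin_mapD(3)[OF g] module.smult_closed[OF M, of q x] by simp
  qed blast
  from free_space_spanned[OF this _ x] eq show ?thesis by auto
qed

section \<open>Tensor products and symmetric powers\<close>

lemma free_minus_closed:
  "a \<in> carrier (free_space S) \<Longrightarrow> b \<in> carrier (free_space S) \<Longrightarrow> a - b \<in> carrier (free_space S)"
  by (auto simp: keys_subset_iff lookup_minus)

lemma single_in_free: "s \<in> S \<Longrightarrow> Poly_Mapping.single s q \<in> carrier (free_space S)"
  by auto

lemma gen_add_in_free: "s \<in> S \<Longrightarrow> s' \<in> S \<Longrightarrow> gen s + gen s' \<in> carrier (free_space S)"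
  by (auto simp: keys_subset_iff lookup_add lookup_single when_def)

lemma scale_gen: "q \<odot>\<^bsub>free_space S\<^esub> gen s = Poly_Mapping.single s q"
  by (rule poly_mapping_eqI) (auto simp: lookup_single when_def)

lemma coset_free_eqI:
  assumes "submodule U rat_ring (free_space S)" "b \<in> carrier (free_space S)" "a - b \<in> U"
  shows "U +>\<^bsub>free_space S\<^esub> a = U +>\<^bsub>free_space S\<^esub> b"
  using assms by (intro coset_eqI[OF module_free_space assms(1), of "a - b"]) auto

subsection \<open>Tensor products\<close>

lemma lin_map_vanishes_on_span:
  assumes "module rat_ring M" "module rat_ring N" "lin_map M N f" "X \<subseteq> carrier M"
    and "\<And>x. x \<in> X \<Longrightarrow> f x = \<zero>\<^bsub>N\<^esub>" "u \<in> lin_span M X"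
  shows "f u = \<zero>\<^bsub>N\<^esub>"
proof -
  have "lin_span M X \<subseteq> {x \<in> carrier M. f x \<in> {\<zero>\<^bsub>N\<^esub>}}"
    by (rule lin_span_least[OF submodule_preimage[OF assms(1-3) submodule_zero[OF assms(2)]]])
       (use assms(4,5) in auto)
  then show ?thesis using assms(6) by blast
qed

lemma lin_map_free_minus:
  assumes N: "module rat_ring N" and f: "lin_map (free_space S) N f"
    and ab: "a \<in> carrier (free_space S)" "b \<in> carrier (free_space S)" and eq: "f a = f b"
  shows "f (a - b) = \<zero>\<^bsub>N\<^esub>"
proof -
  interpret N: module rat_ring N by fact
  have c: "a - b \<in> carrier (free_space S)" using free_minus_closed[OF ab] .
  have "f ((a - b) \<oplus>\<^bsub>free_space S\<^esub> b) = f (a - b) \<oplus>\<^bsub>N\<^esub> f b" by (rule lin_mapD(2)[OF f c ab(2)])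
  then have "f b = f (a - b) \<oplus>\<^bsub>N\<^esub> f b" using eq by simp
  then show ?thesis using lin_mapD(1)[OF f c] lin_mapD(1)[OF f ab(2)] by (metis N.add.r_cancel_one')
qed

context
  fixes M :: "(rat, 'v) module" and N :: "(rat, 'w) module"
  assumes M: "module rat_ring M" and N: "module rat_ring N"
begin

interpretation M: module rat_ring M by (rule M)
interpretation N: module rat_ring N by (rule N)

lemma M_smult: "x \<in> carrier M \<Longrightarrow> q \<odot>\<^bsub>M\<^esub> x \<in> carrier M" and N_smult: "y \<in> carrier N \<Longrightarrow> q \<odot>\<^bsub>N\<^esub> y \<in> carrier N"
  by (simp_all add: module.smult_closed[OF M] module.smult_closed[OF N])

text \<open>An elimination rule in which a sum of two generators is subtracted at once. In this form every relation
  is a difference of two elements, and \<open>lin_map_free_minus\<close> applies to it.\<close>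

lemma tensor_rel_cases:
  assumes "r \<in> tensor_rel M N"
    and "\<And>u v y. u \<in> carrier M \<Longrightarrow> v \<in> carrier M \<Longrightarrow> y \<in> carrier N \<Longrightarrow>
      P (gen (u \<oplus>\<^bsub>M\<^esub> v, y) - (gen (u, y) + gen (v, y)))"
    and "\<And>x u v. x \<in> carrier M \<Longrightarrow> u \<in> carrier N \<Longrightarrow> v \<in> carrier N \<Longrightarrow>
      P (gen (x, u \<oplus>\<^bsub>N\<^esub> v) - (gen (x, u) + gen (x, v)))"
    and "\<And>q x y. x \<in> carrier M \<Longrightarrow> y \<in> carrier N \<Longrightarrow> P (gen (q \<odot>\<^bsub>M\<^esub> x, y) - Poly_Mapping.single (x, y) q)"
    and "\<And>q x y. x \<in> carrier M \<Longrightarrow> y \<in> carrier N \<Longrightarrow> P (gen (x, q \<odot>\<^bsub>N\<^esub> y) - Poly_Mapping.single (x, y) q)"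
  shows "P r"
  using assms(1) unfolding tensor_rel_def diff_diff_eq
  by (elim UnE CollectE exE conjE) (simp_all only: assms(2-5))

lemma tensor_rel_carrier: "tensor_rel M N \<subseteq> carrier (free_space (carrier M \<times> carrier N))"
proof
  fix r assume "r \<in> tensor_rel M N"
  then show "r \<in> carrier (free_space (carrier M \<times> carrier N))"
    by (rule tensor_rel_cases)
       ((intro free_minus_closed gen_add_in_free single_in_free SigmaI M_smult N_smult M.a_closed N.a_closed; assumption)+)
qed

lemma submodule_tensor_null: "submodule (tensor_null M N) rat_ring (free_space (carrier M \<times> carrier N))"
  unfolding tensor_null_def by (rule submodule_lin_span[OF module_free_space tensor_rel_carrier])

lemma module_tensor: "module rat_ring (tensor M N)"
  unfolding tensor_def by (rule module_quot_space[OF module_free_space submodule_tensor_null])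

lemma tensor_relD: "r \<in> tensor_rel M N \<Longrightarrow> r \<in> tensor_null M N"
  unfolding tensor_null_def by (rule subsetD[OF lin_span_superset])

lemma pure_tensor_closed:
  "x \<in> carrier M \<Longrightarrow> y \<in> carrier N \<Longrightarrow> pure_tensor M N x y \<in> carrier (tensor M N)"
  by (simp add: tensor_def pure_tensor_def carrier_quot_space)

lemma pure_tensor_lin_left:
  assumes y: "y \<in> carrier N"
  shows "lin_map M (tensor M N) (\<lambda>x. pure_tensor M N x y)"
proof (rule lin_mapI)
  note sub = submodule_tensor_null
  let ?F = "free_space (carrier M \<times> carrier N)"
  fix u assume u: "u \<in> carrier M"
  show "pure_tensor M N u y \<in> carrier (tensor M N)" using u y by (rule pure_tensor_closed)
  have g: "gen (u, y) \<in> carrier ?F" using u y by auto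
  { fix v assume v: "v \<in> carrier M"
    have g': "gen (v, y) \<in> carrier ?F" using v y by auto
    have "gen (u \<oplus>\<^bsub>M\<^esub> v, y) - (gen (u, y) + gen (v, y)) \<in> tensor_null M N"
      by (intro tensor_relD, unfold tensor_rel_def diff_diff_eq, rule UnI1, rule UnI1, rule UnI1)
         (rule CollectI, rule exI[of _ u], rule exI[of _ v], rule exI[of _ y], intro conjI refl u v y)
    moreover have "gen (u, y) + gen (v, y) \<in> carrier ?F" using g g' by (auto simp: keys_subset_iff lookup_add)
    ultimately show "pure_tensor M N (u \<oplus>\<^bsub>M\<^esub> v) y = pure_tensor M N u y \<oplus>\<^bsub>tensor M N\<^esub> pure_tensor M N v y"
      unfolding pure_tensor_def tensor_def coset_add[OF module_free_space sub g g']
      by (intro coset_free_eqI[OF sub]) auto }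
  fix q
  have "gen (q \<odot>\<^bsub>M\<^esub> u, y) - Poly_Mapping.single (u, y) q \<in> tensor_null M N"
    by (intro tensor_relD, unfold tensor_rel_def, rule UnI1, rule UnI2) (rule CollectI, rule exI[of _ q], rule exI[of _ u], rule exI[of _ y], intro conjI refl u y)
  then show "pure_tensor M N (q \<odot>\<^bsub>M\<^esub> u) y = q \<odot>\<^bsub>tensor M N\<^esub> pure_tensor M N u y"
    unfolding pure_tensor_def tensor_def coset_smult[OF module_free_space sub g] scale_gen
    using u y by (intro coset_free_eqI[OF sub] single_in_free) auto
qed

lemma pure_tensor_lin_right:
  assumes x: "x \<in> carrier M"
  shows "lin_map N (tensor M N) (\<lambda>y. pure_tensor M N x y)"
proof (rule lin_mapI)
  note sub = submodule_tensor_null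
  let ?F = "free_space (carrier M \<times> carrier N)"
  fix u assume u: "u \<in> carrier N"
  show "pure_tensor M N x u \<in> carrier (tensor M N)" using x u by (rule pure_tensor_closed)
  have g: "gen (x, u) \<in> carrier ?F" using u x by auto
  { fix v assume v: "v \<in> carrier N"
    have g': "gen (x, v) \<in> carrier ?F" using v x by auto
    have "gen (x, u \<oplus>\<^bsub>N\<^esub> v) - (gen (x, u) + gen (x, v)) \<in> tensor_null M N"
      by (intro tensor_relD, unfold tensor_rel_def diff_diff_eq, rule UnI1, rule UnI1, rule UnI2)
         (rule CollectI, rule exI[of _ x], rule exI[of _ u], rule exI[of _ v], intro conjI refl u v x)
    moreover have "gen (x, u) + gen (x, v) \<in> carrier ?F" using g g' by (auto simp: keys_subset_iff lookup_add)
    ultimately show "pure_tensor M N x (u \<oplus>\<^bsub>N\<^esub> v) = pure_tensor M N x u \<oplus>\<^bsub>tensor M N\<^esub> pure_tensor M N x v"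
      unfolding pure_tensor_def tensor_def coset_add[OF module_free_space sub g g']
      by (intro coset_free_eqI[OF sub]) auto }
  fix q
  have "gen (x, q \<odot>\<^bsub>N\<^esub> u) - Poly_Mapping.single (x, u) q \<in> tensor_null M N"
    by (intro tensor_relD, unfold tensor_rel_def, rule UnI2) (rule CollectI, rule exI[of _ q], rule exI[of _ x], rule exI[of _ u], intro conjI refl u x)
  then show "pure_tensor M N x (q \<odot>\<^bsub>N\<^esub> u) = q \<odot>\<^bsub>tensor M N\<^esub> pure_tensor M N x u"
    unfolding pure_tensor_def tensor_def coset_smult[OF module_free_space sub g] scale_gen
    using u x by (intro coset_free_eqI[OF sub] single_in_free) auto
qed

text \<open>The universal property. The extension of \<open>B\<close> to the free space takes equal values on the two sides of
  each defining relation, hence descends to the quotient.\<close>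

lemma tensor_lift:
  assumes L: "module rat_ring L"
    and bl: "\<And>y. y \<in> carrier N \<Longrightarrow> lin_map M L (\<lambda>x. B x y)" and br: "\<And>x. x \<in> carrier M \<Longrightarrow> lin_map N L (B x)"
  shows "\<exists>h. lin_map (tensor M N) L h \<and> (\<forall>x\<in>carrier M. \<forall>y\<in>carrier N. h (pure_tensor M N x y) = B x y)"
proof -
  let ?S = "carrier M \<times> carrier N"
  let ?f = "lin_extend L (\<lambda>(x, y). B x y)"
  have Bc: "B x y \<in> carrier L" if "x \<in> carrier M" "y \<in> carrier N" for x y by (rule lin_mapD(1)[OF br[OF that(1)] that(2)])
  have f: "lin_map (free_space ?S) L ?f" by (rule lin_map_lin_extend[OF L]) (auto intro: Bc)
  have fg: "?f (gen (x, y)) = B x y" if "x \<in> carrier M" "y \<in> carrier N" for x y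
    using lin_extend_gen[OF L, of "\<lambda>(x, y). B x y" "(x, y)"] Bc[OF that] by simp
  have fs: "?f (Poly_Mapping.single (x, y) q) = q \<odot>\<^bsub>L\<^esub> B x y" if "x \<in> carrier M" "y \<in> carrier N" for x y q
    using lin_mapD(3)[OF f single_in_free[of "(x,y)" ?S 1], of q] fg that unfolding scale_gen by simp
  have fp: "?f (gen (x, y) + gen (x', y')) = B x y \<oplus>\<^bsub>L\<^esub> B x' y'"
    if "x \<in> carrier M" "y \<in> carrier N" "x' \<in> carrier M" "y' \<in> carrier N" for x y x' y'
    using lin_mapD(2)[OF f single_in_free[of "(x,y)" ?S 1] single_in_free[of "(x',y')" ?S 1]] fg that by simp
  have van: "?f r = \<zero>\<^bsub>L\<^esub>" if r: "r \<in> tensor_rel M N" for r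
  proof -
    from r show ?thesis
    proof (rule tensor_rel_cases)
      fix u v y assume 1: "u \<in> carrier M" "v \<in> carrier M" "y \<in> carrier N"
      have t: "(u \<oplus>\<^bsub>M\<^esub> v, y) \<in> ?S" "(u, y) \<in> ?S" "(v, y) \<in> ?S" using 1 by auto
      show "?f (gen (u \<oplus>\<^bsub>M\<^esub> v, y) - (gen (u, y) + gen (v, y))) = \<zero>\<^bsub>L\<^esub>"
        by (rule lin_map_free_minus[OF L f single_in_free[OF t(1)] gen_add_in_free[OF t(2,3)]])
           (use fg fp lin_mapD(2)[OF bl[OF 1(3)] 1(1,2)] 1 in simp)
    next
      fix x u v assume 2: "x \<in> carrier M" "u \<in> carrier N" "v \<in> carrier N"
      have t: "(x, u \<oplus>\<^bsub>N\<^esub> v) \<in> ?S" "(x, u) \<in> ?S" "(x, v) \<in> ?S" using 2 by auto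
      show "?f (gen (x, u \<oplus>\<^bsub>N\<^esub> v) - (gen (x, u) + gen (x, v))) = \<zero>\<^bsub>L\<^esub>"
        by (rule lin_map_free_minus[OF L f single_in_free[OF t(1)] gen_add_in_free[OF t(2,3)]])
           (use fg fp lin_mapD(2)[OF br[OF 2(1)] 2(2,3)] 2 in simp)
    next
      fix q x y assume 3: "x \<in> carrier M" "y \<in> carrier N"
      have t: "(q \<odot>\<^bsub>M\<^esub> x, y) \<in> ?S" "(x, y) \<in> ?S" using 3 M_smult by auto
      show "?f (gen (q \<odot>\<^bsub>M\<^esub> x, y) - Poly_Mapping.single (x, y) q) = \<zero>\<^bsub>L\<^esub>"
        by (rule lin_map_free_minus[OF L f single_in_free[OF t(1)] single_in_free[OF t(2)]])
           (simp only: fg[OF M_smult[OF 3(1)] 3(2)] fs[OF 3] lin_mapD(3)[OF bl[OF 3(2)] 3(1)])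
    next
      fix q x y assume 4: "x \<in> carrier M" "y \<in> carrier N"
      have t: "(x, q \<odot>\<^bsub>N\<^esub> y) \<in> ?S" "(x, y) \<in> ?S" using 4 N_smult by auto
      show "?f (gen (x, q \<odot>\<^bsub>N\<^esub> y) - Poly_Mapping.single (x, y) q) = \<zero>\<^bsub>L\<^esub>"
        by (rule lin_map_free_minus[OF L f single_in_free[OF t(1)] single_in_free[OF t(2)]])
           (simp only: fg[OF 4(1) N_smult[OF 4(2)]] fs[OF 4] lin_mapD(3)[OF br[OF 4(1)] 4(2)])
    qed
  qed
  have "\<exists>h. lin_map (tensor M N) L h \<and> (\<forall>x\<in>carrier (free_space ?S). h (tensor_null M N +>\<^bsub>free_space ?S\<^esub> x) = ?f x)"
    unfolding tensor_def
    by (rule quot_space_lift[OF module_free_space submodule_tensor_null L f])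
       (rule lin_map_vanishes_on_span[OF module_free_space L f tensor_rel_carrier van], auto simp: tensor_null_def)
  then show ?thesis using fg unfolding pure_tensor_def by (metis SigmaI gen_in_free)
qed

lemma tensor_spanned:
  assumes H: "submodule H rat_ring (tensor M N)"
    and p: "\<And>x y. x \<in> carrier M \<Longrightarrow> y \<in> carrier N \<Longrightarrow> pure_tensor M N x y \<in> H"
  shows "carrier (tensor M N) \<subseteq> H"
proof -
  let ?F = "free_space (carrier M \<times> carrier N)"
  have sm: "submodule {f \<in> carrier ?F. tensor_null M N +>\<^bsub>?F\<^esub> f \<in> H} rat_ring ?F"
    using submodule_preimage[OF module_free_space module_tensor[unfolded tensor_def]
       lin_map_coset[OF module_free_space submodule_tensor_null]] H unfolding tensor_def by blast
  have "f \<in> {f \<in> carrier ?F. tensor_null M N +>\<^bsub>?F\<^esub> f \<in> H}" if "f \<in> carrier ?F" for f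
    by (rule free_space_spanned[OF sm _ that]) (use p in \<open>auto simp: pure_tensor_def\<close>)
  then show ?thesis by (auto simp: tensor_def carrier_quot_space)
qed

end

subsection \<open>Symmetric powers\<close>

context
  fixes V :: "(rat, 'v) module" and k :: nat
  assumes V: "module rat_ring V"
begin

interpretation V: module rat_ring V by (rule V)

lemma V_smult: "x \<in> carrier V \<Longrightarrow> q \<odot>\<^bsub>V\<^esub> x \<in> carrier V"
  by (rule V.smult_closed) simp

lemma sym_rel_cases:
  assumes "r \<in> sym_rel k V"
    and "\<And>xs u v ys. xs @ [u] @ ys \<in> tuples k V \<Longrightarrow> xs @ [v] @ ys \<in> tuples k V \<Longrightarrow>
      P (gen (xs @ [u \<oplus>\<^bsub>V\<^esub> v] @ ys) - (gen (xs @ [u] @ ys) + gen (xs @ [v] @ ys)))"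
    and "\<And>xs q u ys. xs @ [u] @ ys \<in> tuples k V \<Longrightarrow>
      P (gen (xs @ [q \<odot>\<^bsub>V\<^esub> u] @ ys) - Poly_Mapping.single (xs @ [u] @ ys) q)"
    and "\<And>xs ys. xs \<in> tuples k V \<Longrightarrow> ys \<in> tuples k V \<Longrightarrow> mset xs = mset ys \<Longrightarrow> P (gen xs - gen ys)"
  shows "P r"
  using assms(1) unfolding sym_rel_def diff_diff_eq
  by (elim UnE CollectE exE conjE) (simp_all only: assms(2-4))

lemma sym_rel_carrier: "sym_rel k V \<subseteq> carrier (free_space (tuples k V))"
proof
  fix r assume "r \<in> sym_rel k V"
  then show "r \<in> carrier (free_space (tuples k V))"
  proof (rule sym_rel_cases)
    fix xs u v ys assume "xs @ [u] @ ys \<in> tuples k V" "xs @ [v] @ ys \<in> tuples k V"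
    moreover from this have "xs @ [u \<oplus>\<^bsub>V\<^esub> v] @ ys \<in> tuples k V" by (auto simp: tuples_def)
    ultimately show "gen (xs @ [u \<oplus>\<^bsub>V\<^esub> v] @ ys) - (gen (xs @ [u] @ ys) + gen (xs @ [v] @ ys)) \<in> carrier (free_space (tuples k V))"
      by (intro free_minus_closed gen_add_in_free single_in_free)
  next
    fix xs q u ys assume "xs @ [u] @ ys \<in> tuples k V"
    moreover from this have "xs @ [q \<odot>\<^bsub>V\<^esub> u] @ ys \<in> tuples k V" using V_smult by (auto simp: tuples_def)
    ultimately show "gen (xs @ [q \<odot>\<^bsub>V\<^esub> u] @ ys) - Poly_Mapping.single (xs @ [u] @ ys) q \<in> carrier (free_space (tuples k V))"
      by (intro free_minus_closed single_in_free)
  qed (intro free_minus_closed single_in_free)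
qed

lemma submodule_sym_null: "submodule (sym_null k V) rat_ring (free_space (tuples k V))"
  unfolding sym_null_def by (rule submodule_lin_span[OF module_free_space sym_rel_carrier])

lemma module_sym_power: "module rat_ring (sym_power k V)"
  unfolding sym_power_def by (rule module_quot_space[OF module_free_space submodule_sym_null])

lemma sym_relD: "r \<in> sym_rel k V \<Longrightarrow> r \<in> sym_null k V"
  unfolding sym_null_def by (rule subsetD[OF lin_span_superset])

lemma sym_prod_eq: "xs \<in> tuples k V \<Longrightarrow> sym_prod V xs = sym_null k V +>\<^bsub>free_space (tuples k V)\<^esub> gen xs"
  by (simp add: sym_prod_def tuples_def)

lemma sym_prod_closed: "xs \<in> tuples k V \<Longrightarrow> sym_prod V xs \<in> carrier (sym_power k V)"
  by (simp add: sym_power_def carrier_quot_space sym_prod_eq)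

lemma sym_prod_lin:
  assumes "length xs + Suc (length ys) = k" "set xs \<subseteq> carrier V" "set ys \<subseteq> carrier V"
  shows "lin_map V (sym_power k V) (\<lambda>x. sym_prod V (xs @ x # ys))"
proof (rule lin_mapI)
  note sub = submodule_sym_null
  let ?F = "free_space (tuples k V)"
  have t: "xs @ x # ys \<in> tuples k V" if "x \<in> carrier V" for x using assms that by (auto simp: tuples_def)
  fix u assume u: "u \<in> carrier V"
  show "sym_prod V (xs @ u # ys) \<in> carrier (sym_power k V)" using t[OF u] by (rule sym_prod_closed)
  have g: "gen (xs @ u # ys) \<in> carrier ?F" using t[OF u] by auto
  { fix v assume v: "v \<in> carrier V"
    have g': "gen (xs @ v # ys) \<in> carrier ?F" using t[OF v] by auto
    have uv: "u \<oplus>\<^bsub>V\<^esub> v \<in> carrier V" using u v by simp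
    have "gen (xs @ [u \<oplus>\<^bsub>V\<^esub> v] @ ys) - gen (xs @ [u] @ ys) - gen (xs @ [v] @ ys) \<in> sym_null k V"
      by (rule sym_relD, unfold sym_rel_def, rule UnI1, rule UnI1)
         (rule CollectI, rule exI[of _ xs], rule exI[of _ u], rule exI[of _ v], rule exI[of _ ys], use t[OF u] t[OF v] in simp)
    then have "gen (xs @ (u \<oplus>\<^bsub>V\<^esub> v) # ys) - (gen (xs @ u # ys) + gen (xs @ v # ys)) \<in> sym_null k V"
      by (simp add: diff_diff_eq)
    moreover have "gen (xs @ u # ys) + gen (xs @ v # ys) \<in> carrier ?F" using g g' by (auto simp: keys_subset_iff lookup_add)
    ultimately show "sym_prod V (xs @ (u \<oplus>\<^bsub>V\<^esub> v) # ys) = sym_prod V (xs @ u # ys) \<oplus>\<^bsub>sym_power k V\<^esub> sym_prod V (xs @ v # ys)"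
      unfolding sym_prod_eq[OF t[OF u]] sym_prod_eq[OF t[OF v]] sym_prod_eq[OF t[OF uv]] sym_power_def
        coset_add[OF module_free_space sub g g']
      by (intro coset_free_eqI[OF sub]) auto }
  fix q
  have "gen (xs @ [q \<odot>\<^bsub>V\<^esub> u] @ ys) - Poly_Mapping.single (xs @ [u] @ ys) q \<in> sym_null k V"
    by (rule sym_relD, unfold sym_rel_def, rule UnI1, rule UnI2) (rule CollectI, rule exI[of _ xs], rule exI[of _ q], rule exI[of _ u], rule exI[of _ ys], use t[OF u] in simp)
  then show "sym_prod V (xs @ (q \<odot>\<^bsub>V\<^esub> u) # ys) = q \<odot>\<^bsub>sym_power k V\<^esub> sym_prod V (xs @ u # ys)"
    unfolding sym_prod_eq[OF t[OF u]] sym_prod_eq[OF t[OF V_smult[OF u]]] sym_power_def coset_smult[OF module_free_space sub g] scale_gen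
    using t[OF u] by (intro coset_free_eqI[OF sub] single_in_free) auto
qed

lemma sym_prod_perm:
  assumes "xs \<in> tuples k V" "mset xs = mset ys"
  shows "sym_prod V xs = sym_prod V ys"
proof -
  have ys: "ys \<in> tuples k V" using assms by (auto simp: tuples_def dest: mset_eq_setD mset_eq_length)
  have "gen xs - gen ys \<in> sym_null k V"
    by (rule sym_relD, unfold sym_rel_def, rule UnI2) (rule CollectI, rule exI[of _ xs], rule exI[of _ ys], intro conjI refl assms ys)
  then show ?thesis
    unfolding sym_prod_eq[OF assms(1)] sym_prod_eq[OF ys]
    using ys by (intro coset_free_eqI[OF submodule_sym_null]) auto
qed

lemma sym_power_spanned:
  assumes H: "submodule H rat_ring (sym_power k V)"
    and p: "\<And>xs. xs \<in> tuples k V \<Longrightarrow> sym_prod V xs \<in> H"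
  shows "carrier (sym_power k V) \<subseteq> H"
proof -
  let ?F = "free_space (tuples k V)"
  have sm: "submodule {f \<in> carrier ?F. sym_null k V +>\<^bsub>?F\<^esub> f \<in> H} rat_ring ?F"
    using submodule_preimage[OF module_free_space module_sym_power[unfolded sym_power_def]
       lin_map_coset[OF module_free_space submodule_sym_null]] H unfolding sym_power_def by blast
  have "f \<in> {f \<in> carrier ?F. sym_null k V +>\<^bsub>?F\<^esub> f \<in> H}" if "f \<in> carrier ?F" for f
    by (rule free_space_spanned[OF sm _ that]) (use p sym_prod_eq in auto)
  then show ?thesis by (auto simp: sym_power_def carrier_quot_space)
qed

lemma sym_power_lift:
  assumes L: "module rat_ring L"
    and lin: "\<And>xs ys. length xs + Suc (length ys) = k \<Longrightarrow> set xs \<subseteq> carrier V \<Longrightarrow> set ys \<subseteq> carrier V \<Longrightarrow>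
       lin_map V L (\<lambda>x. F (xs @ x # ys))"
    and perm: "\<And>xs ys. xs \<in> tuples k V \<Longrightarrow> mset xs = mset ys \<Longrightarrow> F xs = F ys"
    and cl: "\<And>xs. xs \<in> tuples k V \<Longrightarrow> F xs \<in> carrier L"
  shows "\<exists>h. lin_map (sym_power k V) L h \<and> (\<forall>xs\<in>tuples k V. h (sym_prod V xs) = F xs)"
proof -
  let ?S = "tuples k V"
  let ?f = "lin_extend L F"
  have f: "lin_map (free_space ?S) L ?f" by (rule lin_map_lin_extend[OF L cl])
  have fg: "?f (gen xs) = F xs" if "xs \<in> ?S" for xs using lin_extend_gen[OF L, of F] cl that by blast
  have fs: "?f (Poly_Mapping.single xs q) = q \<odot>\<^bsub>L\<^esub> F xs" if "xs \<in> ?S" for xs q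
    using lin_mapD(3)[OF f single_in_free[of xs ?S 1], of q] fg that unfolding scale_gen by simp
  have fp: "?f (gen xs + gen ys) = F xs \<oplus>\<^bsub>L\<^esub> F ys" if "xs \<in> ?S" "ys \<in> ?S" for xs ys
    using lin_mapD(2)[OF f single_in_free[of xs ?S 1] single_in_free[of ys ?S 1]] fg that by simp
  have van: "?f r = \<zero>\<^bsub>L\<^esub>" if r: "r \<in> sym_rel k V" for r
    using r
  proof (rule sym_rel_cases)
    fix xs u v ys assume 1: "xs @ [u] @ ys \<in> ?S" "xs @ [v] @ ys \<in> ?S"
    then have l: "lin_map V L (\<lambda>x. F (xs @ x # ys))" and uv: "u \<in> carrier V" "v \<in> carrier V"
      by (auto intro!: lin simp: tuples_def)
    have t: "xs @ [u \<oplus>\<^bsub>V\<^esub> v] @ ys \<in> ?S" using 1 uv by (auto simp: tuples_def)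
    show "?f (gen (xs @ [u \<oplus>\<^bsub>V\<^esub> v] @ ys) - (gen (xs @ [u] @ ys) + gen (xs @ [v] @ ys))) = \<zero>\<^bsub>L\<^esub>"
      by (rule lin_map_free_minus[OF L f single_in_free[OF t] gen_add_in_free[OF 1]])
         (use fg[OF t] fp[OF 1] lin_mapD(2)[OF l uv] in simp)
  next
    fix xs q u ys assume 2: "xs @ [u] @ ys \<in> ?S"
    then have l: "lin_map V L (\<lambda>x. F (xs @ x # ys))" and u: "u \<in> carrier V"
      by (auto intro!: lin simp: tuples_def)
    have t: "xs @ [q \<odot>\<^bsub>V\<^esub> u] @ ys \<in> ?S" using 2 V_smult[OF u] by (auto simp: tuples_def)
    show "?f (gen (xs @ [q \<odot>\<^bsub>V\<^esub> u] @ ys) - Poly_Mapping.single (xs @ [u] @ ys) q) = \<zero>\<^bsub>L\<^esub>"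
      by (rule lin_map_free_minus[OF L f single_in_free[OF t] single_in_free[OF 2]])
         (use fg[OF t] fs[OF 2] lin_mapD(3)[OF l u] in simp)
  next
    fix xs ys assume 3: "xs \<in> ?S" "ys \<in> ?S" "mset xs = mset ys"
    show "?f (gen xs - gen ys) = \<zero>\<^bsub>L\<^esub>"
      by (rule lin_map_free_minus[OF L f single_in_free[OF 3(1)] single_in_free[OF 3(2)]])
         (simp only: fg[OF 3(1)] fg[OF 3(2)] perm[OF 3(1,3)])
  qed
  have "\<exists>h. lin_map (sym_power k V) L h \<and> (\<forall>x\<in>carrier (free_space ?S). h (sym_null k V +>\<^bsub>free_space ?S\<^esub> x) = ?f x)"
    unfolding sym_power_def
    by (rule quot_space_lift[OF module_free_space submodule_sym_null L f])
       (rule lin_map_vanishes_on_span[OF module_free_space L f sym_rel_carrier van], auto simp: sym_null_def)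
  then show ?thesis using fg sym_prod_eq by (metis gen_in_free)
qed

end

section \<open>The functor \<open>S\<^sub>*\<close> and its coordinates\<close>

lemma lin_map_add:
  assumes L: "module rat_ring L" and f: "lin_map V L f" and g: "lin_map V L g"
  shows "lin_map V L (\<lambda>x. f x \<oplus>\<^bsub>L\<^esub> g x)"
proof -
  interpret L: module rat_ring L by fact
  note F = lin_mapD[OF f] and G = lin_mapD[OF g]
  show ?thesis
  proof (rule lin_mapI)
    fix q x assume x: "x \<in> carrier V"
    show "f (q \<odot>\<^bsub>V\<^esub> x) \<oplus>\<^bsub>L\<^esub> g (q \<odot>\<^bsub>V\<^esub> x) = q \<odot>\<^bsub>L\<^esub> (f x \<oplus>\<^bsub>L\<^esub> g x)"
      unfolding F(3)[OF x] G(3)[OF x] using F(1)[OF x] G(1)[OF x] by (intro L.smult_r_distr[symmetric]) auto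
  qed (simp_all add: F(1,2) G(1,2) L.a_ac)
qed

lemma lin_map_smult:
  assumes L: "module rat_ring L" and f: "lin_map V L f"
  shows "lin_map V L (\<lambda>x. c \<odot>\<^bsub>L\<^esub> f x)"
proof -
  interpret L: module rat_ring L by fact
  note F = lin_mapD[OF f]
  have sc: "z \<in> carrier L \<Longrightarrow> q \<odot>\<^bsub>L\<^esub> z \<in> carrier L" for q z by (rule L.smult_closed) simp
  have comm: "z \<in> carrier L \<Longrightarrow> c \<odot>\<^bsub>L\<^esub> (q \<odot>\<^bsub>L\<^esub> z) = q \<odot>\<^bsub>L\<^esub> (c \<odot>\<^bsub>L\<^esub> z)" for q z
    using L.smult_assoc1[of c q z] L.smult_assoc1[of q c z] by (simp add: mult.commute)
  show ?thesis
  proof (rule lin_mapI)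
    fix x y assume x: "x \<in> carrier V" and y: "y \<in> carrier V"
    show "c \<odot>\<^bsub>L\<^esub> f (x \<oplus>\<^bsub>V\<^esub> y) = c \<odot>\<^bsub>L\<^esub> f x \<oplus>\<^bsub>L\<^esub> c \<odot>\<^bsub>L\<^esub> f y"
      unfolding F(2)[OF x y] using F(1)[OF x] F(1)[OF y] by (intro L.smult_r_distr) auto
  next
    fix q x assume x: "x \<in> carrier V"
    show "c \<odot>\<^bsub>L\<^esub> f (q \<odot>\<^bsub>V\<^esub> x) = q \<odot>\<^bsub>L\<^esub> (c \<odot>\<^bsub>L\<^esub> f x)"
      unfolding F(3)[OF x] by (rule comm[OF F(1)[OF x]])
  qed (rule sc[OF F(1)])
qed

lemma lin_map_0: "module rat_ring L \<Longrightarrow> lin_map V L (\<lambda>x. \<zero>\<^bsub>L\<^esub>)"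
proof -
  assume L: "module rat_ring L"
  interpret L: module rat_ring L by fact
  show ?thesis using L.smult_r_null by (intro lin_mapI) auto
qed

lemma lin_map_cong:
  assumes "module rat_ring V" "lin_map V L f" "\<And>x. x \<in> carrier V \<Longrightarrow> f x = g x"
  shows "lin_map V L g"
proof -
  interpret V: module rat_ring V by fact
  have sc: "z \<in> carrier V \<Longrightarrow> q \<odot>\<^bsub>V\<^esub> z \<in> carrier V" for q z by (rule V.smult_closed) simp
  show ?thesis
    using assms(2,3) sc by (simp add: lin_map_def)
qed

definition star_class :: "nat \<Rightarrow> (rat, 'v) module \<Rightarrow> 'v list \<Rightarrow> 'v \<Rightarrow> 'v sym_tensor" where
  "star_class n V xs y = pure_tensor (sym_power (n - 1) V) V (sym_prod V xs) y"

definition star_coset :: "nat \<Rightarrow> (rat, 'v) module \<Rightarrow> 'v list \<Rightarrow> 'v \<Rightarrow> 'v sym_tensor set" where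
  "star_coset n V xs y = sym_image n V +>\<^bsub>tensor (sym_power (n - 1) V) V\<^esub> star_class n V xs y"

context
  fixes V :: "(rat, 'v) module" and n :: nat
  assumes V: "module rat_ring V"
begin

abbreviation (input) "TT \<equiv> tensor (sym_power (n - 1) V) V"

lemma module_TT: "module rat_ring TT"
  by (rule module_tensor[OF module_sym_power[OF V] V])

lemma remove_nth_tuples:
  "xs \<in> tuples n V \<Longrightarrow> i < n \<Longrightarrow> take i xs @ drop (Suc i) xs \<in> tuples (n - 1) V \<and> xs ! i \<in> carrier V"
  by (auto simp: tuples_def dest: in_set_takeD in_set_dropD)

lemma star_class_closed: "xs \<in> tuples (n - 1) V \<Longrightarrow> y \<in> carrier V \<Longrightarrow> star_class n V xs y \<in> carrier TT"
  unfolding star_class_def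
  by (rule pure_tensor_closed[OF module_sym_power[OF V] V sym_prod_closed[OF V]])

definition "cyclic_sum xs = (\<Oplus>\<^bsub>TT\<^esub>i\<in>{..<n}. star_class n V (take i xs @ drop (Suc i) xs) (xs ! i))"

lemma cyclic_sum_closed: "xs \<in> tuples n V \<Longrightarrow> cyclic_sum xs \<in> carrier TT"
proof -
  assume xs: "xs \<in> tuples n V"
  interpret TT: module rat_ring TT by (rule module_TT)
  show ?thesis unfolding cyclic_sum_def
    by (rule TT.finsum_closed) (use remove_nth_tuples[OF xs] star_class_closed in auto)
qed

lemma sym_image_eq: "sym_image n V = lin_span TT (cyclic_sum ` tuples n V)"
  unfolding sym_image_def cyclic_sum_def star_class_def image_def by (rule arg_cong[where f = "lin_span TT"]) blast

lemma submodule_sym_image: "submodule (sym_image n V) rat_ring TT"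
  unfolding sym_image_eq by (rule submodule_lin_span[OF module_TT]) (use cyclic_sum_closed in auto)

lemma S_star_eq: "S_star n V = quot_space TT (sym_image n V)"
  by (simp add: S_star_def)

lemma module_S_star: "module rat_ring (S_star n V)"
  unfolding S_star_eq by (rule module_quot_space[OF module_TT submodule_sym_image])

lemma lin_map_star: "lin_map TT (S_star n V) (\<lambda>x. sym_image n V +>\<^bsub>TT\<^esub> x)"
  unfolding S_star_eq by (rule lin_map_coset[OF module_TT submodule_sym_image])

lemma star_coset_closed: "xs \<in> tuples (n - 1) V \<Longrightarrow> y \<in> carrier V \<Longrightarrow> star_coset n V xs y \<in> carrier (S_star n V)"
  unfolding star_coset_def by (rule lin_mapD(1)[OF lin_map_star star_class_closed])

lemma star_coset_lin_left:
  assumes "length xs + Suc (length ys) = n - 1" "set xs \<subseteq> carrier V" "set ys \<subseteq> carrier V" "y \<in> carrier V"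
  shows "lin_map V (S_star n V) (\<lambda>x. star_coset n V (xs @ x # ys) y)"
  unfolding star_coset_def star_class_def
  by (intro lin_map_compose[OF _ lin_map_star]
      lin_map_compose[OF sym_prod_lin[OF V assms(1-3)] pure_tensor_lin_left[OF module_sym_power[OF V] V assms(4)]])

lemma star_coset_lin_right:
  assumes "xs \<in> tuples (n - 1) V"
  shows "lin_map V (S_star n V) (star_coset n V xs)"
  unfolding star_coset_def[abs_def] star_class_def[abs_def]
  by (intro lin_map_compose[OF _ lin_map_star] pure_tensor_lin_right module_sym_power V sym_prod_closed assms)

lemma star_coset_perm:
  "xs \<in> tuples (n - 1) V \<Longrightarrow> mset xs = mset ys \<Longrightarrow> star_coset n V xs y = star_coset n V ys y"
  unfolding star_coset_def star_class_def using sym_prod_perm[OF V] by metis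

lemma star_coset_cyclic:
  assumes xs: "xs \<in> tuples n V"
  shows "(\<Oplus>\<^bsub>S_star n V\<^esub>i\<in>{..<n}. star_coset n V (take i xs @ drop (Suc i) xs) (xs ! i)) = \<zero>\<^bsub>S_star n V\<^esub>"
proof -
  interpret TT: module rat_ring TT by (rule module_TT)
  have "(\<Oplus>\<^bsub>S_star n V\<^esub>i\<in>{..<n}. star_coset n V (take i xs @ drop (Suc i) xs) (xs ! i)) =
      sym_image n V +>\<^bsub>TT\<^esub> cyclic_sum xs"
    unfolding cyclic_sum_def star_coset_def
    by (rule lin_map_finsum[OF module_TT module_S_star lin_map_star, symmetric])
       (use remove_nth_tuples[OF xs] star_class_closed in auto)
  also have "\<dots> = sym_image n V +>\<^bsub>TT\<^esub> \<zero>\<^bsub>TT\<^esub>"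
  proof (rule coset_eqI[OF module_TT submodule_sym_image])
    show "cyclic_sum xs \<in> sym_image n V"
      unfolding sym_image_eq by (rule subsetD[OF lin_span_superset]) (use xs in auto)
  qed (simp_all add: cyclic_sum_closed[OF xs] del: One_nat_def)
  also have "\<dots> = \<zero>\<^bsub>S_star n V\<^esub>"
    unfolding S_star_eq by (rule coset_zero[OF module_TT submodule_sym_image])
  finally show ?thesis .
qed

lemma S_star_spanned:
  assumes H: "submodule H rat_ring (S_star n V)"
    and p: "\<And>xs y. xs \<in> tuples (n - 1) V \<Longrightarrow> y \<in> carrier V \<Longrightarrow> star_coset n V xs y \<in> H"
  shows "H = carrier (S_star n V)"
proof
  show "H \<subseteq> carrier (S_star n V)" by (rule submoduleD(1)[OF module_S_star H])
  let ?K = "{t \<in> carrier TT. sym_image n V +>\<^bsub>TT\<^esub> t \<in> H}"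
  have K: "submodule ?K rat_ring TT"
    by (rule submodule_preimage[OF module_TT module_S_star lin_map_star H])
  have "carrier TT \<subseteq> ?K"
  proof (rule tensor_spanned[OF module_sym_power[OF V] V K])
    fix X y assume X: "X \<in> carrier (sym_power (n - 1) V)" and y: "y \<in> carrier V"
    note l = pure_tensor_lin_left[OF module_sym_power[OF V] V y]
    have "carrier (sym_power (n - 1) V) \<subseteq> {X \<in> carrier (sym_power (n - 1) V). pure_tensor (sym_power (n - 1) V) V X y \<in> ?K}"
    proof (rule sym_power_spanned[OF V submodule_preimage[OF module_sym_power[OF V] module_TT l K]])
      fix xs assume xs: "xs \<in> tuples (n - 1) V"
      show "sym_prod V xs \<in> {X \<in> carrier (sym_power (n - 1) V). pure_tensor (sym_power (n - 1) V) V X y \<in> ?K}"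
        using p[OF xs y] sym_prod_closed[OF V xs] star_class_closed[OF xs y]
        by (simp add: star_coset_def star_class_def)
    qed
    then show "pure_tensor (sym_power (n - 1) V) V X y \<in> ?K" using X by blast
  qed
  then show "carrier (S_star n V) \<subseteq> H" by (auto simp: S_star_eq carrier_quot_space)
qed

text \<open>The universal property of the quotient of \<open>Sym\<^sup>n\<^sup>-\<^sup>1 V \<otimes> V\<close>, by which functionals on it can be defined on
  generators. For a fixed second factor \<open>y\<close>, \<open>F\<close> extends to a linear map \<open>h y\<close> on the symmetric power. The
  elements \<open>X\<close> for which \<open>h y X\<close> is linear in \<open>y\<close> form a subspace which contains all products, hence are all
  of the symmetric power. So \<open>h\<close> is bilinear and extends to the tensor product; the hypothesis \<open>cyc\<close> says
  that this extension kills the image of \<open>Sym\<^sup>n V\<close>.\<close>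

lemma S_star_lift:
  assumes L: "module rat_ring L"
    and left: "\<And>xs ys y. length xs + Suc (length ys) = n - 1 \<Longrightarrow> set xs \<subseteq> carrier V \<Longrightarrow> set ys \<subseteq> carrier V \<Longrightarrow>
       y \<in> carrier V \<Longrightarrow> lin_map V L (\<lambda>x. F (xs @ x # ys) y)"
    and right: "\<And>xs. xs \<in> tuples (n - 1) V \<Longrightarrow> lin_map V L (F xs)"
    and perm: "\<And>xs ys y. xs \<in> tuples (n - 1) V \<Longrightarrow> mset xs = mset ys \<Longrightarrow> F xs y = F ys y"
    and cyc: "\<And>xs. xs \<in> tuples n V \<Longrightarrow>
       (\<Oplus>\<^bsub>L\<^esub>i\<in>{..<n}. F (take i xs @ drop (Suc i) xs) (xs ! i)) = \<zero>\<^bsub>L\<^esub>"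
  shows "\<exists>h. lin_map (S_star n V) L h \<and> (\<forall>xs\<in>tuples (n - 1) V. \<forall>y\<in>carrier V. h (star_coset n V xs y) = F xs y)"
proof -
  let ?S = "sym_power (n - 1) V"
  have "\<exists>h. lin_map ?S L h \<and> (\<forall>xs\<in>tuples (n - 1) V. h (sym_prod V xs) = F xs y)" if y: "y \<in> carrier V" for y
    by (rule sym_power_lift[OF V L left perm lin_mapD(1)[OF right y]]) (use y in auto)
  then obtain h where h: "\<And>y. y \<in> carrier V \<Longrightarrow> lin_map ?S L (h y)"
    "\<And>y xs. y \<in> carrier V \<Longrightarrow> xs \<in> tuples (n - 1) V \<Longrightarrow> h y (sym_prod V xs) = F xs y"
    by metis
  have hl: "lin_map V L (\<lambda>y. h y X)" if X: "X \<in> carrier ?S" for X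
  proof -
    interpret S: module rat_ring ?S by (rule module_sym_power[OF V])
    have sc: "z \<in> carrier ?S \<Longrightarrow> q \<odot>\<^bsub>?S\<^esub> z \<in> carrier ?S" for q z by (rule S.smult_closed) simp
    have "submodule {X \<in> carrier ?S. lin_map V L (\<lambda>y. h y X)} rat_ring ?S"
    proof (rule submoduleI_rat[OF module_sym_power[OF V]])
      have "lin_map V L (\<lambda>y. h y \<zero>\<^bsub>?S\<^esub>)"
        by (rule lin_map_cong[OF V lin_map_0[OF L]]) (rule lin_map_zero[OF module_sym_power[OF V] L h(1), symmetric])
      then show "\<zero>\<^bsub>?S\<^esub> \<in> {X \<in> carrier ?S. lin_map V L (\<lambda>y. h y X)}" by (simp del: One_nat_def)
      fix X Y assume "X \<in> {X \<in> carrier ?S. lin_map V L (\<lambda>y. h y X)}" "Y \<in> {X \<in> carrier ?S. lin_map V L (\<lambda>y. h y X)}"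
      then have X: "X \<in> carrier ?S" "lin_map V L (\<lambda>y. h y X)" and Y: "Y \<in> carrier ?S" "lin_map V L (\<lambda>y. h y Y)" by auto
      have "lin_map V L (\<lambda>y. h y (X \<oplus>\<^bsub>?S\<^esub> Y))"
        by (rule lin_map_cong[OF V lin_map_add[OF L X(2) Y(2)]]) (rule lin_mapD(2)[OF h(1) X(1) Y(1), symmetric])
      then show "X \<oplus>\<^bsub>?S\<^esub> Y \<in> {X \<in> carrier ?S. lin_map V L (\<lambda>y. h y X)}" using X Y by (simp del: One_nat_def)
    next
      fix q X assume "X \<in> {X \<in> carrier ?S. lin_map V L (\<lambda>y. h y X)}"
      then have X: "X \<in> carrier ?S" "lin_map V L (\<lambda>y. h y X)" by auto
      have "lin_map V L (\<lambda>y. h y (q \<odot>\<^bsub>?S\<^esub> X))"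
        by (rule lin_map_cong[OF V lin_map_smult[OF L X(2)]]) (rule lin_mapD(3)[OF h(1) X(1), symmetric])
      then show "q \<odot>\<^bsub>?S\<^esub> X \<in> {X \<in> carrier ?S. lin_map V L (\<lambda>y. h y X)}" using sc[OF X(1)] by (simp del: One_nat_def)
    qed auto
    then have "carrier ?S \<subseteq> {X \<in> carrier ?S. lin_map V L (\<lambda>y. h y X)}"
    proof (rule sym_power_spanned[OF V])
      fix xs assume xs: "xs \<in> tuples (n - 1) V"
      have "lin_map V L (\<lambda>y. h y (sym_prod V xs))"
        by (rule lin_map_cong[OF V right[OF xs]]) (rule h(2)[OF _ xs, symmetric])
      then show "sym_prod V xs \<in> {X \<in> carrier ?S. lin_map V L (\<lambda>y. h y X)}"
        using sym_prod_closed[OF V xs] by simp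
    qed
    then show ?thesis using X by blast
  qed
  obtain k where k: "lin_map TT L k" "\<And>X y. X \<in> carrier ?S \<Longrightarrow> y \<in> carrier V \<Longrightarrow> k (pure_tensor ?S V X y) = h y X"
    using tensor_lift[OF module_sym_power[OF V] V L, where B = "\<lambda>X y. h y X"] h(1) hl by blast
  have kF: "k (star_class n V xs y) = F xs y" if "xs \<in> tuples (n - 1) V" "y \<in> carrier V" for xs y
    unfolding star_class_def k(2)[OF sym_prod_closed[OF V that(1)] that(2)] h(2)[OF that(2,1)] ..
  have van: "k u = \<zero>\<^bsub>L\<^esub>" if u: "u \<in> sym_image n V" for u
  proof (rule lin_map_vanishes_on_span[OF module_TT L k(1)])
    show "u \<in> lin_span TT (cyclic_sum ` tuples n V)" using u by (simp add: sym_image_eq)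
    show "cyclic_sum ` tuples n V \<subseteq> carrier TT" using cyclic_sum_closed by auto
    fix t assume "t \<in> cyclic_sum ` tuples n V"
    then obtain xs where xs: "xs \<in> tuples n V" "t = cyclic_sum xs" by auto
    interpret L: module rat_ring L by (rule L)
    have "k t = (\<Oplus>\<^bsub>L\<^esub>i\<in>{..<n}. k (star_class n V (take i xs @ drop (Suc i) xs) (xs ! i)))"
      unfolding xs(2) cyclic_sum_def
      by (rule lin_map_finsum[OF module_TT L k(1)]) (use remove_nth_tuples[OF xs(1)] star_class_closed in auto)
    also have "\<dots> = (\<Oplus>\<^bsub>L\<^esub>i\<in>{..<n}. F (take i xs @ drop (Suc i) xs) (xs ! i))"
      by (rule L.finsum_cong') (use remove_nth_tuples[OF xs(1)] kF lin_mapD(1)[OF right] in auto)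
    finally show "k t = \<zero>\<^bsub>L\<^esub>" using cyc[OF xs(1)] by simp
  qed
  obtain g where g: "lin_map (S_star n V) L g" "\<And>t. t \<in> carrier TT \<Longrightarrow> g (sym_image n V +>\<^bsub>TT\<^esub> t) = k t"
    using quot_space_lift[OF module_TT submodule_sym_image L k(1) van] unfolding S_star_eq by blast
  have "g (star_coset n V xs y) = F xs y" if "xs \<in> tuples (n - 1) V" "y \<in> carrier V" for xs y
    unfolding star_coset_def g(2)[OF star_class_closed[OF that]] by (rule kF[OF that])
  then show ?thesis using g(1) by blast
qed

end

subsection \<open>Coordinates\<close>

abbreviation DS :: "nat \<Rightarrow> (rat, (complex \<Rightarrow>\<^sub>0 rat) sym_tensor set) module" where "DS n \<equiv> S_star n Div"

lemmas module_Div = module_free_space[of "UNIV :: complex set"]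
lemmas module_DS = module_S_star[OF module_Div]

text \<open>The tensor product of free spaces as the free space on pairs.\<close>

definition ptensor :: "('a \<Rightarrow>\<^sub>0 rat) \<Rightarrow> ('b \<Rightarrow>\<^sub>0 rat) \<Rightarrow> ('a \<times> 'b \<Rightarrow>\<^sub>0 rat)" where
  "ptensor x y = (\<Sum>a\<in>Poly_Mapping.keys x. \<Sum>b\<in>Poly_Mapping.keys y.
     Poly_Mapping.single (a, b) (Poly_Mapping.lookup x a * Poly_Mapping.lookup y b))"

lemma lookup_ptensor: "Poly_Mapping.lookup (ptensor x y) (a, b) = Poly_Mapping.lookup x a * Poly_Mapping.lookup y b"
proof -
  have "Poly_Mapping.lookup (ptensor x y) (a, b) = (\<Sum>a'\<in>Poly_Mapping.keys x. \<Sum>b'\<in>Poly_Mapping.keys y.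
     (if a' = a then if b' = b then Poly_Mapping.lookup x a' * Poly_Mapping.lookup y b' else 0 else 0))"
    by (simp add: ptensor_def lookup_sum lookup_single when_def) (intro sum.cong refl, auto)
  also have "\<dots> = (\<Sum>a'\<in>Poly_Mapping.keys x. if a' = a then (\<Sum>b'\<in>Poly_Mapping.keys y.
      if b' = b then Poly_Mapping.lookup x a' * Poly_Mapping.lookup y b' else 0) else 0)"
    by (intro sum.cong refl) auto
  also have "\<dots> = Poly_Mapping.lookup x a * Poly_Mapping.lookup y b"
    by (simp add: sum.delta in_keys_iff)
  finally show ?thesis .
qed

lemma poly_mapping_pair_eqI:
  "(\<And>a b. Poly_Mapping.lookup f (a, b) = Poly_Mapping.lookup g (a, b)) \<Longrightarrow> f = g"
  by (rule poly_mapping_eqI) auto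

lemma ptensor_simps:
  "ptensor (x + x') y = ptensor x y + ptensor x' y" "ptensor x (y + y') = ptensor x y + ptensor x y'"
  "ptensor (x - x') y = ptensor x y - ptensor x' y" "ptensor x (y - y') = ptensor x y - ptensor x y'"
  by (rule poly_mapping_pair_eqI; simp add: lookup_ptensor lookup_add lookup_minus algebra_simps)+

lemma ptensor_gen: "ptensor (gen a) (gen b) = gen (a, b)"
  by (rule poly_mapping_pair_eqI) (simp add: lookup_ptensor lookup_single when_def)

lemma ptensor_lin_left: "lin_map (free_space UNIV) (free_space UNIV) (\<lambda>x. ptensor x y)"
  by (rule lin_mapI) (auto simp: ptensor_simps intro!: poly_mapping_pair_eqI simp: lookup_ptensor)

lemma ptensor_lin_right: "lin_map (free_space UNIV) (free_space UNIV) (ptensor x)"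
  by (rule lin_mapI) (auto simp: ptensor_simps intro!: poly_mapping_pair_eqI simp: lookup_ptensor)

lemma lin_map_lookup: "lin_map (free_space S) rat_space (\<lambda>x. Poly_Mapping.lookup x k)"
  by (rule lin_mapI) (auto simp: lookup_add)

definition reindex :: "('a \<Rightarrow> 'b) \<Rightarrow> ('b \<Rightarrow>\<^sub>0 rat) \<Rightarrow> 'a \<Rightarrow>\<^sub>0 rat" where
  "reindex = Poly_Mapping.map_key"

lemma lookup_reindex: "inj f \<Longrightarrow> Poly_Mapping.lookup (reindex f p) k = Poly_Mapping.lookup p (f k)"
  by (simp add: reindex_def Poly_Mapping.map_key.rep_eq)

lemma lin_map_reindex: "inj f \<Longrightarrow> lin_map (free_space UNIV) (free_space UNIV) (reindex f)"
  by (rule lin_mapI) (auto intro!: poly_mapping_eqI simp: lookup_reindex lookup_add)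

lemma reindex_gen: "inj f \<Longrightarrow> reindex f (gen (f k)) = gen k"
  by (rule poly_mapping_eqI) (auto simp: lookup_reindex lookup_single when_def inj_eq)

lemma tuples_Div: "xs \<in> tuples k Div \<longleftrightarrow> length xs = k"
  by (auto simp: tuples_def)

text \<open>Linear maps from explicit free spaces onto the spaces \<open>S\<^sub>*\<^sup>1\<^sup>,\<^sup>1 A\<close> and \<open>S\<^sub>*\<^sup>2\<^sup>,\<^sup>1 A\<close>. They allow for
  computations with coordinates, at the price of not being injective.\<close>

definition basis2 :: "(complex \<times> complex \<Rightarrow>\<^sub>0 rat) \<Rightarrow> (complex \<Rightarrow>\<^sub>0 rat) sym_tensor set" where
  "basis2 = lin_extend (DS 2) (\<lambda>(a, b). star_coset 2 Div [gen a] (gen b))"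

definition basis3 :: "(complex \<times> complex \<times> complex \<Rightarrow>\<^sub>0 rat) \<Rightarrow> (complex \<Rightarrow>\<^sub>0 rat) sym_tensor set" where
  "basis3 = lin_extend (DS 3) (\<lambda>(a, b, c). star_coset 3 Div [gen a, gen b] (gen c))"

lemma star_closed: "length xs = n - 1 \<Longrightarrow> star_coset n Div xs y \<in> carrier (DS n)"
  by (rule star_coset_closed[OF module_Div]) (auto simp: tuples_Div)

lemma star2_left: "lin_map Div (DS 2) (\<lambda>x. star_coset 2 Div [x] y)"
  using star_coset_lin_left[OF module_Div, of "[]" "[]" 2 y] by simp

lemma star2_right: "lin_map Div (DS 2) (star_coset 2 Div [x])"
  by (rule star_coset_lin_right[OF module_Div]) (simp add: tuples_Div)

lemma star3_left: "lin_map Div (DS 3) (\<lambda>x. star_coset 3 Div [x, x'] y)"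
  using star_coset_lin_left[OF module_Div, of "[]" "[x']" 3 y] by simp

lemma star3_mid: "lin_map Div (DS 3) (\<lambda>x'. star_coset 3 Div [x, x'] y)"
  using star_coset_lin_left[OF module_Div, of "[x]" "[]" 3 y] by simp

lemma star3_right: "lin_map Div (DS 3) (star_coset 3 Div [x, x'])"
  by (rule star_coset_lin_right[OF module_Div]) (simp add: tuples_Div)

lemma lin_map_basis2: "lin_map (free_space UNIV) (DS 2) basis2"
  unfolding basis2_def by (rule lin_map_lin_extend[OF module_DS]) (auto intro!: star_closed)

lemma lin_map_basis3: "lin_map (free_space UNIV) (DS 3) basis3"
  unfolding basis3_def by (rule lin_map_lin_extend[OF module_DS]) (auto intro!: star_closed)

lemma basis2_gen: "basis2 (gen (a, b)) = star_coset 2 Div [gen a] (gen b)"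
  unfolding basis2_def by (subst lin_extend_gen[OF module_DS]) (auto intro!: star_closed)

lemma basis3_gen: "basis3 (gen (a, b, c)) = star_coset 3 Div [gen a, gen b] (gen c)"
  unfolding basis3_def by (subst lin_extend_gen[OF module_DS]) (auto intro!: star_closed)

lemma UNIV_carrier: "x \<in> carrier (free_space UNIV)"
  by simp

lemma basis2_ptensor: "basis2 (ptensor x y) = star_coset 2 Div [x] y"
proof (rule lin_map_eq_on_gens[OF module_DS lin_map_compose[OF ptensor_lin_left lin_map_basis2] star2_left _ UNIV_carrier])
  fix a
  show "basis2 (ptensor (gen a) y) = star_coset 2 Div [gen a] y"
    by (rule lin_map_eq_on_gens[OF module_DS lin_map_compose[OF ptensor_lin_right lin_map_basis2] star2_right _ UNIV_carrier])
       (simp only: ptensor_gen basis2_gen)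
qed

lemma basis3_ptensor: "basis3 (ptensor x (ptensor x' y)) = star_coset 3 Div [x, x'] y"
proof (rule lin_map_eq_on_gens[OF module_DS lin_map_compose[OF ptensor_lin_left lin_map_basis3] star3_left _ UNIV_carrier])
  fix a
  show "basis3 (ptensor (gen a) (ptensor x' y)) = star_coset 3 Div [gen a, x'] y"
  proof (rule lin_map_eq_on_gens[OF module_DS lin_map_compose[OF lin_map_compose[OF ptensor_lin_left ptensor_lin_right] lin_map_basis3] star3_mid _ UNIV_carrier])
    fix b
    show "basis3 (ptensor (gen a) (ptensor (gen b) y)) = star_coset 3 Div [gen a, gen b] y"
      by (rule lin_map_eq_on_gens[OF module_DS lin_map_compose[OF lin_map_compose[OF ptensor_lin_right ptensor_lin_right] lin_map_basis3] star3_right _ UNIV_carrier])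
         (simp only: ptensor_gen basis3_gen)
  qed
qed

lemma finsum_lessThan_2_3:
  assumes "module rat_ring M" "\<And>i. f i \<in> carrier M"
  shows "(\<Oplus>\<^bsub>M\<^esub>i\<in>{..<2::nat}. f i) = f 0 \<oplus>\<^bsub>M\<^esub> f 1"
    and "(\<Oplus>\<^bsub>M\<^esub>i\<in>{..<3::nat}. f i) = f 0 \<oplus>\<^bsub>M\<^esub> (f 1 \<oplus>\<^bsub>M\<^esub> f 2)"
proof -
  interpret M: module rat_ring M by fact
  have "{..<2} = {0, 1::nat}" "{..<3} = {0, 1, 2::nat}" by auto
  then show "(\<Oplus>\<^bsub>M\<^esub>i\<in>{..<2::nat}. f i) = f 0 \<oplus>\<^bsub>M\<^esub> f 1"
    and "(\<Oplus>\<^bsub>M\<^esub>i\<in>{..<3::nat}. f i) = f 0 \<oplus>\<^bsub>M\<^esub> (f 1 \<oplus>\<^bsub>M\<^esub> f 2)"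
    using assms(2) by (simp_all add: M.finsum_insert)
qed

lemma star2_cyclic: "star_coset 2 Div [y] x \<oplus>\<^bsub>DS 2\<^esub> star_coset 2 Div [x] y = \<zero>\<^bsub>DS 2\<^esub>"
proof -
  define f where "f i = star_coset 2 Div (if i = 0 then [y] else [x]) ([x, y] ! i)" for i
  have "(\<Oplus>\<^bsub>DS 2\<^esub>i\<in>{..<2}. star_coset 2 Div (take i [x, y] @ drop (Suc i) [x, y]) ([x, y] ! i)) = \<zero>\<^bsub>DS 2\<^esub>"
    by (rule star_coset_cyclic[OF module_Div]) (simp add: tuples_Div)
  also have "(\<Oplus>\<^bsub>DS 2\<^esub>i\<in>{..<2}. star_coset 2 Div (take i [x, y] @ drop (Suc i) [x, y]) ([x, y] ! i)) = (\<Oplus>\<^bsub>DS 2\<^esub>i\<in>{..<2}. f i)"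
    by (rule abelian_monoid.finsum_cong'[OF abelian_group.axioms(1)[OF module.axioms(2)[OF module_DS]] refl])
       (auto simp: f_def less_2_cases_iff intro!: star_closed)
  also have "\<dots> = f 0 \<oplus>\<^bsub>DS 2\<^esub> f 1"
    by (rule finsum_lessThan_2_3(1)[OF module_DS]) (auto simp: f_def intro!: star_closed)
  finally show ?thesis by (simp add: f_def)
qed

lemma star3_cyclic: "star_coset 3 Div [y, z] x \<oplus>\<^bsub>DS 3\<^esub> (star_coset 3 Div [x, z] y \<oplus>\<^bsub>DS 3\<^esub> star_coset 3 Div [x, y] z) = \<zero>\<^bsub>DS 3\<^esub>"
proof -
  define f where "f i = star_coset 3 Div (if i = 0 then [y, z] else if i = 1 then [x, z] else [x, y]) ([x, y, z] ! i)" for i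
  have three: "i < 3 \<Longrightarrow> i = 0 \<or> i = 1 \<or> i = 2" for i :: nat by auto
  have "(\<Oplus>\<^bsub>DS 3\<^esub>i\<in>{..<3}. star_coset 3 Div (take i [x, y, z] @ drop (Suc i) [x, y, z]) ([x, y, z] ! i)) = \<zero>\<^bsub>DS 3\<^esub>"
    by (rule star_coset_cyclic[OF module_Div]) (simp add: tuples_Div)
  also have "(\<Oplus>\<^bsub>DS 3\<^esub>i\<in>{..<3}. star_coset 3 Div (take i [x, y, z] @ drop (Suc i) [x, y, z]) ([x, y, z] ! i)) = (\<Oplus>\<^bsub>DS 3\<^esub>i\<in>{..<3}. f i)"
    by (rule abelian_monoid.finsum_cong'[OF abelian_group.axioms(1)[OF module.axioms(2)[OF module_DS]] refl])
       (auto simp: f_def dest!: three intro!: star_closed)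
  also have "\<dots> = f 0 \<oplus>\<^bsub>DS 3\<^esub> (f 1 \<oplus>\<^bsub>DS 3\<^esub> f 2)"
    by (rule finsum_lessThan_2_3(2)[OF module_DS]) (auto simp: f_def intro!: star_closed)
  finally show ?thesis by (simp add: f_def)
qed

lemma star3_swap: "star_coset 3 Div [x, y] z = star_coset 3 Div [y, x] z"
  by (rule star_coset_perm[OF module_Div]) (auto simp: tuples_Div)

lemma rat_torsion_free:
  assumes M: "module rat_ring M" and x: "x \<in> carrier M" and q: "q \<noteq> 0" "q \<odot>\<^bsub>M\<^esub> x = \<zero>\<^bsub>M\<^esub>"
  shows "x = \<zero>\<^bsub>M\<^esub>"
proof -
  interpret M: module rat_ring M by fact
  have "x = (inverse q * q) \<odot>\<^bsub>M\<^esub> x" using q M.smult_one[OF x] by simp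
  also have "\<dots> = inverse q \<odot>\<^bsub>M\<^esub> (q \<odot>\<^bsub>M\<^esub> x)" using M.smult_assoc1[of "inverse q" q x] x by simp
  also have "\<dots> = \<zero>\<^bsub>M\<^esub>" using q M.smult_r_null[of "inverse q"] by simp
  finally show ?thesis .
qed

lemma add_self: "module rat_ring M \<Longrightarrow> x \<in> carrier M \<Longrightarrow> x \<oplus>\<^bsub>M\<^esub> x = 2 \<odot>\<^bsub>M\<^esub> x"
  and add_self3: "module rat_ring M \<Longrightarrow> x \<in> carrier M \<Longrightarrow> x \<oplus>\<^bsub>M\<^esub> (x \<oplus>\<^bsub>M\<^esub> x) = 3 \<odot>\<^bsub>M\<^esub> x"
proof -
  assume M: "module rat_ring M" and x: "x \<in> carrier M"
  interpret M: module rat_ring M by fact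
  have one: "1 \<odot>\<^bsub>M\<^esub> x = x" using M.smult_one[OF x] by simp
  show 2: "x \<oplus>\<^bsub>M\<^esub> x = 2 \<odot>\<^bsub>M\<^esub> x" using M.smult_l_distr[of 1 1 x] x one by simp
  show "x \<oplus>\<^bsub>M\<^esub> (x \<oplus>\<^bsub>M\<^esub> x) = 3 \<odot>\<^bsub>M\<^esub> x" unfolding 2 using M.smult_l_distr[of 1 2 x] x one by simp
qed

text \<open>The defining relation \<open>[a] \<otimes> [b] + [b] \<otimes> [a] = 0\<close> shows that \<open>basis2\<close> takes opposite values on \<open>m\<close> and on its
  transpose. For symmetric \<open>m\<close> this gives \<open>2 basis2 m = 0\<close>.\<close>

lemma basis2_symmetric_eq_0:
  assumes "\<And>a b. Poly_Mapping.lookup m (a, b) = Poly_Mapping.lookup m (b, a)"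
  shows "basis2 m = \<zero>\<^bsub>DS 2\<^esub>"
proof -
  let ?s = "\<lambda>(a, b). (b, a :: complex) :: complex \<times> complex"
  have s: "inj ?s" by (auto simp: inj_def)
  have "basis2 m \<oplus>\<^bsub>DS 2\<^esub> basis2 (reindex ?s m) = \<zero>\<^bsub>DS 2\<^esub>"
  proof (rule lin_map_eq_on_gens[OF module_DS lin_map_add[OF module_DS lin_map_basis2 lin_map_compose[OF lin_map_reindex[OF s] lin_map_basis2]] lin_map_0[OF module_DS] _ UNIV_carrier])
    fix k :: "complex \<times> complex"
    obtain a b where k: "k = (a, b)" by (cases k)
    have "reindex ?s (gen k) = gen (b, a)" using reindex_gen[OF s, of "(b, a)"] by (simp add: k)
    then show "basis2 (gen k) \<oplus>\<^bsub>DS 2\<^esub> basis2 (reindex ?s (gen k)) = \<zero>\<^bsub>DS 2\<^esub>"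
      by (simp only: k basis2_gen star2_cyclic)
  qed
  moreover have "reindex ?s m = m"
    by (rule poly_mapping_pair_eqI) (simp add: lookup_reindex[OF s] assms[of b a for a b])
  moreover have c: "basis2 m \<in> carrier (DS 2)" by (rule lin_mapD(1)[OF lin_map_basis2 UNIV_carrier])
  ultimately have "2 \<odot>\<^bsub>DS 2\<^esub> basis2 m = \<zero>\<^bsub>DS 2\<^esub>" using add_self[OF module_DS c] by simp
  then show ?thesis by (intro rat_torsion_free[OF module_DS c, of 2]) auto
qed

text \<open>The values of \<open>basis3\<close> on the three cyclic rotations of \<open>m\<close> add up to \<open>0\<close>, by the defining relation
  and the symmetry of the first two factors. For \<open>m\<close>
  invariant under rotation this gives \<open>3 basis3 m = 0\<close>.\<close>

lemma basis3_symmetric_eq_0: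
  assumes "\<And>a b c. Poly_Mapping.lookup m (a, b, c) = Poly_Mapping.lookup m (b, c, a)"
  shows "basis3 m = \<zero>\<^bsub>DS 3\<^esub>"
proof -
  let ?r = "\<lambda>(a, b, c). (b, c, a :: complex) :: complex \<times> complex \<times> complex"
  let ?t = "\<lambda>(a, b, c). (c, a, b) :: complex \<times> complex \<times> complex"
  have r: "inj ?r" and t: "inj ?t" by (auto simp: inj_def)
  have "basis3 m \<oplus>\<^bsub>DS 3\<^esub> (basis3 (reindex ?r m) \<oplus>\<^bsub>DS 3\<^esub> basis3 (reindex ?t m)) = \<zero>\<^bsub>DS 3\<^esub>"
  proof (rule lin_map_eq_on_gens[OF module_DS lin_map_add[OF module_DS lin_map_basis3 lin_map_add[OF module_DS
          lin_map_compose[OF lin_map_reindex[OF r] lin_map_basis3] lin_map_compose[OF lin_map_reindex[OF t] lin_map_basis3]]]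
          lin_map_0[OF module_DS] _ UNIV_carrier])
    fix k :: "complex \<times> complex \<times> complex"
    obtain a b c where k: "k = (a, b, c)" by (cases k)
    have "reindex ?r (gen k) = gen (c, a, b)" "reindex ?t (gen k) = gen (b, c, a)"
      using reindex_gen[OF r, of "(c, a, b)"] reindex_gen[OF t, of "(b, c, a)"] by (simp_all add: k)
    moreover have "star_coset 3 Div [gen c, gen b] (gen a) \<oplus>\<^bsub>DS 3\<^esub> star_coset 3 Div [gen c, gen a] (gen b) =
        star_coset 3 Div [gen c, gen a] (gen b) \<oplus>\<^bsub>DS 3\<^esub> star_coset 3 Div [gen b, gen c] (gen a)"
      unfolding star3_swap[of "gen c" "gen b"]
      by (rule abelian_monoid.a_comm[OF abelian_group.axioms(1)[OF module.axioms(2)[OF module_DS]]]) (auto intro!: star_closed)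
    ultimately show "basis3 (gen k) \<oplus>\<^bsub>DS 3\<^esub> (basis3 (reindex ?r (gen k)) \<oplus>\<^bsub>DS 3\<^esub> basis3 (reindex ?t (gen k))) = \<zero>\<^bsub>DS 3\<^esub>"
      using star3_cyclic[of "gen a" "gen b" "gen c"] by (simp only: k basis3_gen)
  qed
  moreover have "reindex ?r m = m"
    by (rule poly_mapping_eqI) (auto simp: lookup_reindex[OF r] assms[symmetric])
  moreover have "reindex ?t m = m"
    by (rule poly_mapping_eqI) (auto simp: lookup_reindex[OF t] assms)
  moreover have c: "basis3 m \<in> carrier (DS 3)" by (rule lin_mapD(1)[OF lin_map_basis3 UNIV_carrier])
  ultimately have "3 \<odot>\<^bsub>DS 3\<^esub> basis3 m = \<zero>\<^bsub>DS 3\<^esub>" using add_self3[OF module_DS c] by simp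
  then show ?thesis by (intro rat_torsion_free[OF module_DS c, of 3]) auto
qed

section \<open>The maps \<open>J\<^sub>n\<close>, their kernels and their images\<close>

text \<open>With both divisors \<open>0\<close> at \<open>\<phi> = 0\<close> and \<open>\<phi> = 1\<close>, the formula \<open>(\<phi>)\<^sup>n\<^sup>-\<^sup>1 \<otimes> (1 - \<phi>)\<close> for \<open>J\<^sub>n\<close> includes
  the conventions for these two functions.\<close>

definition div_num :: "ratfun \<Rightarrow> complex \<Rightarrow>\<^sub>0 rat" where
  "div_num \<phi> = (if \<phi> = 0 \<or> \<phi> = 1 then 0 else divisor \<phi>)"

definition div_one_minus :: "ratfun \<Rightarrow> complex \<Rightarrow>\<^sub>0 rat" where
  "div_one_minus \<phi> = (if \<phi> = 0 \<or> \<phi> = 1 then 0 else divisor (1 - \<phi>))"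

lemma J_eq: "J n = lin_extend (DS n) (\<lambda>\<phi>. star_coset n Div (replicate (n - 1) (div_num \<phi>)) (div_one_minus \<phi>))"
proof -
  have z: "star_coset n Div xs 0 = \<zero>\<^bsub>DS n\<^esub>" if "length xs = n - 1" for xs
    using lin_map_zero[OF module_Div module_DS star_coset_lin_right[OF module_Div, of xs n]] that
    by (simp add: tuples_Div)
  show ?thesis unfolding J_def
    by (rule arg_cong[where f = "lin_extend (DS n)"], rule ext)
       (simp add: div_num_def div_one_minus_def z star_coset_def[symmetric] star_class_def[symmetric] del: One_nat_def)
qed

lemma lin_map_J: "lin_map QCt (DS n) (J n)"
  unfolding J_eq by (rule lin_map_lin_extend[OF module_DS]) (auto intro!: star_closed)

lemma J_gen: "J n (gen \<phi>) = star_coset n Div (replicate (n - 1) (div_num \<phi>)) (div_one_minus \<phi>)"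
  unfolding J_eq by (rule lin_extend_gen[OF module_DS]) (auto intro!: star_closed)

lemma lin_map_J1: "lin_map QCt Div J1"
  unfolding J1_def by (rule lin_map_lin_extend[OF module_Div]) auto

lemma J1_gen: "J1 (gen \<phi>) = div_num \<phi>"
  unfolding J1_def div_num_def by (rule lin_extend_gen[OF module_Div]) auto

lemma lookup_lin_extend:
  assumes "x \<in> carrier (free_space UNIV)"
  shows "Poly_Mapping.lookup (lin_extend (free_space UNIV) f x) k
     = (\<Sum>s\<in>Poly_Mapping.keys x. Poly_Mapping.lookup x s * Poly_Mapping.lookup (f s) k)"
proof -
  have "Poly_Mapping.lookup (lin_extend (free_space UNIV) f x) k =
    (\<Oplus>\<^bsub>rat_space\<^esub>s\<in>Poly_Mapping.keys x. Poly_Mapping.lookup (Poly_Mapping.map ((*) (Poly_Mapping.lookup x s)) (f s)) k)"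
    unfolding lin_extend_def
    by (subst lin_map_finsum[OF module_free_space module_rat_space lin_map_lookup]) auto
  then show ?thesis by (simp add: finsum_rat_space)
qed

lemma lookup_J1: "Poly_Mapping.lookup (J1 x) k = (\<Sum>\<phi>\<in>Poly_Mapping.keys x. Poly_Mapping.lookup x \<phi> * Poly_Mapping.lookup (div_num \<phi>) k)"
  unfolding J1_def by (subst lookup_lin_extend) (auto simp: div_num_def[symmetric])

text \<open>Lifts of \<open>J\<^sub>2\<close> and \<open>J\<^sub>3\<close> along \<open>basis2\<close> and \<open>basis3\<close>.\<close>

definition coords2 :: "(ratfun \<Rightarrow>\<^sub>0 rat) \<Rightarrow> complex \<times> complex \<Rightarrow>\<^sub>0 rat" where
  "coords2 = lin_extend (free_space UNIV) (\<lambda>\<phi>. ptensor (div_num \<phi>) (div_one_minus \<phi>))"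

definition coords3 :: "(ratfun \<Rightarrow>\<^sub>0 rat) \<Rightarrow> complex \<times> complex \<times> complex \<Rightarrow>\<^sub>0 rat" where
  "coords3 = lin_extend (free_space UNIV) (\<lambda>\<phi>. ptensor (div_num \<phi>) (ptensor (div_num \<phi>) (div_one_minus \<phi>)))"

lemma lookup_coords2: "Poly_Mapping.lookup (coords2 x) (a, b) = (\<Sum>\<phi>\<in>Poly_Mapping.keys x. Poly_Mapping.lookup x \<phi> *
    (Poly_Mapping.lookup (div_num \<phi>) a * Poly_Mapping.lookup (div_one_minus \<phi>) b))"
  unfolding coords2_def by (subst lookup_lin_extend) (auto simp: lookup_ptensor)

lemma lookup_coords3: "Poly_Mapping.lookup (coords3 x) (a, b, c) = (\<Sum>\<phi>\<in>Poly_Mapping.keys x. Poly_Mapping.lookup x \<phi> *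
    (Poly_Mapping.lookup (div_num \<phi>) a * (Poly_Mapping.lookup (div_num \<phi>) b * Poly_Mapping.lookup (div_one_minus \<phi>) c)))"
  unfolding coords3_def by (subst lookup_lin_extend) (auto simp: lookup_ptensor)

lemma lin_map_coords2: "lin_map QCt (free_space UNIV) coords2"
  unfolding coords2_def by (rule lin_map_lin_extend[OF module_free_space]) auto

lemma lin_map_coords3: "lin_map QCt (free_space UNIV) coords3"
  unfolding coords3_def by (rule lin_map_lin_extend[OF module_free_space]) auto

lemma coords2_gen: "coords2 (gen \<phi>) = ptensor (div_num \<phi>) (div_one_minus \<phi>)"
  unfolding coords2_def by (rule lin_extend_gen[OF module_free_space]) auto

lemma coords3_gen: "coords3 (gen \<phi>) = ptensor (div_num \<phi>) (ptensor (div_num \<phi>) (div_one_minus \<phi>))"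
  unfolding coords3_def by (rule lin_extend_gen[OF module_free_space]) auto

lemma J2_eq_basis2: "J 2 x = basis2 (coords2 x)"
  by (rule lin_map_eq_on_gens[OF module_DS lin_map_J lin_map_compose[OF lin_map_coords2 lin_map_basis2] _ UNIV_carrier])
     (simp add: J_gen coords2_gen basis2_ptensor)

lemma J3_eq_basis3: "J 3 x = basis3 (coords3 x)"
  by (rule lin_map_eq_on_gens[OF module_DS lin_map_J lin_map_compose[OF lin_map_coords3 lin_map_basis3] _ UNIV_carrier])
     (simp add: J_gen coords3_gen basis3_ptensor numeral_2_eq_2)

lemma append_eq_1: "length xs + Suc (length ys) = 2 - 1 \<Longrightarrow> xs = [] \<and> ys = []"
  by simp

lemma append_eq_2: "length xs + Suc (length ys) = 3 - 1 \<Longrightarrow> (\<exists>z. xs = [] \<and> ys = [z]) \<or> (\<exists>z. xs = [z] \<and> ys = [])"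
  by (cases xs; cases ys) auto

text \<open>These functionals detect every antisymmetric part of the coordinates.\<close>

lemma antisymmetric_functional:
  "\<exists>h. lin_map (DS 2) rat_space h \<and> (\<forall>x y. h (star_coset 2 Div [x] y) =
      Poly_Mapping.lookup x a * Poly_Mapping.lookup y b - Poly_Mapping.lookup x b * Poly_Mapping.lookup y a)"
proof -
  let ?l = Poly_Mapping.lookup
  define F where "F xs y = ?l (hd xs) a * ?l y b - ?l (hd xs) b * ?l y a" for xs and y :: "complex \<Rightarrow>\<^sub>0 rat"
  have "\<exists>h. lin_map (S_star 2 Div) rat_space h \<and> (\<forall>xs\<in>tuples (2 - 1) Div. \<forall>y\<in>carrier Div. h (star_coset 2 Div xs y) = F xs y)"
  proof (rule S_star_lift[OF module_Div module_rat_space])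
    fix xs ys :: "(complex \<Rightarrow>\<^sub>0 rat) list" and y :: "complex \<Rightarrow>\<^sub>0 rat"
    assume "length xs + Suc (length ys) = 2 - 1"
    then have "xs = []" "ys = []" using append_eq_1 by blast+
    then show "lin_map Div rat_space (\<lambda>x. F (xs @ x # ys) y)"
      by (intro lin_mapI) (auto simp: F_def lookup_add algebra_simps)
  next
    fix xs :: "(complex \<Rightarrow>\<^sub>0 rat) list"
    show "lin_map Div rat_space (F xs)"
      by (intro lin_mapI) (auto simp: F_def lookup_add algebra_simps)
  next
    fix xs ys :: "(complex \<Rightarrow>\<^sub>0 rat) list" and y
    assume "xs \<in> tuples (2 - 1) Div" "mset xs = mset ys"
    then have "length xs = 1" "length ys = 1" "mset xs = mset ys" by (auto simp: tuples_Div dest: mset_eq_length)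
    then have "xs = ys" by (auto simp: length_Suc_conv)
    then show "F xs y = F ys y" by simp
  next
    fix xs :: "(complex \<Rightarrow>\<^sub>0 rat) list"
    assume "xs \<in> tuples 2 Div"
    then obtain u v where xs: "xs = [u, v]" by (auto simp: tuples_Div length_Suc_conv numeral_2_eq_2)
    show "(\<Oplus>\<^bsub>rat_space\<^esub>i\<in>{..<2}. F (take i xs @ drop (Suc i) xs) (xs ! i)) = \<zero>\<^bsub>rat_space\<^esub>"
      by (simp add: finsum_rat_space numeral_2_eq_2 lessThan_Suc xs F_def)
  qed
  then obtain h where h: "lin_map (DS 2) rat_space h" "\<forall>xs\<in>tuples (2 - 1) Div. \<forall>y\<in>carrier Div. h (star_coset 2 Div xs y) = F xs y"
    by blast
  have "h (star_coset 2 Div [x] y) = ?l x a * ?l y b - ?l x b * ?l y a" for x y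
    using h(2)[rule_format, of "[x]" y] by (simp add: tuples_Div F_def)
  then show ?thesis using h(1) by blast
qed

text \<open>Symmetrisation in the first two factors followed by antisymmetrisation in \<open>b\<close> and \<open>c\<close>, that is, a
  coordinate of the projection to the hook shape \<open>(2, 1)\<close>. It is \<open>0\<close> on the symmetrisation of every product, which is the
  condition for passing to \<open>S\<^sub>*\<^sup>2\<^sup>,\<^sup>1\<close>.\<close>

lemma hook_functional:
  "\<exists>h. lin_map (DS 3) rat_space h \<and> (\<forall>x x' y. h (star_coset 3 Div [x, x'] y) =
      (Poly_Mapping.lookup x a * Poly_Mapping.lookup x' b + Poly_Mapping.lookup x b * Poly_Mapping.lookup x' a) * Poly_Mapping.lookup y c
    - (Poly_Mapping.lookup x a * Poly_Mapping.lookup x' c + Poly_Mapping.lookup x c * Poly_Mapping.lookup x' a) * Poly_Mapping.lookup y b)"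
proof -
  let ?l = Poly_Mapping.lookup
  define F where "F xs y = (?l (xs ! 0) a * ?l (xs ! 1) b + ?l (xs ! 0) b * ?l (xs ! 1) a) * ?l y c
    - (?l (xs ! 0) a * ?l (xs ! 1) c + ?l (xs ! 0) c * ?l (xs ! 1) a) * ?l y b" for xs and y :: "complex \<Rightarrow>\<^sub>0 rat"
  have "\<exists>h. lin_map (S_star 3 Div) rat_space h \<and> (\<forall>xs\<in>tuples (3 - 1) Div. \<forall>y\<in>carrier Div. h (star_coset 3 Div xs y) = F xs y)"
  proof (rule S_star_lift[OF module_Div module_rat_space])
    fix xs ys :: "(complex \<Rightarrow>\<^sub>0 rat) list" and y :: "complex \<Rightarrow>\<^sub>0 rat"
    assume "length xs + Suc (length ys) = 3 - 1"
    then consider z where "xs = []" "ys = [z]" | z where "xs = [z]" "ys = []" using append_eq_2 by blast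
    then show "lin_map Div rat_space (\<lambda>x. F (xs @ x # ys) y)"
      by cases (intro lin_mapI; simp add: F_def lookup_add algebra_simps)+
  next
    fix xs :: "(complex \<Rightarrow>\<^sub>0 rat) list"
    show "lin_map Div rat_space (F xs)"
      by (intro lin_mapI) (auto simp: F_def lookup_add algebra_simps)
  next
    fix xs ys :: "(complex \<Rightarrow>\<^sub>0 rat) list" and y
    assume "xs \<in> tuples (3 - 1) Div" "mset xs = mset ys"
    then have "length xs = 2" "length ys = 2" and m: "mset xs = mset ys" by (auto simp: tuples_Div dest: mset_eq_length)
    then obtain u v u' v' where xy: "xs = [u, v]" "ys = [u', v']" by (auto simp: length_Suc_conv numeral_2_eq_2)
    then have "u = u' \<and> v = v' \<or> u = v' \<and> v = u'" using m by (auto simp: add_eq_conv_ex)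
    then show "F xs y = F ys y" by (auto simp: xy F_def algebra_simps)
  next
    fix xs :: "(complex \<Rightarrow>\<^sub>0 rat) list"
    assume "xs \<in> tuples 3 Div"
    then obtain u v w where xs: "xs = [u, v, w]" by (auto simp: tuples_Div length_Suc_conv numeral_3_eq_3)
    show "(\<Oplus>\<^bsub>rat_space\<^esub>i\<in>{..<3}. F (take i xs @ drop (Suc i) xs) (xs ! i)) = \<zero>\<^bsub>rat_space\<^esub>"
      by (simp add: finsum_rat_space numeral_3_eq_3 lessThan_Suc xs F_def) (simp add: algebra_simps)
  qed
  then obtain h where h: "lin_map (DS 3) rat_space h" "\<forall>xs\<in>tuples (3 - 1) Div. \<forall>y\<in>carrier Div. h (star_coset 3 Div xs y) = F xs y"
    by blast
  have "h (star_coset 3 Div [x, x'] y) = F [x, x'] y" for x x' y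
    using h(2)[rule_format, of "[x, x']" y] by (simp add: tuples_Div)
  then show ?thesis using h(1) by (auto simp: F_def)
qed

lemma lin_map_lookup_diff: "lin_map (free_space UNIV) rat_space (\<lambda>x. r * (Poly_Mapping.lookup x k - Poly_Mapping.lookup x l))"
  by (rule lin_mapI) (auto simp: lookup_add algebra_simps)

lemma J2_eq_0_iff:
  "J 2 x = \<zero>\<^bsub>DS 2\<^esub> \<longleftrightarrow> (\<forall>a b. Poly_Mapping.lookup (coords2 x) (a, b) = Poly_Mapping.lookup (coords2 x) (b, a))"
proof
  assume J: "J 2 x = \<zero>\<^bsub>DS 2\<^esub>"
  show "\<forall>a b. Poly_Mapping.lookup (coords2 x) (a, b) = Poly_Mapping.lookup (coords2 x) (b, a)"
  proof (intro allI)
    fix a b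
    obtain h where h: "lin_map (DS 2) rat_space h" "\<And>x y. h (star_coset 2 Div [x] y) =
      Poly_Mapping.lookup x a * Poly_Mapping.lookup y b - Poly_Mapping.lookup x b * Poly_Mapping.lookup y a"
      using antisymmetric_functional by blast
    have "h (J 2 x) = 1 * (Poly_Mapping.lookup (coords2 x) (a, b) - Poly_Mapping.lookup (coords2 x) (b, a))"
      by (rule lin_map_eq_on_gens[OF module_rat_space lin_map_compose[OF lin_map_J h(1)]
            lin_map_compose[OF lin_map_coords2 lin_map_lookup_diff] _ UNIV_carrier])
         (simp add: J_gen coords2_gen h(2) lookup_ptensor)
    then show "Poly_Mapping.lookup (coords2 x) (a, b) = Poly_Mapping.lookup (coords2 x) (b, a)"
      using lin_map_zero[OF module_DS module_rat_space h(1)] J by simp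
  qed
qed (auto simp: J2_eq_basis2 intro!: basis2_symmetric_eq_0)

lemma coords3_swap: "Poly_Mapping.lookup (coords3 x) (a, b, c) = Poly_Mapping.lookup (coords3 x) (b, a, c)"
  by (simp add: lookup_coords3 mult.left_commute)

text \<open>The coordinates are symmetric in the first two arguments by construction. So symmetry in the last two
  makes them totally symmetric, in particular invariant under rotation.\<close>

lemma J3_eq_0_iff:
  "J 3 x = \<zero>\<^bsub>DS 3\<^esub> \<longleftrightarrow> (\<forall>a b c. Poly_Mapping.lookup (coords3 x) (a, b, c) = Poly_Mapping.lookup (coords3 x) (a, c, b))"
proof
  assume J: "J 3 x = \<zero>\<^bsub>DS 3\<^esub>"
  show "\<forall>a b c. Poly_Mapping.lookup (coords3 x) (a, b, c) = Poly_Mapping.lookup (coords3 x) (a, c, b)"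
  proof (intro allI)
    fix a b c
    obtain h where h: "lin_map (DS 3) rat_space h" "\<And>x x' y. h (star_coset 3 Div [x, x'] y) =
      (Poly_Mapping.lookup x a * Poly_Mapping.lookup x' b + Poly_Mapping.lookup x b * Poly_Mapping.lookup x' a) * Poly_Mapping.lookup y c
    - (Poly_Mapping.lookup x a * Poly_Mapping.lookup x' c + Poly_Mapping.lookup x c * Poly_Mapping.lookup x' a) * Poly_Mapping.lookup y b"
      using hook_functional by blast
    have "h (J 3 x) = 2 * (Poly_Mapping.lookup (coords3 x) (a, b, c) - Poly_Mapping.lookup (coords3 x) (a, c, b))"
      by (rule lin_map_eq_on_gens[OF module_rat_space lin_map_compose[OF lin_map_J h(1)]
            lin_map_compose[OF lin_map_coords3 lin_map_lookup_diff] _ UNIV_carrier])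
         (simp add: J_gen coords3_gen h(2) lookup_ptensor numeral_2_eq_2 algebra_simps)
    then show "Poly_Mapping.lookup (coords3 x) (a, b, c) = Poly_Mapping.lookup (coords3 x) (a, c, b)"
      using lin_map_zero[OF module_DS module_rat_space h(1)] J by simp
  qed
next
  assume s: "\<forall>a b c. Poly_Mapping.lookup (coords3 x) (a, b, c) = Poly_Mapping.lookup (coords3 x) (a, c, b)"
  have "Poly_Mapping.lookup (coords3 x) (a, b, c) = Poly_Mapping.lookup (coords3 x) (b, c, a)" for a b c
    using s coords3_swap by metis
  then show "J 3 x = \<zero>\<^bsub>DS 3\<^esub>" unfolding J3_eq_basis3 by (rule basis3_symmetric_eq_0)
qed

lemma poly_divisor_linear: "k \<noteq> 0 \<Longrightarrow> poly_divisor (Polynomial.smult k [:- a, 1:]) = gen a"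
proof (rule poly_mapping_eqI)
  fix b assume k: "k \<noteq> 0"
  have "Polynomial.order b [:- a, 1:] = (if a = b then 1 else 0)"
    using order_power_n_n[of a 1] by (auto simp: order_0I)
  then show "Poly_Mapping.lookup (poly_divisor (Polynomial.smult k [:- a, 1:])) b = Poly_Mapping.lookup (gen a) b"
    using k by (subst lookup_poly_divisor) (auto simp: order_smult lookup_single when_def simp del: smult_pCons)
qed

lemma poly_divisor_1: "poly_divisor 1 = 0"
  by (simp add: poly_divisor_def)

lemma unit_factor_linear: "unit_factor [:- a, 1 :: complex:] = 1"
  by (simp add: unit_factor_poly_def)

lemma J1_surj: "J1 ` carrier QCt = carrier Div"
proof -
  have "gen a \<in> J1 ` carrier QCt" for a
  proof -
    define \<phi> where "\<phi> = to_fract [:- a, 1 :: complex:]"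
    have nd: "numer \<phi> = [:- a, 1:]" "denom \<phi> = 1" by (simp_all add: \<phi>_def numer_def denom_def)
    have "\<phi> \<noteq> 0" "\<phi> \<noteq> 1" by (simp_all add: \<phi>_def flip: to_fract_0 to_fract_1) (simp add: one_pCons)
    then have "J1 (gen \<phi>) = gen a"
      using poly_divisor_linear[of 1 a] by (simp add: J1_gen div_num_def divisor_def nd poly_divisor_1)
    then show ?thesis by (metis UNIV_carrier image_eqI)
  qed
  then show ?thesis
    using free_space_spanned[OF submodule_image[OF module_free_space module_Div lin_map_J1]] lin_mapD(1)[OF lin_map_J1]
    by blast
qed

text \<open>The function \<open>(t - a) / (b - a)\<close>, which takes the value \<open>0\<close> at \<open>a\<close> and \<open>1\<close> at \<open>b\<close>.\<close>

lemma affine_ratfun: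
  assumes "a \<noteq> b"
  obtains \<phi> where "div_num \<phi> = gen a" "div_one_minus \<phi> = gen b"
proof -
  define p where "p = Polynomial.smult (1 / (b - a)) [:- a, 1 :: complex:]"
  define \<phi> where "\<phi> = Fract p 1"
  have nd: "numer \<phi> = p" "denom \<phi> = 1" using numer_denom_Fract[of p 1] by (simp_all add: \<phi>_def)
  have q: "1 - p = Polynomial.smult (1 / (a - b)) [:- b, 1:]"
    using assms by (simp add: p_def one_pCons divide_simps) (simp add: algebra_simps)
  have "p \<noteq> 0" "p \<noteq> 1" using assms by (auto simp: p_def one_pCons)
  then have nz: "\<phi> \<noteq> 0" "\<phi> \<noteq> 1" using nd numer_eq_0_iff[of \<phi>] numer_eq_0_iff[of "1 - \<phi>"] by (auto simp: numer_one_minus)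
  have k: "1 / (b - a) \<noteq> 0" "1 / (a - b) \<noteq> 0" using assms by auto
  show ?thesis
  proof (rule that)
    show "div_num \<phi> = gen a"
      using nz poly_divisor_linear[OF k(1), of a] unfolding p_def[symmetric]
      by (simp add: div_num_def divisor_def nd poly_divisor_1)
    show "div_one_minus \<phi> = gen b"
      using nz poly_divisor_linear[OF k(2), of b]
      by (simp add: div_one_minus_def divisor_def nd numer_one_minus denom_one_minus poly_divisor_1 q del: smult_pCons)
  qed
qed

text \<open>The cross-ratio, which takes the values \<open>0\<close>, \<open>\<infinity>\<close>, \<open>1\<close> at \<open>a\<close>, \<open>b\<close>, \<open>c\<close>.\<close>

lemma cross_ratio_ratfun:
  assumes "a \<noteq> b" "a \<noteq> c" "b \<noteq> c"
  obtains \<phi> where "div_num \<phi> = gen a - gen b" "div_one_minus \<phi> = gen c - gen b"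
proof -
  define k where "k = (c - b) / (c - a)"
  have k: "k \<noteq> 0" "1 - k \<noteq> 0" using assms by (auto simp: k_def field_simps)
  define p q where "p = Polynomial.smult k [:- a, 1:]" and "q = [:- b, 1:]"
  define \<phi> where "\<phi> = Fract p q"
  have "coprime p q"
  proof (rule coprimeI)
    fix d assume p: "d dvd p" and q: "d dvd q"
    have "d dvd [:- a, 1:]" using p k(1) unfolding p_def by (rule dvd_smult_cancel)
    then have "d dvd [:- a, 1:] - [:- b, 1:]" using q unfolding q_def by (rule dvd_diff)
    also have "[:- a, 1:] - [:- b, 1:] = [:b - a:]" by simp
    finally show "is_unit d" using assms(1) by (auto elim: dvd_unit_imp_unit simp: is_unit_const_poly_iff dvd_field_iff)
  qed
  then have nd: "numer \<phi> = p" "denom \<phi> = q"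
    using numer_denom_Fract[of p q] by (simp_all add: \<phi>_def q_def unit_factor_linear)
  have "(1 - k) * c = b - k * a" using assms by (simp add: k_def field_simps)
  then have qp: "q - p = Polynomial.smult (1 - k) [:- c, 1:]"
    by (simp add: p_def q_def algebra_simps)
  have "p \<noteq> 0" using k by (simp add: p_def)
  moreover have "q - p \<noteq> 0" unfolding qp using k by simp
  ultimately have nz: "\<phi> \<noteq> 0" "\<phi> \<noteq> 1" using nd numer_eq_0_iff[of \<phi>] numer_eq_0_iff[of "1 - \<phi>"] by (auto simp: numer_one_minus)
  show ?thesis
  proof (rule that)
    show "div_num \<phi> = gen a - gen b"
      using nz poly_divisor_linear[OF k(1), of a] poly_divisor_linear[of 1 b]
      unfolding p_def[symmetric] by (simp add: div_num_def divisor_def nd flip: q_def)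
    show "div_one_minus \<phi> = gen c - gen b"
      using nz poly_divisor_linear[OF k(2), of c] poly_divisor_linear[of 1 b]
      by (simp add: div_one_minus_def divisor_def nd numer_one_minus denom_one_minus qp del: smult_pCons flip: q_def)
  qed
qed

lemma DS_spanned2:
  assumes H: "submodule H rat_ring (DS 2)" and g: "\<And>a b. star_coset 2 Div [gen a] (gen b) \<in> H"
  shows "H = carrier (DS 2)"
proof (rule S_star_spanned[OF module_Div H])
  fix xs and y :: "complex \<Rightarrow>\<^sub>0 rat" assume "xs \<in> tuples (2 - 1) Div"
  then obtain x where xs: "xs = [x]" by (auto simp: tuples_Div length_Suc_conv)
  have "ptensor x y \<in> {p \<in> carrier (free_space UNIV). basis2 p \<in> H}"
    by (rule free_space_spanned[OF submodule_preimage[OF module_free_space module_DS lin_map_basis2 H] _ UNIV_carrier])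
       (use g in \<open>auto simp: basis2_gen\<close>)
  then show "star_coset 2 Div xs y \<in> H" by (simp add: xs basis2_ptensor)
qed

lemma DS_spanned3:
  assumes H: "submodule H rat_ring (DS 3)" and g: "\<And>a b c. basis3 (gen (a, b, c)) \<in> H"
  shows "H = carrier (DS 3)"
proof (rule S_star_spanned[OF module_Div H])
  fix xs and y :: "complex \<Rightarrow>\<^sub>0 rat" assume "xs \<in> tuples (3 - 1) Div"
  then obtain x x' where xs: "xs = [x, x']" by (auto simp: tuples_Div length_Suc_conv numeral_2_eq_2)
  have "ptensor x (ptensor x' y) \<in> {p \<in> carrier (free_space UNIV). basis3 p \<in> H}"
    by (rule free_space_spanned[OF submodule_preimage[OF module_free_space module_DS lin_map_basis3 H] _ UNIV_carrier])
       (use g in auto)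
  then show "star_coset 3 Div xs y \<in> H" by (simp add: xs basis3_ptensor)
qed

lemma J2_surj: "J 2 ` carrier QCt = carrier (DS 2)"
proof (rule DS_spanned2[OF submodule_image[OF module_free_space module_DS lin_map_J]])
  fix a b
  show "star_coset 2 Div [gen a] (gen b) \<in> J 2 ` carrier QCt"
  proof (cases "a = b")
    case True
    have "basis2 (gen (a, b)) = \<zero>\<^bsub>DS 2\<^esub>"
      by (rule basis2_symmetric_eq_0) (auto simp: True lookup_single when_def)
    then show ?thesis
      using submoduleD(2)[OF module_DS submodule_image[OF module_free_space module_DS lin_map_J]] by (simp only: basis2_gen)
  next
    case False
    then obtain \<phi> where "div_num \<phi> = gen a" "div_one_minus \<phi> = gen b" by (rule affine_ratfun)
    then have "J 2 (gen \<phi>) = star_coset 2 Div [gen a] (gen b)" by (simp add: J_gen)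
    then show ?thesis by (metis UNIV_carrier image_eqI)
  qed
qed

text \<open>The computation takes place in the preimage \<open>K\<close> of the range under \<open>basis3\<close>. It contains \<open>[a][a][b]\<close> by
  \<open>affine_ratfun\<close>; the rotation relation and the symmetry in the first two factors, both valid modulo the
  kernel of \<open>basis3\<close>, add all triples with two equal entries. For distinct points the cross-ratio contributes
  \<open>([a] - [b]) \<otimes> ([a] - [b]) \<otimes> ([c] - [b])\<close>, which is \<open>- 2 [a][b][c]\<close> modulo these elements.\<close>

lemma J3_surj: "J 3 ` carrier QCt = carrier (DS 3)"
proof (rule DS_spanned3[OF submodule_image[OF module_free_space module_DS lin_map_J]])
  let ?H = "J 3 ` carrier QCt"
  define K where "K = {p \<in> carrier (free_space UNIV). basis3 p \<in> ?H}"
  have K: "submodule K rat_ring (free_space UNIV)"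
    unfolding K_def by (rule submodule_preimage[OF module_free_space module_DS lin_map_basis3
          submodule_image[OF module_free_space module_DS lin_map_J]])
  have Kadd: "x + y \<in> K" if "x \<in> K" "y \<in> K" for x y using submoduleD(3)[OF module_free_space K that] by simp
  have Kscale: "Poly_Mapping.map ((*) q) x \<in> K" if "x \<in> K" for q x using submoduleD(4)[OF module_free_space K that] by simp
  have Kdiff: "x - y \<in> K" if "x \<in> K" "y \<in> K" for x y
  proof -
    have "x - y = x + Poly_Mapping.map ((*) (-1)) y" by (rule poly_mapping_eqI) (simp add: lookup_add lookup_minus)
    then show ?thesis using Kadd[OF that(1) Kscale[OF that(2), of "-1"]] by metis
  qed
  have Khalf: "x \<in> K" if "x + x \<in> K" for x
  proof -
    have "Poly_Mapping.lookup (x + x) k = Poly_Mapping.lookup x k + Poly_Mapping.lookup x k" for k by (rule lookup_add)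
    then have "x = Poly_Mapping.map ((*) (1/2)) (x + x)" by (intro poly_mapping_eqI) (simp only: lookup_scale, simp)
    then show ?thesis using Kscale[OF that] by metis
  qed
  have Kzero: "p \<in> K" if "\<And>a b c. Poly_Mapping.lookup p (a, b, c) = Poly_Mapping.lookup p (b, c, a)" for p
    using basis3_symmetric_eq_0[OF that] submoduleD(2)[OF module_DS submodule_image[OF module_free_space module_DS lin_map_J]]
    by (simp add: K_def)
  have KJ: "ptensor (div_num \<phi>) (ptensor (div_num \<phi>) (div_one_minus \<phi>)) \<in> K" for \<phi>
    unfolding K_def using J3_eq_basis3[of "gen \<phi>"] by (simp add: coords3_gen) (metis image_eqI rangeI)
  have cyc: "gen (a, b, c) + gen (b, c, a) + gen (c, a, b) \<in> K" for a b c
  proof (rule Kzero)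
    have "Poly_Mapping.lookup (gen (a, b, c)) (x, y, z) = of_bool (a = x \<and> b = y \<and> c = z)" for a b c x y z :: complex
      by (simp add: lookup_single when_def)
    then show "Poly_Mapping.lookup (gen (a, b, c) + gen (b, c, a) + gen (c, a, b)) (x, y, z) =
        Poly_Mapping.lookup (gen (a, b, c) + gen (b, c, a) + gen (c, a, b)) (y, z, x)" for x y z
      by (simp only: lookup_add conj_ac add_ac)
  qed
  have Kswap: "gen (a, b, c) - gen (b, a, c) \<in> K" for a b c
  proof -
    have "basis3 (gen (a, b, c) - gen (b, a, c)) = \<zero>\<^bsub>DS 3\<^esub>"
      by (rule lin_map_free_minus[OF module_DS lin_map_basis3 UNIV_carrier UNIV_carrier])
         (simp only: basis3_gen star3_swap[of "gen a"])
    then show ?thesis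
      using submoduleD(2)[OF module_DS submodule_image[OF module_free_space module_DS lin_map_J]] by (simp add: K_def)
  qed
  have aab: "gen (a, a, b) \<in> K" for a b
  proof (cases "a = b")
    case True
    show ?thesis by (rule Kzero) (auto simp: True lookup_single when_def)
  next
    case False
    then obtain \<phi> where "div_num \<phi> = gen a" "div_one_minus \<phi> = gen b" by (rule affine_ratfun)
    then show ?thesis using KJ[of \<phi>] by (simp add: ptensor_gen)
  qed
  have aba: "gen (a, b, a) \<in> K" for a b
  proof (rule Khalf)
    have "gen (a, b, a) + gen (a, b, a) =
        (gen (a, a, b) + gen (a, b, a) + gen (b, a, a)) - gen (a, a, b) + (gen (a, b, a) - gen (b, a, a))"
      by simp
    then show "gen (a, b, a) + gen (a, b, a) \<in> K"
      using Kadd[OF Kdiff[OF cyc[of a a b] aab[of a b]] Kswap[of a b a]] by simp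
  qed
  have baa: "gen (b, a, a) \<in> K" for a b
    using Kdiff[OF aba[of a b] Kswap[of a b a]] by simp
  have abc: "gen (a, b, c) \<in> K" if distinct: "a \<noteq> b" "a \<noteq> c" "b \<noteq> c" for a b c
  proof (rule Khalf)
    obtain \<phi> where \<phi>: "div_num \<phi> = gen a - gen b" "div_one_minus \<phi> = gen c - gen b"
      using distinct by (rule cross_ratio_ratfun)
    define p where "p = ptensor (gen a - gen b) (ptensor (gen a - gen b) (gen c - gen b))"
    have pK: "p \<in> K" using KJ[of \<phi>] by (simp only: \<phi> p_def)
    have p: "p = gen (a, a, c) - gen (a, a, b) - gen (a, b, c) + gen (a, b, b) - gen (b, a, c) + gen (b, a, b)
        + gen (b, b, c) - gen (b, b, b)"
      by (simp add: p_def ptensor_simps ptensor_gen algebra_simps)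
    have "gen (a, b, c) + gen (a, b, c) = gen (a, a, c) - gen (a, a, b) + gen (a, b, b) + gen (b, a, b)
        + gen (b, b, c) - gen (b, b, b) - p + (gen (a, b, c) - gen (b, a, c))"
      by (simp add: p)
    also have "\<dots> \<in> K"
      by (intro Kadd Kdiff aab aba baa Kswap pK)
    finally show "gen (a, b, c) + gen (a, b, c) \<in> K" .
  qed
  fix a b c
  have "gen (a, b, c) \<in> K" using aab aba baa abc by (cases "a = b"; cases "a = c"; cases "b = c") auto
  then show "basis3 (gen (a, b, c)) \<in> ?H" by (simp add: K_def)
qed

section \<open>The kernel of \<open>J\<^sub>n\<close> is \<open>\<A>\<^sub>n\<close>\<close>

definition nonconst_keys :: "(ratfun \<Rightarrow>\<^sub>0 rat) \<Rightarrow> ratfun set" where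
  "nonconst_keys x = {\<phi> \<in> Poly_Mapping.keys x. \<not> const_ratfun \<phi>}"

definition coef :: "(ratfun \<Rightarrow>\<^sub>0 rat) \<Rightarrow> ratfun \<Rightarrow> real" where
  "coef x \<phi> = of_rat (Poly_Mapping.lookup x \<phi>)"

lemma nonconst_family: "ratfun_family (nonconst_keys x)"
  by standard (auto simp: nonconst_keys_def)

lemma value_at_const_ratfun: "const_ratfun \<phi> \<Longrightarrow> value_at \<phi> t = value_at \<phi> s"
  by (auto simp: const_ratfun_def value_at_const)

text \<open>The constant terms of \<open>x\<close> contribute the same number at every point and can be left out.\<close>

lemma A_grp_iff:
  "x \<in> A_grp n \<longleftrightarrow> (\<exists>c. \<forall>t\<in>regular_points n x.
     (\<Sum>\<phi>\<in>nonconst_keys x. coef x \<phi> * zagier n (value_at \<phi> t)) = c)"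
proof -
  \<comment> \<open>Constant functions may be evaluated anywhere, for instance at \<open>0\<close>.\<close>
  define k where "k = (\<Sum>\<phi>\<in>Poly_Mapping.keys x - nonconst_keys x. coef x \<phi> * zagier n (value_at \<phi> 0))"
  have "(\<Sum>\<phi>\<in>Poly_Mapping.keys x. of_rat (Poly_Mapping.lookup x \<phi>) * zagier n (value_at \<phi> t))
     = (\<Sum>\<phi>\<in>nonconst_keys x. coef x \<phi> * zagier n (value_at \<phi> t)) + k" for t
  proof -
    have "(\<Sum>\<phi>\<in>Poly_Mapping.keys x - nonconst_keys x. coef x \<phi> * zagier n (value_at \<phi> t)) = k"
      unfolding k_def
    proof (rule sum.cong[OF refl])
      fix \<phi> assume "\<phi> \<in> Poly_Mapping.keys x - nonconst_keys x"
      then have "value_at \<phi> t = value_at \<phi> 0" by (intro value_at_const_ratfun) (auto simp: nonconst_keys_def)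
      then show "coef x \<phi> * zagier n (value_at \<phi> t) = coef x \<phi> * zagier n (value_at \<phi> 0)" by simp
    qed
    moreover have "nonconst_keys x \<subseteq> Poly_Mapping.keys x" by (auto simp: nonconst_keys_def)
    ultimately show ?thesis
      using sum.subset_diff[of "nonconst_keys x" "Poly_Mapping.keys x" "\<lambda>\<phi>. coef x \<phi> * zagier n (value_at \<phi> t)"]
      by (simp add: coef_def)
  qed
  then have "x \<in> A_grp n \<longleftrightarrow> (\<exists>c. \<forall>t\<in>regular_points n x.
     (\<Sum>\<phi>\<in>nonconst_keys x. coef x \<phi> * zagier n (value_at \<phi> t)) + k = c)"
    by (simp add: A_grp_def)
  also have "\<dots> \<longleftrightarrow> (\<exists>c. \<forall>t\<in>regular_points n x.
     (\<Sum>\<phi>\<in>nonconst_keys x. coef x \<phi> * zagier n (value_at \<phi> t)) = c)"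
  proof
    assume "\<exists>c. \<forall>t\<in>regular_points n x. (\<Sum>\<phi>\<in>nonconst_keys x. coef x \<phi> * zagier n (value_at \<phi> t)) + k = c"
    then obtain c where "\<forall>t\<in>regular_points n x. (\<Sum>\<phi>\<in>nonconst_keys x. coef x \<phi> * zagier n (value_at \<phi> t)) + k = c" ..
    then have "\<forall>t\<in>regular_points n x. (\<Sum>\<phi>\<in>nonconst_keys x. coef x \<phi> * zagier n (value_at \<phi> t)) = c - k" by force
    then show "\<exists>c. \<forall>t\<in>regular_points n x. (\<Sum>\<phi>\<in>nonconst_keys x. coef x \<phi> * zagier n (value_at \<phi> t)) = c" ..
  qed auto
  finally show ?thesis .
qed

lemma div_const:
  assumes "const_ratfun \<phi>"
  shows "div_num \<phi> = 0"
proof -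
  obtain c where "\<phi> = to_fract [:c:]" using assms by (auto simp: const_ratfun_def)
  then show ?thesis using divisor_const[of c] by (cases "c = 0") (auto simp: div_num_def)
qed

lemma lookup_div_nonconst:
  assumes "\<phi> \<in> nonconst_keys x"
  shows "of_rat (Poly_Mapping.lookup (div_num \<phi>) a) = ord_at a \<phi>"
    and "of_rat (Poly_Mapping.lookup (div_one_minus \<phi>) a) = ord_at a (1 - \<phi>)"
  using assms const_ratfun_1 by (auto simp: nonconst_keys_def div_num_def div_one_minus_def ord_at_def)

text \<open>Constants have divisor \<open>0\<close>, so the algebraic side does not see them either.\<close>

lemma sum_nonconst:
  assumes "\<And>\<phi>. const_ratfun \<phi> \<Longrightarrow> f \<phi> = 0"
  shows "(\<Sum>\<phi>\<in>Poly_Mapping.keys x. f \<phi>) = (\<Sum>\<phi>\<in>nonconst_keys x. f \<phi>)"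
  by (rule sum.mono_neutral_right) (use assms in \<open>auto simp: nonconst_keys_def\<close>)

lemma real_J1: "of_rat (Poly_Mapping.lookup (J1 x) a) = (\<Sum>\<phi>\<in>nonconst_keys x. coef x \<phi> * ord_at a \<phi>)"
proof -
  have "Poly_Mapping.lookup (J1 x) a = (\<Sum>\<phi>\<in>nonconst_keys x. Poly_Mapping.lookup x \<phi> * Poly_Mapping.lookup (div_num \<phi>) a)"
    unfolding lookup_J1 by (rule sum_nonconst) (simp add: div_const)
  then show ?thesis by (simp add: of_rat_sum of_rat_mult coef_def lookup_div_nonconst)
qed

lemma real_coords2: "of_rat (Poly_Mapping.lookup (coords2 x) (a, b)) =
    (\<Sum>\<phi>\<in>nonconst_keys x. coef x \<phi> * (ord_at a \<phi> * ord_at b (1 - \<phi>)))"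
proof -
  have "Poly_Mapping.lookup (coords2 x) (a, b) = (\<Sum>\<phi>\<in>nonconst_keys x. Poly_Mapping.lookup x \<phi> *
    (Poly_Mapping.lookup (div_num \<phi>) a * Poly_Mapping.lookup (div_one_minus \<phi>) b))"
    unfolding lookup_coords2 by (rule sum_nonconst) (simp add: div_const)
  then show ?thesis by (simp add: of_rat_sum of_rat_mult coef_def lookup_div_nonconst)
qed

lemma real_coords3: "of_rat (Poly_Mapping.lookup (coords3 x) (a, b, c)) =
    (\<Sum>\<phi>\<in>nonconst_keys x. coef x \<phi> * (ord_at a \<phi> * (ord_at b \<phi> * ord_at c (1 - \<phi>))))"
proof -
  have "Poly_Mapping.lookup (coords3 x) (a, b, c) = (\<Sum>\<phi>\<in>nonconst_keys x. Poly_Mapping.lookup x \<phi> *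
    (Poly_Mapping.lookup (div_num \<phi>) a * (Poly_Mapping.lookup (div_num \<phi>) b * Poly_Mapping.lookup (div_one_minus \<phi>) c)))"
    unfolding lookup_coords3 by (rule sum_nonconst) (simp add: div_const)
  then show ?thesis by (simp add: of_rat_sum of_rat_mult coef_def lookup_div_nonconst)
qed

lemma regular_points_eq:
  assumes "n \<ge> 2"
  shows "regular_points n x = - ratfun_family.A (nonconst_keys x)"
proof -
  interpret F: ratfun_family "nonconst_keys x" by (rule nonconst_family)
  show ?thesis using assms unfolding regular_points_def F.A_def by (auto simp: nonconst_keys_def)
qed

text \<open>The points outside \<open>A\<close> are added to \<open>f2_const_imp_wedge_0\<close> and its converse: all orders vanish there.\<close>

lemma A_grp_2_iff: "x \<in> A_grp 2 \<longleftrightarrow> J 2 x = \<zero>\<^bsub>DS 2\<^esub>"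
proof -
  interpret F: ratfun_family "nonconst_keys x" by (rule nonconst_family)
  have wedge: "F.wedge (coef x) b a = of_rat (Poly_Mapping.lookup (coords2 x) (b, a)) - of_rat (Poly_Mapping.lookup (coords2 x) (a, b))" for a b
    unfolding F.wedge_def real_coords2 sum_subtractf[symmetric] by (intro sum.cong refl) (simp add: algebra_simps)
  have out: "F.wedge (coef x) b a = 0" if "a \<notin> F.A \<or> b \<notin> F.A" for a b
    unfolding F.wedge_def
  proof (intro sum.neutral ballI)
    fix \<phi> assume \<phi>: "\<phi> \<in> nonconst_keys x"
    have "ord_at s \<phi> = 0" "ord_at s (1 - \<phi>) = 0" if "s \<notin> F.A" for s
      using F.nz[OF \<phi>] F.regular[OF \<phi> that] F.regular_one_minus[OF \<phi> that] by (blast intro: ord_at_eq_0)+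
    then show "coef x \<phi> * (ord_at b \<phi> * ord_at a (1 - \<phi>) - ord_at b (1 - \<phi>) * ord_at a \<phi>) = 0" using that by auto
  qed
  have "x \<in> A_grp 2 \<longleftrightarrow> (\<exists>c. \<forall>t. t \<notin> F.A \<longrightarrow> F.f2 (coef x) t = c)"
    unfolding A_grp_iff F.f2_def by (simp add: regular_points_eq Ball_def)
  also have "\<dots> \<longleftrightarrow> (\<forall>a b. F.wedge (coef x) b a = 0)"
    using F.f2_const_imp_wedge_0[of "coef x"] F.wedge_0_imp_f2_const[of "coef x"] out by blast
  also have "\<dots> \<longleftrightarrow> J 2 x = \<zero>\<^bsub>DS 2\<^esub>"
    unfolding J2_eq_0_iff wedge by auto
  finally show ?thesis .
qed

lemma A_grp_3_iff: "x \<in> A_grp 3 \<longleftrightarrow> J 3 x = \<zero>\<^bsub>DS 3\<^esub>"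
proof -
  interpret F: ratfun_family "nonconst_keys x" by (rule nonconst_family)
  have trip: "F.trip (coef x) a b c = of_rat (Poly_Mapping.lookup (coords3 x) (a, b, c))" for a b c
    unfolding F.trip_def real_coords3 ..
  have out: "F.trip (coef x) a b c = 0" if "a \<notin> F.A \<or> b \<notin> F.A \<or> c \<notin> F.A" for a b c
    unfolding F.trip_def
  proof (intro sum.neutral ballI)
    fix \<phi> assume \<phi>: "\<phi> \<in> nonconst_keys x"
    have "ord_at s \<phi> = 0" "ord_at s (1 - \<phi>) = 0" if "s \<notin> F.A" for s
      using F.nz[OF \<phi>] F.regular[OF \<phi> that] F.regular_one_minus[OF \<phi> that] by (blast intro: ord_at_eq_0)+
    then show "coef x \<phi> * (ord_at a \<phi> * (ord_at b \<phi> * ord_at c (1 - \<phi>))) = 0" using that by auto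
  qed
  have "x \<in> A_grp 3 \<longleftrightarrow> (\<exists>c. \<forall>t. t \<notin> F.A \<longrightarrow> F.f3 (coef x) t = c)"
    unfolding A_grp_iff F.f3_def by (simp add: regular_points_eq Ball_def)
  also have "\<dots> \<longleftrightarrow> (\<forall>a b c. F.trip (coef x) a b c = F.trip (coef x) a c b)"
  proof
    assume "\<exists>c. \<forall>t. t \<notin> F.A \<longrightarrow> F.f3 (coef x) t = c"
    then obtain k where k: "\<And>t. t \<notin> F.A \<Longrightarrow> F.f3 (coef x) t = k" by blast
    show "\<forall>a b c. F.trip (coef x) a b c = F.trip (coef x) a c b"
    proof (intro allI)
      fix a b c
      show "F.trip (coef x) a b c = F.trip (coef x) a c b"
      proof (cases "a \<in> F.A \<and> b \<in> F.A \<and> c \<in> F.A")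
        case True
        then show ?thesis using F.f3_const_imp_trip_symmetric[OF k] by blast
      next
        case False
        then have "F.trip (coef x) a b c = 0" "F.trip (coef x) a c b = 0" using out by blast+
        then show ?thesis by simp
      qed
    qed
  qed (rule F.trip_symmetric_imp_f3_const, blast)
  also have "\<dots> \<longleftrightarrow> J 3 x = \<zero>\<^bsub>DS 3\<^esub>"
    unfolding J3_eq_0_iff trip by auto
  finally show ?thesis .
qed

text \<open>On the regular points, which may include those where some \<open>\<phi>\<close> is \<open>1\<close>, the sum of the \<open>ln |\<phi>|\<close> is a
  constant plus the combination of the \<open>ln |t - a|\<close> with the coordinates of the divisor as coefficients.\<close>

lemma A_grp_1_iff: "x \<in> A_grp 1 \<longleftrightarrow> J1 x = \<zero>\<^bsub>Div\<^esub>"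
proof -
  interpret F: ratfun_family "nonconst_keys x" by (rule nonconst_family)
  define A where "A = (\<Union>\<phi>\<in>nonconst_keys x. {t. \<not> (finite_at \<phi> t \<and> value_at \<phi> t \<noteq> 0)})"
  have A: "finite A" by (rule finite_subset[OF _ F.finite_A]) (auto simp: A_def F.A_def)
  have reg: "finite_at \<phi> t \<and> value_at \<phi> t \<noteq> 0" if "\<phi> \<in> nonconst_keys x" "t \<notin> A" for \<phi> t
    using that by (auto simp: A_def)
  have rp: "regular_points 1 x = - A"
    unfolding regular_points_def A_def nonconst_keys_def by auto
  define V where "V a = (\<Sum>\<phi>\<in>nonconst_keys x. coef x \<phi> * ord_at a \<phi>)" for a
  define k where "k = (\<Sum>\<phi>\<in>nonconst_keys x. coef x \<phi> * ln_lead_at \<phi>)"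
  have out: "V a = 0" if "a \<notin> A" for a
    unfolding V_def using F.nz reg[OF _ that] by (intro sum.neutral) (auto simp: ord_at_eq_0)
  have sum: "(\<Sum>\<phi>\<in>nonconst_keys x. coef x \<phi> * zagier 1 (value_at \<phi> t)) = (\<Sum>a\<in>A. V a * ln (cmod (t - a))) + k" if t: "t \<notin> A" for t
  proof -
    have "(\<Sum>\<phi>\<in>nonconst_keys x. coef x \<phi> * zagier 1 (value_at \<phi> t)) =
        (\<Sum>\<phi>\<in>nonconst_keys x. (\<Sum>a\<in>A. coef x \<phi> * ord_at a \<phi> * ln (cmod (t - a))) + coef x \<phi> * ln_lead_at \<phi>)"
    proof (rule sum.cong[OF refl])
      fix \<phi> assume \<phi>: "\<phi> \<in> nonconst_keys x"
      have "ln (cmod (value_at \<phi> t)) = ln_lead_at \<phi> + (\<Sum>a\<in>A. ord_at a \<phi> * ln (cmod (t - a)))"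
        by (rule ln_cmod_value_at) (use F.nz[OF \<phi>] A reg[OF \<phi>] t in blast)+
      then show "coef x \<phi> * zagier 1 (value_at \<phi> t) = (\<Sum>a\<in>A. coef x \<phi> * ord_at a \<phi> * ln (cmod (t - a))) + coef x \<phi> * ln_lead_at \<phi>"
        by (simp add: zagier_def algebra_simps sum_distrib_left)
    qed
    also have "\<dots> = (\<Sum>a\<in>A. V a * ln (cmod (t - a))) + k"
      unfolding sum.distrib k_def V_def sum_distrib_right by (subst sum.swap) simp
    finally show ?thesis .
  qed
  have "x \<in> A_grp 1 \<longleftrightarrow> (\<exists>c. \<forall>t. t \<notin> A \<longrightarrow> (\<Sum>a\<in>A. V a * ln (cmod (t - a))) + k = c)"
    unfolding A_grp_iff rp using sum by auto
  also have "\<dots> \<longleftrightarrow> (\<forall>a. V a = 0)"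
  proof
    assume "\<exists>c. \<forall>t. t \<notin> A \<longrightarrow> (\<Sum>a\<in>A. V a * ln (cmod (t - a))) + k = c"
    then obtain c where c: "\<And>t. t \<notin> A \<Longrightarrow> (\<Sum>a\<in>A. V a * ln (cmod (t - a))) + k = c" by blast
    show "\<forall>a. V a = 0"
    proof
      fix a show "V a = 0"
      proof (cases "a \<in> A")
        case True
        have "complex_of_real (V a) = 0"
        \<comment> \<open>Dividing by \<open>t - b\<close> and by the conjugate of \<open>t - d\<close>, for all \<open>b\<close> and \<open>d\<close>, puts the relation into the
            form to which independence applies; hence \<open>T\<close> does not depend on its last two arguments.\<close>
        proof (rule log_pole_independent[OF A _ True True True, where T = "\<lambda>a _ _. of_real (V a)" and k = "\<lambda>_ _. of_real (k - c)"])
          fix t assume t: "t \<notin> A"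
          have "(\<Sum>a\<in>A. complex_of_real (V a) * of_real (ln (cmod (t - a)))) + of_real (k - c)
              = of_real ((\<Sum>a\<in>A. V a * ln (cmod (t - a))) + k - c)" by simp
          also have "\<dots> = 0" using c[OF t] by simp
          finally show "(\<Sum>b\<in>A. \<Sum>d\<in>A. ((\<Sum>a\<in>A. complex_of_real (V a) * of_real (ln (cmod (t - a)))) + of_real (k - c)) /
              ((t - b) * cnj (t - d))) = 0" by simp
        qed
        then show ?thesis by simp
      qed (rule out)
    qed
  qed simp
  also have "\<dots> \<longleftrightarrow> (\<forall>a. Poly_Mapping.lookup (J1 x) a = 0)"
    unfolding V_def real_J1[symmetric] by simp
  also have "\<dots> \<longleftrightarrow> J1 x = \<zero>\<^bsub>Div\<^esub>"
    by (auto intro: poly_mapping_eqI)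
  finally show ?thesis .
qed

theorem theorem1p5:
  shows "(J1 ` carrier QCt = carrier Div \<and>
          J 2 ` carrier QCt = carrier (S_star 2 Div) \<and>
          J 3 ` carrier QCt = carrier (S_star 3 Div)) \<and>
         induces_iso QCt (A_grp 1) Div J1 \<and>
         induces_iso QCt (A_grp 2) (S_star 2 Div) (J 2) \<and>
         induces_iso QCt (A_grp 3) (S_star 3 Div) (J 3)"
proof (intro conjI)
  show "induces_iso QCt (A_grp 1) Div J1"
    by (rule induces_isoI[OF module_free_space module_Div lin_map_J1 J1_surj]) (use A_grp_1_iff in auto)
  show "induces_iso QCt (A_grp 2) (S_star 2 Div) (J 2)"
    by (rule induces_isoI[OF module_free_space module_DS lin_map_J J2_surj]) (use A_grp_2_iff in auto)
  show "induces_iso QCt (A_grp 3) (S_star 3 Div) (J 3)"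
    by (rule induces_isoI[OF module_free_space module_DS lin_map_J J3_surj]) (use A_grp_3_iff in auto)
qed (rule J1_surj J2_surj J3_surj)+

end
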